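(* For every $n=14$ and every $n\ge 16$, there exists a quasi-optimal 1-plane graph with $n$ vertices containing two odd-degree vertices.
   Context: All graphs are finite and simple. A drawing of a graph maps vertices to distinct points of the plane and edges to arcs joining the images of their endpoints; all drawings are good: no edge crosses itself, two edges cross at most once, and edges sharing an endpoint do not cross. A drawing is 1-planar if every edge is crossed at most once; a 1-plane graph is a graph together with a fixed 1-planar drawing. An optimal 1-planar graph is a maximal 1-planar graph (adding any edge destroys 1-planarity or simplicity) with $n$ vertices and $4n-8$ edges; it has a unique 1-planar drawing up to isomorphism, and the graph with this drawing is an optimal 1-plane graph. For a 1-plane graph $G$, $G^\times$ is the plane graph obtained by replacing each crossing by a new vertex of degree 4. An edge is non-crossing if it crosses no other edge. Edge merging: given 1-plane graphs $G_1,G_2$ with non-crossing edges $e_1,e_2$, the graph $G_1\ominus G_2$ is obtained by redrawing $G_2$ so that $e_2$ lies on the boundary of the infinite face of $G_2^\times$, choosing a face $F$ of $G_1^\times$ whose boundary contains $e_1$, inserting $G_2$ into $F$ and identifying $e_1$ with $e_2$ (including endpoints). Quasi-optimal 1-plane graphs: every optimal 1-plane graph is quasi-optimal; the edge merging of two quasi-optimal 1-plane graphs is quasi-optimal; and these are the only ones (finitely many steps). *)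

theory Defs
  imports "HOL-Analysis.Analysis"
begin

section \<open>Drawings of finite simple graphs\<close>

text \<open>The plane is the type complex.  The field loc places the vertices, and curve assigns to
  an edge the point set of the arc representing it.  Their values outside verts and edges are
  irrelevant.\<close>

record 'v drawn_graph =
  verts :: "'v set"
  edges :: "'v set set"
  loc :: "'v \<Rightarrow> complex"
  curve :: "'v set \<Rightarrow> complex set"

definition simple_graph :: "'v set \<Rightarrow> 'v set set \<Rightarrow> bool" where
  "simple_graph V E \<longleftrightarrow> finite V \<and> (\<forall>e\<in>E. e \<subseteq> V \<and> card e = 2)"

definition vertex_degree :: "'v drawn_graph \<Rightarrow> 'v \<Rightarrow> nat" where
  "vertex_degree G v = card {e \<in> edges G. v \<in> e}"

text \<open>A common point of two curves is a crossing if, up to a local homeomorphism, the curves look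
  there like the two coordinate axes; touching points are thereby excluded.\<close>

definition crosses_at :: "complex set \<Rightarrow> complex set \<Rightarrow> complex \<Rightarrow> bool" where
  "crosses_at A B x \<longleftrightarrow>
     (\<exists>U h k. open U \<and> x \<in> U \<and> homeomorphism U (ball 0 1) h k \<and> h x = 0 \<and>
        h ` (A \<inter> U) = {z \<in> ball 0 1. Im z = 0} \<and>
        h ` (B \<inter> U) = {z \<in> ball 0 1. Re z = 0})"

definition crossings :: "'v drawn_graph \<Rightarrow> 'v set \<Rightarrow> 'v set \<Rightarrow> complex set" where
  "crossings G e f = {x. crosses_at (curve G e) (curve G f) x}"

definition crosses :: "'v drawn_graph \<Rightarrow> 'v set \<Rightarrow> 'v set \<Rightarrow> bool" where
  "crosses G e f \<longleftrightarrow> e \<noteq> f \<and> crossings G e f \<noteq> {}"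

text \<open>As usual, an edge passes through no vertex other than its endpoints, and distinct edges meet
  only in common endpoints and in crossings.\<close>

definition drawing :: "'v drawn_graph \<Rightarrow> bool" where
  "drawing G \<longleftrightarrow>
     simple_graph (verts G) (edges G) \<and>
     inj_on (loc G) (verts G) \<and>
     (\<forall>e\<in>edges G. \<exists>g. arc g \<and> path_image g = curve G e \<and>
        {pathstart g, pathfinish g} = loc G ` e) \<and>
     (\<forall>e\<in>edges G. curve G e \<inter> loc G ` verts G = loc G ` e) \<and>
     (\<forall>e\<in>edges G. \<forall>f\<in>edges G. e \<noteq> f \<longrightarrow>
        curve G e \<inter> curve G f = loc G ` (e \<inter> f) \<union> crossings G e f)"

text \<open>That no edge crosses itself is already part of drawing, because arcs are injective.\<close>

definition good_drawing :: "'v drawn_graph \<Rightarrow> bool" where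
  "good_drawing G \<longleftrightarrow>
     drawing G \<and>
     (\<forall>e\<in>edges G. \<forall>f\<in>edges G. e \<noteq> f \<longrightarrow>
        (\<forall>x\<in>crossings G e f. \<forall>y\<in>crossings G e f. x = y)) \<and>
     (\<forall>e\<in>edges G. \<forall>f\<in>edges G. e \<inter> f \<noteq> {} \<longrightarrow> \<not> crosses G e f)"

section \<open>1-planarity and optimality\<close>

text \<open>In a good drawing a pair of edges crosses at most once, so an edge is crossed at most once iff
  at most one other edge crosses it.\<close>

definition one_plane :: "'v drawn_graph \<Rightarrow> bool" where
  "one_plane G \<longleftrightarrow>
     good_drawing G \<and>
     (\<forall>e\<in>edges G. \<forall>f\<in>edges G. \<forall>g\<in>edges G. crosses G e f \<and> crosses G e g \<longrightarrow> f = g)"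

definition one_planar :: "'v set \<Rightarrow> 'v set set \<Rightarrow> bool" where
  "one_planar V E \<longleftrightarrow> (\<exists>G. one_plane G \<and> verts G = V \<and> edges G = E)"

definition maximal_one_planar :: "'v set \<Rightarrow> 'v set set \<Rightarrow> bool" where
  "maximal_one_planar V E \<longleftrightarrow>
     one_planar V E \<and>
     (\<forall>u\<in>V. \<forall>v\<in>V. u \<noteq> v \<and> {u, v} \<notin> E \<longrightarrow> \<not> one_planar V (insert {u, v} E))"

text \<open>The edge count is 4n - 8, written without truncating subtraction.\<close>

definition optimal_one_planar :: "'v set \<Rightarrow> 'v set set \<Rightarrow> bool" where
  "optimal_one_planar V E \<longleftrightarrow> maximal_one_planar V E \<and> card E + 8 = 4 * card V"

definition optimal_one_plane :: "'v drawn_graph \<Rightarrow> bool" where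
  "optimal_one_plane G \<longleftrightarrow> one_plane G \<and> optimal_one_planar (verts G) (edges G)"

section \<open>Faces and edge merging\<close>

definition skeleton :: "'v drawn_graph \<Rightarrow> complex set" where
  "skeleton G = loc G ` verts G \<union> (\<Union>e\<in>edges G. curve G e)"

text \<open>These are the faces of the planarization: turning crossings into vertices does not change the
  underlying point set of the drawing.\<close>

definition faces :: "'v drawn_graph \<Rightarrow> complex set set" where
  "faces G = components (- skeleton G)"

definition non_crossing :: "'v drawn_graph \<Rightarrow> 'v set \<Rightarrow> bool" where
  "non_crossing G e \<longleftrightarrow> e \<in> edges G \<and> (\<forall>f\<in>edges G. \<not> crosses G e f)"

text \<open>The sphere is the one-point compactification of the plane; None is the point at infinity.\<close>

abbreviation plane_sphere :: "complex option topology" where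
  "plane_sphere \<equiv> Alexandroff_compactification euclidean"

text \<open>H is G drawn again (with vertices renamed by s): some homeomorphism of the sphere carries one
  drawing to the other.  Such a homeomorphism can turn any face into the infinite one.\<close>

definition redrawing :: "('v \<Rightarrow> 'v) \<Rightarrow> 'v drawn_graph \<Rightarrow> 'v drawn_graph \<Rightarrow> bool" where
  "redrawing s G H \<longleftrightarrow>
     bij_betw s (verts G) (verts H) \<and>
     edges H = (\<lambda>e. s ` e) ` edges G \<and>
     (\<exists>\<phi>. homeomorphic_map plane_sphere plane_sphere \<phi> \<and>
        (\<forall>v\<in>verts G. \<phi> (Some (loc G v)) = Some (loc H (s v))) \<and>
        (\<forall>e\<in>edges G. \<phi> ` Some ` curve G e = Some ` curve H (s ` e)))"

text \<open>H is a redrawing of the second graph in which its edge e2 has become e1, endpoints and curve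
  included; apart from that edge H is disjoint from the first graph and lies in the face F.\<close>

definition edge_merging ::
  "'v drawn_graph \<Rightarrow> 'v set \<Rightarrow> 'v drawn_graph \<Rightarrow> 'v set \<Rightarrow> 'v drawn_graph \<Rightarrow> bool" where
  "edge_merging G1 e1 G2 e2 G \<longleftrightarrow>
     one_plane G1 \<and> one_plane G2 \<and> non_crossing G1 e1 \<and> non_crossing G2 e2 \<and>
     (\<exists>s H F F'. redrawing s G2 H \<and>
        F' \<in> faces H \<and> \<not> bounded F' \<and> curve H (s ` e2) \<subseteq> frontier F' \<and>
        F \<in> faces G1 \<and> curve G1 e1 \<subseteq> frontier F \<and>
        s ` e2 = e1 \<and> verts G1 \<inter> verts H = e1 \<and>
        (\<forall>v\<in>e1. loc H v = loc G1 v) \<and> curve H e1 = curve G1 e1 \<and>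
        skeleton H - curve H e1 \<subseteq> F \<and>
        verts G = verts G1 \<union> verts H \<and> edges G = edges G1 \<union> edges H \<and>
        (\<forall>v\<in>verts G1. loc G v = loc G1 v) \<and> (\<forall>v\<in>verts H. loc G v = loc H v) \<and>
        (\<forall>e\<in>edges G1. curve G e = curve G1 e) \<and> (\<forall>e\<in>edges H. curve G e = curve H e))"

inductive quasi_optimal :: "'v drawn_graph \<Rightarrow> bool" where
  optimal: "optimal_one_plane G \<Longrightarrow> quasi_optimal G"
| merging: "quasi_optimal G1 \<Longrightarrow> quasi_optimal G2 \<Longrightarrow> edge_merging G1 e1 G2 e2 G \<Longrightarrow> quasi_optimal G"

definition odd_vertices :: "'v drawn_graph \<Rightarrow> 'v set" where
  "odd_vertices G = {v \<in> verts G. odd (vertex_degree G v)}"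

end

theory Submission imports Defs begin

text \<open>Merging two optimal 1-plane graphs along an edge ab turns the degrees of a and b, which are even in
  both, into odd ones and leaves all other degrees even; so it suffices to draw optimal 1-planar graphs
  with 8 and with each m >= 10 vertices and to merge them, for a total of 8 + m - 2 vertices.

  Four straight-line patterns with 8, 10, 11 and 13 vertices, each closed by two bent edges and with a square
  face into which nested squares are inserted four vertices at a time, give all these m.  The maximality
  required of an optimal graph is the bound 4n - 8 on the number of edges of a 1-planar drawing.  For plane
  graphs drawn with arbitrary arcs the analogous bounds 3n - 6 and (in the bipartite case) 2n - 4 are obtained
  from Janiszewski's theorem: an arc whose ends are already joined by a path raises the number of faces, and
  an arc touches at most two faces.\<close>

section \<open>Faces touching an arc\<close>

text \<open>An optimal 1-planar graph is a quadrangulation with both diagonals in each of its n - 2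
  faces, so 2n - 4 + 2(n - 2) edges. A vertex on k edges of the quadrangulation lies on k faces and
  gets one diagonal in each; this is why all degrees are even. Merging identifies one edge, so each
  of its ends gets the sum of two even degrees minus one. The unbounded face needs its two diagonals
  as well, and outside a convex frame they cannot be straight: hence the bent edges. Residue 1
  modulo 4 starts at 13 because no optimal graph has 9 vertices, which leaves the gap at n = 15. The
  obstacle is that maximality speaks of every drawing of the enlarged graph, with arcs of any shape.
  The edge bound is thus a statement of plane topology. Faces are treated as components of
  complements, without boundary walks, and of Euler's formula only the inequality that guarantees
  many faces is proved, the direction that bounds the number of edges from above. The concrete
  drawings, by contrast, are reduced to sign tests on integers that are settled by
  evaluation.\<close>

lemma arc_image_empty_interior:
  fixes g :: "real \<Rightarrow> complex"
  assumes "arc g" "open U" "U \<noteq> {}"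
  shows "\<not> U \<subseteq> path_image g"
proof
  assume U: "U \<subseteq> path_image g"
  obtain h where h: "homeomorphism {0..1} (path_image g) g h"
    using homeomorphism_arc[OF assms(1)] by blast
  have "continuous_on U h" "inj_on h U"
    using h U by (auto simp: homeomorphism_def continuous_on_subset intro!: inj_on_inverseI[of U g h])
  then have "DIM(complex) \<le> DIM(real)"
    using invariance_of_dimension assms by blast
  then show False by simp
qed

lemma connected_component_subset_ball:
  fixes S :: "complex set"
  assumes "ball p r \<subseteq> S" "x \<in> ball p r" "y \<in> ball p r"
  shows "connected_component S x y"
  using assms unfolding connected_component_def by (metis connected_ball)

lemma arc_open_image:
  assumes "arc g"
  shows "g ` {0<..<1} = path_image g - {pathstart g, pathfinish g}"
  using simple_path_endless arc_imp_simple_path assms by metis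

text \<open>Shrinking the arc near a missed interior point leaves two arcs hanging on X, and these do not
  separate the plane any further.\<close>

lemma component_closure_contains_arc:
  fixes X :: "complex set"
  assumes X: "compact X" and g: "arc g" and gX: "path_image g \<inter> X = {pathstart g, pathfinish g}"
    and D: "D \<in> components (- (X \<union> path_image g))" and x: "x \<in> D"
    and y: "y \<in> g ` {0<..<1}" and xy: "connected_component (- X) x y"
  shows "g ` {0<..<1} \<subseteq> closure D"
proof
  fix p assume "p \<in> g ` {0<..<1}"
  then obtain t where t: "0 < t" "t < 1" "p = g t" by auto
  show "p \<in> closure D"
  proof (rule ccontr)
    assume "p \<notin> closure D"
    then obtain r where "r > 0" "ball p r \<subseteq> - closure D"
      using open_contains_ball[of "- closure D"] by auto
    then have r: "r > 0" "ball p r \<inter> D = {}" "ball p r \<inter> closure D = {}"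
      using closure_subset[of D] by auto
    have cont: "continuous_on {0..1} g" using g by (simp add: arc_def path_def)
    have "t \<in> {0..1}" using t by auto
    then obtain d where d: "d > 0" "\<And>s. s \<in> {0..1} \<Longrightarrow> dist s t < d \<Longrightarrow> dist (g s) (g t) < r"
      using cont r(1) unfolding continuous_on_iff by blast
    define e where "e = min (d/2) (min (t/2) ((1-t)/2))"
    have e: "e > 0" "e < d" "e < t" "e < 1 - t" using d t by (auto simp: e_def min_def)
    define t1 t2 where "t1 = t - e" and "t2 = t + e"
    have tt: "0 < t1" "t1 < t" "t < t2" "t2 < 1" using e t by (auto simp: t1_def t2_def)
    have mid: "g s \<in> ball p r" if "s \<in> {t1..t2}" for s
      using d(2)[of s] that tt e by (auto simp: t dist_commute t1_def t2_def dist_real_def)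
    let ?A1 = "g ` {0..t1}" and ?A2 = "g ` {t2..1}"
    have inj: "g s \<noteq> g s'" if "s \<in> {0..1}" "s' \<in> {0..1}" "s \<noteq> s'" for s s'
      using that g by (auto simp: arc_def inj_on_def)
    have A1: "compact ?A1" "connected (- ?A1)"
    proof -
      have a: "arc (subpath 0 t1 g)" using arc_subpath_arc[OF g, of 0 t1] tt by auto
      have i: "path_image (subpath 0 t1 g) = ?A1" using tt by (simp add: path_image_subpath)
      show "compact ?A1" "connected (- ?A1)"
        using connected_arc_complement[OF a] compact_arc_image[OF a] i by auto
    qed
    have A2: "compact ?A2" "connected (- ?A2)"
    proof -
      have a: "arc (subpath t2 1 g)" using arc_subpath_arc[OF g, of t2 1] tt by auto
      have i: "path_image (subpath t2 1 g) = ?A2" using tt by (simp add: path_image_subpath)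
      show "compact ?A2" "connected (- ?A2)"
        using connected_arc_complement[OF a] compact_arc_image[OF a] i by auto
    qed
    have inX: "g s \<in> X \<longleftrightarrow> s = 0 \<or> s = 1" if "s \<in> {0..1}" for s
    proof -
      have "g s \<in> X \<longleftrightarrow> g s \<in> {g 0, g 1}"
        using gX that by (auto simp: path_image_def pathstart_def pathfinish_def)
      then show ?thesis using inj[of s 0] inj[of s 1] that by auto
    qed
    have xD: "x \<notin> X" "x \<notin> path_image g"
      using in_components_subset[OF D] x by auto
    have sub: "?A1 \<subseteq> path_image g" "?A2 \<subseteq> path_image g" using tt by (auto simp: path_image_def)
    have p: "p \<notin> X" "p \<notin> ?A1" "p \<notin> ?A2"
      using inX[of t] tt by (auto simp: t) (use inj[of t] tt in \<open>force+\<close>)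
    have "connected_component (- X) y p"
    proof -
      have "connected (g ` {0<..<1})"
        using cont by (intro connected_continuous_image) (auto intro: continuous_on_subset)
      moreover have "g ` {0<..<1} \<subseteq> - X" using inX by auto
      ultimately show ?thesis
        using y \<open>p \<in> g ` {0<..<1}\<close> unfolding connected_component_def by blast
    qed
    then have xp: "connected_component (- X) x p"
      using xy connected_component_trans by metis
    have c1: "connected_component (- ?A1) x p"
      using A1(2) xD sub p unfolding connected_iff_connected_component by blast
    have c2: "connected_component (- ?A2) x p"
      using A2(2) xD sub p unfolding connected_iff_connected_component by blast
    \<comment> \<open>Janiszewski's theorem asks for a connected intersection. Each end piece of the
      arc meets what is already there in one point only, an end of \<open>g\<close>.\<close>
    have "X \<inter> ?A1 = {g 0}" using inX tt by auto
    then have 1: "connected_component (- (X \<union> ?A1)) x p"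
      using Janiszewski[OF X compact_imp_closed[OF A1(1)] _ xp c1] by simp
    have "(X \<union> ?A1) \<inter> ?A2 = {g 1}" using inX tt inj[of 1] inj by auto
    then have 2: "connected_component (- (X \<union> ?A1 \<union> ?A2)) x p"
      using Janiszewski[OF compact_Un[OF X A1(1)] compact_imp_closed[OF A2(1)] _ 1 c2] by simp
    then obtain T where T: "connected T" "T \<subseteq> - (X \<union> ?A1 \<union> ?A2)" "x \<in> T" "p \<in> T"
      unfolding connected_component_def by blast
    \<comment> \<open>The connection \<open>T\<close> leaves \<open>D\<close> and therefore meets
      its frontier. It can do so only on the removed middle piece of the arc, which lies in a disc
      disjoint from the closure of \<open>D\<close>.\<close>
    have "p \<notin> D" using \<open>p \<notin> closure D\<close> closure_subset by blast
    then obtain z where z: "z \<in> T" "z \<in> frontier D"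
      using connected_Int_frontier[OF T(1), of D] T x by auto
    have cl: "closed (X \<union> path_image g)"
      using X g by (simp add: compact_imp_closed closed_Un closed_arc_image)
    have "z \<in> X \<union> path_image g"
      using frontier_of_components_closed_complement[OF cl D] z by auto
    then obtain s where s: "s \<in> {0..1}" "z = g s" using z T(2) by (auto simp: path_image_def)
    then have "s \<in> {t1..t2}" using z T(2) tt by force
    then have "z \<in> ball p r" using mid s by auto
    then show False using z r(3) by (auto simp: frontier_def)
  qed
qed

text \<open>Near \<open>p\<close> there are points of \<open>D\<close>, and a small disc about
  \<open>p\<close> misses \<open>X\<close>. Together with the preceding lemma: a component that
  touches the open arc in one point has the whole arc in its closure.\<close>

lemma component_near_arc_connected:
  fixes X :: "complex set"
  assumes X: "compact X" and gX: "path_image g \<inter> X = {pathstart g, pathfinish g}" "arc g"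
    and D: "D \<in> components (- (X \<union> path_image g))" and p: "p \<in> g ` {0<..<1}" "p \<in> closure D"
    and x: "x \<in> D"
  shows "connected_component (- X) x p"
proof -
  have "p \<notin> X" using p(1) gX arc_open_image by fastforce
  then obtain r where r: "r > 0" "ball p r \<subseteq> - X"
    using X open_contains_ball[of "- X"] by (auto simp: compact_imp_closed open_Compl)
  obtain z where z: "z \<in> D" "z \<in> ball p r"
    using p(2) r(1) unfolding closure_approachable by (metis dist_commute mem_ball)
  have "connected D" "D \<subseteq> - X" using D in_components_connected in_components_subset by blast+
  then have "connected_component (- X) x z" using x z unfolding connected_component_def by blast
  moreover have "connected_component (- X) z p"
    using connected_component_subset_ball r z by auto
  ultimately show ?thesis using connected_component_trans by metis
qed


text \<open>Given three components, a crosscut of the third closes a piece of the arc to a Jordan curve;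
  points of the three components near the arc then cannot all be separated by it, and Janiszewski's
  theorem, with the crosscut as intersection, joins two of them.\<close>

lemma components_near_arc_no_three:
  fixes X :: "complex set"
  assumes X: "compact X" and g: "arc g" and gX: "path_image g \<inter> X = {pathstart g, pathfinish g}"
    and D: "D1 \<in> components (- (X \<union> path_image g))" "D2 \<in> components (- (X \<union> path_image g))"
      "D3 \<in> components (- (X \<union> path_image g))"
    and cl: "g ` {0<..<1} \<subseteq> closure D1" "g ` {0<..<1} \<subseteq> closure D2" "g ` {0<..<1} \<subseteq> closure D3"
    and ne: "D1 \<noteq> D2" "D1 \<noteq> D3" "D2 \<noteq> D3"
  shows False
proof -
  let ?Y = "X \<union> path_image g"
  have clY: "closed ?Y" using X g by (simp add: compact_imp_closed closed_Un closed_arc_image)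
  have inj: "g s \<noteq> g s'" if "s \<in> {0..1}" "s' \<in> {0..1}" "s \<noteq> s'" for s s'
    using that g by (auto simp: arc_def inj_on_def)
  have cont: "continuous_on {0..1} g" using g by (simp add: arc_def path_def)
  have inX: "g s \<in> X \<longleftrightarrow> s = 0 \<or> s = 1" if "s \<in> {0..1}" for s
  proof -
    have "g s \<in> X \<longleftrightarrow> g s \<in> {g 0, g 1}"
      using gX that by (auto simp: path_image_def pathstart_def pathfinish_def)
    then show ?thesis using inj[of s 0] inj[of s 1] that by auto
  qed
  have notin: "g s \<notin> g ` S" if "s \<in> {0..1}" "S \<subseteq> {0..1}" "s \<notin> S" for s S
    using inj[OF that(1)] that by blast
  have cg: "compact (g ` {s..s'})" if "s \<in> {0..1}" "s' \<in> {0..1}" for s s'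
    using that cont by (intro compact_continuous_image) (auto intro: continuous_on_subset)
  have D3: "open D3" "connected D3" "D3 \<subseteq> - ?Y"
    using D(3) clY open_components in_components_connected in_components_subset by blast+
  have fr3: "frontier D3 \<subseteq> ?Y" using frontier_of_components_closed_complement[OF clY D(3)] .
  \<comment> \<open>The frontier of \<open>D3\<close> contains the open arc; \<open>U\<close> and
    \<open>V\<close> are its portions that lie only on the first and only on the second half. They
    are relatively open, as \<open>dense_access_fp_aux\<close> requires, and disjoint, so the
    crosscut \<open>q\<close> ends at parameters on different sides of 1/2.\<close>
  define U V where "U = frontier D3 \<inter> - (X \<union> g ` {1/2..1})" and "V = frontier D3 \<inter> - (X \<union> g ` {0..1/2})"
  have opU: "openin (top_of_set (frontier D3)) U" "openin (top_of_set (frontier D3)) V"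
    unfolding U_def V_def using X cg[of "1/2" 1] cg[of 0 "1/2"]
    by (auto intro!: openin_open_Int open_Compl closed_Un compact_imp_closed)
  have infr: "g s \<in> frontier D3" if "s \<in> {0<..<1}" for s
    using that cl(3) D3(1,3) by (auto simp: frontier_def interior_open path_image_def)
  have "g (1/4) \<notin> g ` {1/2..1}" "g (3/4) \<notin> g ` {0..1/2}"
    using inj by (fastforce elim!: imageE)+
  then have "g (1/4) \<in> U" "g (3/4) \<in> V"
    using infr[of "1/4"] inX[of "1/4"] infr[of "3/4"] inX[of "3/4"] by (auto simp: U_def V_def)
  moreover have U: "\<exists>s\<in>{0<..<1/2}. z = g s" if "z \<in> U" for z
  proof -
    have "z \<in> path_image g" "z \<notin> X" "z \<notin> g ` {1/2..1}" using that fr3 by (auto simp: U_def)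
    then obtain s where s: "s \<in> {0..1}" "z = g s" "s \<noteq> 0" "s \<noteq> 1"
      using inX by (auto simp: path_image_def)
    have "\<not> s \<ge> 1/2"
      using s(1) imageI[of s "{1/2..1}" g] \<open>z \<notin> g ` {1/2..1}\<close>
      by (auto simp: \<open>z = g s\<close> simp del: image_eqI)
    then show ?thesis using s by auto
  qed
  moreover have V: "\<exists>s\<in>{1/2<..<1}. z = g s" if "z \<in> V" for z
  proof -
    have "z \<in> path_image g" "z \<notin> X" "z \<notin> g ` {0..1/2}" using that fr3 by (auto simp: V_def)
    then obtain s where s: "s \<in> {0..1}" "z = g s" "s \<noteq> 0" "s \<noteq> 1"
      using inX by (auto simp: path_image_def)
    have "\<not> s \<le> 1/2"
      using s(1) imageI[of s "{0..1/2}" g] \<open>z \<notin> g ` {0..1/2}\<close>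
      by (auto simp: \<open>z = g s\<close> simp del: image_eqI)
    then show ?thesis using s by auto
  qed
  moreover have "U \<inter> V = {}"
  proof -
    have False if zU: "z \<in> U" and zV: "z \<in> V" for z
    proof -
      obtain s where "s \<in> {0<..<1/2}" "z = g s" using U[OF zU] by blast
      moreover obtain s' where "s' \<in> {1/2<..<1}" "z = g s'" using V[OF zV] by blast
      ultimately show False using inj[of s s'] by auto
    qed
    then show ?thesis by blast
  qed
  ultimately obtain q where q: "arc q" "pathstart q \<in> U" "pathfinish q \<in> V" "q ` {0<..<1} \<subseteq> D3"
    using dense_access_fp_aux[OF D3(1,2) opU] by (metis disjoint_iff empty_iff subsetD)
  obtain s1 where s1: "s1 \<in> {0<..<1/2}" "pathstart q = g s1" using U q(2) by blast
  obtain s2 where s2: "s2 \<in> {1/2<..<1}" "pathfinish q = g s2" using V q(3) by blast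
  let ?Q = "path_image q" and ?B = "g ` {s1..s2}" and ?A1 = "g ` {0..s1}" and ?A2 = "g ` {s2..1}"
  have Q: "?Q = insert (g s1) (insert (g s2) (q ` {0<..<1}))"
    using arc_open_image[OF q(1)] s1 s2 pathstart_in_path_image[of q] pathfinish_in_path_image[of q] by auto
  define h where "h = subpath s1 s2 g"
  have h: "arc h" "path_image h = ?B" "pathstart h = g s1" "pathfinish h = g s2"
    using arc_subpath_arc[OF g, of s1 s2] s1 s2 by (auto simp: h_def path_image_subpath)
  have Bsub: "?B \<subseteq> path_image g" using s1 s2 by (auto simp: path_image_def)
  have QB: "?Q \<inter> ?B \<subseteq> {g s1, g s2}" using Q q(4) D3(3) Bsub by blast
  define c where "c = q +++ reversepath h"
  have c: "simple_path c" "pathfinish c = pathstart c"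
    unfolding c_def using q(1) h s1 s2 QB by (auto intro!: simple_path_join_loop simp: arc_reversepath)
  have J: "path_image c = ?Q \<union> ?B"
    unfolding c_def using h s1 s2 by (simp add: path_image_join)
  let ?I = "inside (path_image c)" and ?O = "outside (path_image c)"
  have jor: "connected ?I" "connected ?O" "?I \<union> ?O = - path_image c"
    using Jordan_inside_outside[OF c] by auto
  \<comment> \<open>\<open>T\<close> leaves out just the middle piece of the arc: a disc about
    \<open>g (1/2)\<close> misses it, and it meets the Jordan curve exactly in the crosscut, which
    is connected.\<close>
  define T where "T = X \<union> ?A1 \<union> ?A2 \<union> ?Q"
  have clT: "closed T"
    unfolding T_def using X cg[of 0 s1] cg[of s2 1] s1 s2 closed_arc_image[OF q(1)]
    by (simp add: closed_Un compact_imp_closed)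
  have "path_image c \<inter> T = ?Q"
  proof -
    have "g s \<in> ?Q" if "s \<in> {s1..s2}" "g s \<in> X \<or> g s \<in> ?A1 \<or> g s \<in> ?A2" for s
    proof -
      have "g s \<notin> X" using inX[of s] that(1) s1 s2 by auto
      then have "\<exists>s'\<in>{0..s1} \<union> {s2..1}. g s = g s'" using that(2) by blast
      then obtain s' where s': "s' \<in> {0..s1} \<union> {s2..1}" "g s = g s'" by blast
      then have "s = s'" using inj[of s s'] that(1) s1 s2 by fastforce
      then have "s = s1 \<or> s = s2" using s'(1) that(1) s1 s2 by auto
      then show ?thesis using Q by auto
    qed
    then show ?thesis unfolding J T_def by blast
  qed
  then have conJT: "connected (path_image c \<inter> T)" using connected_arc_image[OF q(1)] by simp
  have p: "g (1/2) \<notin> T"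
  proof -
    have "g (1/2) \<notin> X" using inX[of "1/2"] by auto
    moreover have "g (1/2) \<notin> ?A1" "g (1/2) \<notin> ?A2"
      using notin[of "1/2" "{0..s1}"] notin[of "1/2" "{s2..1}"] s1 s2 by auto
    moreover have "g (1/2) \<notin> ?Q"
    proof -
      have "g (1/2) \<in> path_image g" by (auto simp: path_image_def)
      moreover have "g (1/2) \<noteq> g s1" "g (1/2) \<noteq> g s2"
        using inj[of "1/2" s1] inj[of "1/2" s2] s1 s2 by auto
      ultimately show ?thesis using Q q(4) D3(3) by blast
    qed
    ultimately show ?thesis unfolding T_def by auto
  qed
  then obtain r where r: "r > 0" "ball (g (1/2)) r \<subseteq> - T"
    using clT open_contains_ball[of "- T"] by auto
  have pick: "\<exists>d\<in>D. d \<in> ball (g (1/2)) r" if "g ` {0<..<1} \<subseteq> closure D" for D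
  proof -
    have "g (1/2) \<in> closure D" using that by auto
    then show ?thesis using r(1) unfolding closure_approachable by (metis dist_commute mem_ball)
  qed
  obtain d1 where d1: "d1 \<in> D1" "d1 \<in> ball (g (1/2)) r" using pick[OF cl(1)] by blast
  obtain d2 where d2: "d2 \<in> D2" "d2 \<in> ball (g (1/2)) r" using pick[OF cl(2)] by blast
  obtain d3 where d3: "d3 \<in> D3" "d3 \<in> ball (g (1/2)) r" using pick[OF cl(3)] by blast
  have off: "d \<in> ?I \<or> d \<in> ?O" if "d \<in> ball (g (1/2)) r" "d \<in> D" "D \<in> components (- ?Y)" for d D
  proof -
    have "d \<notin> ?Y" "d \<notin> T" using that r in_components_subset by blast+
    then show ?thesis using jor(3) J Bsub T_def by blast
  qed
  have sep: "D = D'" if "d \<in> ball (g (1/2)) r" "d \<in> D" "D \<in> components (- ?Y)"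
    "d' \<in> ball (g (1/2)) r" "d' \<in> D'" "D' \<in> components (- ?Y)"
    "d \<in> ?I \<and> d' \<in> ?I \<or> d \<in> ?O \<and> d' \<in> ?O" for d d' D D'
  proof -
    have "connected_component (- path_image c) d d'"
      using that(7) jor unfolding connected_component_def by blast
    moreover have "connected_component (- T) d d'"
      using connected_component_subset_ball[OF r(2)] that by blast
    ultimately have "connected_component (- (path_image c \<union> T)) d d'"
      using Janiszewski[OF _ clT conJT] c compact_simple_path_image by blast
    moreover have "?Y \<subseteq> path_image c \<union> T"
    proof -
      have "g s \<in> ?B \<union> ?A1 \<union> ?A2" if "s \<in> {0..1}" for s
        using that by (cases "s \<le> s1"; cases "s \<le> s2") auto
      then have "path_image g \<subseteq> ?B \<union> ?A1 \<union> ?A2" unfolding path_image_def by blast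
      then show ?thesis unfolding T_def J by blast
    qed
    ultimately have con: "connected_component (- ?Y) d d'"
      by (auto intro: connected_component_of_subset)
    then obtain S where S: "connected S" "S \<subseteq> - ?Y" "d \<in> S" "d' \<in> S"
      unfolding connected_component_def by blast
    then have "d' \<in> D" using components_maximal[OF that(3) S(1,2)] that(2) by blast
    then show ?thesis using components_nonoverlap[OF that(3,6)] that(5) by blast
  qed
  \<comment> \<open>Of three points near \<open>g (1/2)\<close> two lie on the same side of the
    Jordan curve.\<close>
  show False using off[OF d1(2,1) D(1)] off[OF d2(2,1) D(2)] off[OF d3(2,1) D(3)]
    sep[OF d1(2,1) D(1) d2(2,1) D(2)] sep[OF d1(2,1) D(1) d3(2,1) D(3)] sep[OF d2(2,1) D(2) d3(2,1) D(3)] ne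
    by blast
qed

section \<open>The number of faces along an arc\<close>

definition components_touching :: "complex set \<Rightarrow> complex set \<Rightarrow> complex set set" where
  "components_touching Y A = {D \<in> components (- Y). closure D \<inter> A \<noteq> {}}"

lemma card_components_touching_le_2:
  fixes X :: "complex set"
  assumes X: "compact X" and g: "arc g" and gX: "path_image g \<inter> X = {pathstart g, pathfinish g}"
  shows "finite (components_touching (X \<union> path_image g) (g ` {0<..<1}))"
    and "card (components_touching (X \<union> path_image g) (g ` {0<..<1})) \<le> 2"
proof -
  let ?N = "components_touching (X \<union> path_image g) (g ` {0<..<1})"
  have cl: "g ` {0<..<1} \<subseteq> closure D" if "D \<in> ?N" for D
  proof -
    obtain p where p: "p \<in> closure D" "p \<in> g ` {0<..<1}" and D: "D \<in> components (- (X \<union> path_image g))"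
      using \<open>D \<in> ?N\<close> by (auto simp: components_touching_def)
    obtain x where x: "x \<in> D" using D in_components_nonempty by blast
    show ?thesis
      using component_closure_contains_arc[OF X g gX D x p(2)] component_near_arc_connected[OF X gX g D p(2,1) x] .
  qed
  have three: "D1 = D2 \<or> D1 = D3 \<or> D2 = D3" if "D1 \<in> ?N" "D2 \<in> ?N" "D3 \<in> ?N" for D1 D2 D3
    using components_near_arc_no_three[OF X g gX, of D1 D2 D3] cl[OF that(1)] cl[OF that(2)] cl[OF that(3)] that
    unfolding components_touching_def by blast
  have "\<exists>D1 D2. ?N \<subseteq> {D1, D2}"
  proof (cases "\<exists>D1\<in>?N. \<exists>D2\<in>?N. D1 \<noteq> D2")
    case True
    then obtain D1 D2 where "D1 \<in> ?N" "D2 \<in> ?N" "D1 \<noteq> D2" by blast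
    then have "?N \<subseteq> {D1, D2}" using three by blast
    then show ?thesis by blast
  next
    case False
    then show ?thesis by blast
  qed
  then obtain D1 D2 where "?N \<subseteq> {D1, D2}" by blast
  then show "finite ?N" "card ?N \<le> 2"
    using finite_subset card_mono[of "{D1, D2}" ?N] card_insert_le_m1[of 2 "{D2}" D1] by fastforce+
qed


text \<open>The open arc lies in a single component \<open>C0\<close> of the complement of
  \<open>X\<close>. As \<open>C0\<close> is open, the closures of the other components miss the arc,
  so these survive unchanged, while \<open>C0\<close> breaks up into precisely the components that
  touch the arc. There is at least one of them because an arc cannot fill the open set
  \<open>C0\<close>.\<close>

lemma components_attach_arc:
  fixes X :: "complex set"
  assumes X: "compact X" and g: "arc g" and gX: "path_image g \<inter> X = {pathstart g, pathfinish g}"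
  defines "Y \<equiv> X \<union> path_image g" and "C0 \<equiv> connected_component_set (- X) (g (1/2))"
    and "N \<equiv> components_touching (X \<union> path_image g) (g ` {0<..<1})"
  shows "components (- Y) = (components (- X) - {C0}) \<union> N"
    and "C0 \<in> components (- X)" and "N \<inter> components (- X) \<subseteq> {C0}" and "N \<noteq> {}"
    and "g ` {0<..<1} \<subseteq> C0" and "open C0"
proof -
  let ?a = "g ` {0<..<1}"
  have a: "?a = path_image g - {pathstart g, pathfinish g}" using arc_open_image[OF g] .
  have aX: "?a \<subseteq> - X" using a gX by auto
  have cona: "connected ?a"
    using g by (intro connected_continuous_image) (auto simp: arc_def path_def intro: continuous_on_subset)
  have half: "g (1/2) \<in> ?a" by auto
  show aC: "?a \<subseteq> C0"
    unfolding C0_def by (rule connected_component_maximal[OF half cona aX])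
  show C0: "C0 \<in> components (- X)"
    unfolding C0_def components_def using half aX by blast
  show opC: "open C0" using open_components[OF _ C0] compact_imp_closed[OF X] by auto
  have away: "closure C \<inter> ?a = {}" if "C \<in> components (- X)" "C \<noteq> C0" for C
  proof -
    have "C0 \<inter> C = {}" using components_nonoverlap C0 that by metis
    then have "C0 \<inter> closure C = {}" using opC open_Int_closure_eq_empty by blast
    then show ?thesis using aC by blast
  qed
  have sub: "C \<subseteq> - Y" if "C \<in> components (- X)" "C \<noteq> C0" for C
  proof -
    have "C \<inter> g ` {0<..<1} = {}" using away[OF that] closure_subset[of C] by blast
    moreover have "C \<subseteq> - X" using in_components_subset[OF that(1)] .
    ultimately show ?thesis using a gX unfolding Y_def by blast
  qed
  show "N \<inter> components (- X) \<subseteq> {C0}"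
    using away unfolding N_def components_touching_def by blast
  have N: "D \<in> N" if D: "D \<in> components (- Y)" "D \<subseteq> C0" for D
  proof -
    obtain x where x: "x \<in> D" using in_components_nonempty[OF D(1)] by blast
    then have "connected_component (- X) x (g (1/2))"
      using D(2) unfolding C0_def by (auto intro: connected_component_sym)
    then have "?a \<subseteq> closure D"
      using component_closure_contains_arc[OF X g gX D(1)[unfolded Y_def] x half] by blast
    then show ?thesis using D half unfolding N_def Y_def components_touching_def by blast
  qed
  show "N \<noteq> {}"
  proof -
    obtain z where z: "z \<in> C0" "z \<notin> path_image g"
      using arc_image_empty_interior[OF g opC] half aC by blast
    then have zY: "z \<in> - Y" using in_components_subset[OF C0] unfolding Y_def by blast
    define D where "D = connected_component_set (- Y) z"
    have D: "D \<in> components (- Y)" "z \<in> D" unfolding D_def components_def using zY by auto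
    have "D \<subseteq> C0"
      using components_maximal[OF C0, of D] D z(1) in_components_connected[OF D(1)] in_components_subset[OF D(1)]
      unfolding Y_def by blast
    then show ?thesis using N[OF D(1)] by blast
  qed
  show "components (- Y) = (components (- X) - {C0}) \<union> N"
  proof (intro equalityI subsetI)
    fix D assume D: "D \<in> components (- Y)"
    obtain x where x: "x \<in> D" using in_components_nonempty[OF D] by blast
    define C where "C = connected_component_set (- X) x"
    have xX: "x \<in> - X" using x in_components_subset[OF D] unfolding Y_def by blast
    have C: "C \<in> components (- X)" "x \<in> C" unfolding C_def components_def using xX by auto
    have DC: "D \<subseteq> C"
      using components_maximal[OF C(1), of D] C(2) x in_components_connected[OF D] in_components_subset[OF D]
      unfolding Y_def by blast
    show "D \<in> (components (- X) - {C0}) \<union> N"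
    proof (cases "C = C0")
      case True then show ?thesis using N[OF D] DC by blast
    next
      case False
      then have "C \<subseteq> D"
        using components_maximal[OF D, of C] sub[OF C(1) False] in_components_connected[OF C(1)] C(2) x by blast
      then have "D = C" using DC by blast
      then show ?thesis using C(1) False by simp
    qed
  next
    fix D assume "D \<in> (components (- X) - {C0}) \<union> N"
    then show "D \<in> components (- Y)"
    proof
      assume D: "D \<in> components (- X) - {C0}"
      then have D0: "D \<in> components (- X)" and "D \<noteq> C0" by auto
      then have D': "D \<subseteq> - Y" by (rule sub)
      obtain x where x: "x \<in> D" using in_components_nonempty[OF D0] by blast
      define E where "E = connected_component_set (- Y) x"
      have E: "E \<in> components (- Y)" "x \<in> E" unfolding E_def components_def using x D' by (auto intro!: imageI)
      have "E \<subseteq> D"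
        using components_maximal[OF D0, of E] x E(2) in_components_connected[OF E(1)]
          in_components_subset[OF E(1)] unfolding Y_def by blast
      moreover have "D \<subseteq> E"
        using components_maximal[OF E(1), of D] D' x E(2) in_components_connected[OF D0] by blast
      ultimately show ?thesis using E by simp
    qed (auto simp: N_def Y_def components_touching_def)
  qed
qed

lemma card_components_attach_arc:
  fixes X :: "complex set"
  assumes X: "compact X" and g: "arc g" and gX: "path_image g \<inter> X = {pathstart g, pathfinish g}"
    and fin: "finite (components (- X))"
  shows "finite (components (- (X \<union> path_image g)))"
    and "card (components (- (X \<union> path_image g))) + 1 =
      card (components (- X)) + card (components_touching (X \<union> path_image g) (g ` {0<..<1}))"
    and "card (components_touching (X \<union> path_image g) (g ` {0<..<1})) \<ge> 1"
proof -
  define C0 where "C0 = connected_component_set (- X) (g (1/2))"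
  let ?N = "components_touching (X \<union> path_image g) (g ` {0<..<1})"
  note a = components_attach_arc[OF X g gX, folded C0_def]
  have N: "finite ?N" using card_components_touching_le_2[OF X g gX] by blast
  show "card ?N \<ge> 1" using N a(4) by (simp add: Suc_leI card_gt_0_iff)
  show "finite (components (- (X \<union> path_image g)))" using a(1) fin N by simp
  have "card (components (- (X \<union> path_image g))) = card (components (- X) - {C0}) + card ?N"
    unfolding a(1) using fin N a(3) by (intro card_Un_disjoint) auto
  moreover have "card (components (- X)) = Suc (card (components (- X) - {C0}))"
    using a(2) fin by (metis card_Suc_Diff1)
  ultimately show "card (components (- (X \<union> path_image g))) + 1 = card (components (- X)) + card ?N"
    by simp
qed

text \<open>A path in \<open>X\<close> between the ends contains an arc, which closes
  \<open>g\<close> to a Jordan curve. Both of its sides accumulate at \<open>g (1/2)\<close>, and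
  the points found there lie in \<open>C0\<close>; so each side contributes a component, and the
  curve separates the two.\<close>

lemma card_components_touching_loop:
  fixes X :: "complex set"
  assumes X: "compact X" and g: "arc g" and gX: "path_image g \<inter> X = {pathstart g, pathfinish g}"
    and con: "path_component X (pathstart g) (pathfinish g)"
  shows "card (components_touching (X \<union> path_image g) (g ` {0<..<1})) \<ge> 2"
proof -
  let ?Y = "X \<union> path_image g"
  let ?N = "components_touching ?Y (g ` {0<..<1})"
  define C0 where "C0 = connected_component_set (- X) (g (1/2))"
  note a = components_attach_arc[OF X g gX, folded C0_def]
  have ends: "pathstart g \<noteq> pathfinish g" using arc_distinct_ends[OF g] by simp
  obtain p where p: "path p" "path_image p \<subseteq> X" "pathstart p = pathstart g" "pathfinish p = pathfinish g"
    using con unfolding path_component_def by blast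
  obtain q where q: "arc q" "path_image q \<subseteq> X" "pathstart q = pathstart g" "pathfinish q = pathfinish g"
    using path_contains_arc[OF p(1,3,4) ends] p(2) by (metis subset_trans)
  define c where "c = q +++ reversepath g"
  have c: "simple_path c" "pathfinish c = pathstart c"
    unfolding c_def using q g gX by (auto intro!: simple_path_join_loop simp: arc_reversepath)
  have J: "path_image c = path_image q \<union> path_image g"
    unfolding c_def using q by (simp add: path_image_join)
  let ?I = "inside (path_image c)" and ?O = "outside (path_image c)"
  note jor = Jordan_inside_outside[OF c]
  have half: "g (1/2) \<in> C0" "g (1/2) \<in> path_image c" using a(5) J by (auto simp: path_image_def)
  have C0X: "C0 \<subseteq> - X" using in_components_subset[OF a(2)] .
  have pick: "\<exists>D\<in>?N. \<exists>z\<in>D. z \<in> S"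
    if S: "g (1/2) \<in> closure S" "S \<inter> path_image c = {}" for S
  proof -
    obtain z where z: "z \<in> C0" "z \<in> S"
      using S(1) a(6) half(1) open_Int_closure_eq_empty[of C0 S] by blast
    have zY: "z \<in> - ?Y" using z C0X S(2) J by blast
    then have D: "connected_component_set (- ?Y) z \<in> components (- ?Y)" "z \<in> connected_component_set (- ?Y) z"
      unfolding components_def by auto
    moreover have "connected_component_set (- ?Y) z \<noteq> C \<or> C = C0" if "C \<in> components (- X)" for C
      using components_nonoverlap[OF that a(2)] z(1) D(2) by blast
    ultimately have "connected_component_set (- ?Y) z \<in> ?N" using a(1) by blast
    then show ?thesis using D(2) z(2) by blast
  qed
  obtain D1 z1 where 1: "D1 \<in> ?N" "z1 \<in> D1" "z1 \<in> ?I"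
    using pick[of ?I] jor half(2) by (auto simp: frontier_def)
  obtain D2 z2 where 2: "D2 \<in> ?N" "z2 \<in> D2" "z2 \<in> ?O"
    using pick[of ?O] jor half(2) by (auto simp: frontier_def)
  have "D1 \<noteq> D2"
  proof
    assume "D1 = D2"
    have D1: "D1 \<in> components (- ?Y)" using 1(1) unfolding components_touching_def by blast
    have "connected D1" "D1 \<subseteq> - ?Y"
      using in_components_connected[OF D1] in_components_subset[OF D1] by blast+
    moreover have "path_image c \<subseteq> ?Y" using J q(2) by blast
    ultimately have "connected_component (- path_image c) z1 z2"
      unfolding connected_component_def using 1 2 \<open>D1 = D2\<close> by blast
    then have "z2 \<in> ?I" using inside_same_component 1(3) by blast
    then show False using 2(3) jor by blast
  qed
  moreover have "finite ?N" using card_components_touching_le_2[OF X g gX] by blast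
  ultimately show ?thesis
    using card_mono[of ?N "{D1, D2}"] 1(1) 2(1) by simp
qed

subsection \<open>Plane graphs given by arcs\<close>

text \<open>An edge is a point set, so no orientation has to be chosen. Parallel edges are allowed;
  simplicity is expressed separately by injectivity of \<open>\<lambda>a. a \<inter> P\<close>,
  which maps an edge to its pair of ends.\<close>

definition plane_graph :: "complex set \<Rightarrow> complex set set \<Rightarrow> bool" where
  "plane_graph P A \<longleftrightarrow> finite P \<and> finite A \<and>
     (\<forall>a\<in>A. \<exists>g. arc g \<and> path_image g = a \<and> a \<inter> P = {pathstart g, pathfinish g}) \<and>
     (\<forall>a\<in>A. \<forall>b\<in>A. a \<noteq> b \<longrightarrow> a \<inter> b \<subseteq> P)"

text \<open>For \<open>X = P \<union> \<Union>A\<close> these are the connected components of the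
  graph, since every point of an edge is joined to a vertex.\<close>

definition path_classes :: "complex set \<Rightarrow> complex set \<Rightarrow> complex set set" where
  "path_classes P X = path_component_set X ` P"

lemma plane_graph_subset: "plane_graph P A \<Longrightarrow> B \<subseteq> A \<Longrightarrow> plane_graph P B"
  unfolding plane_graph_def by (meson finite_subset subsetD)

lemma plane_graph_compact:
  assumes "plane_graph P A" shows "compact (P \<union> \<Union>A)"
proof -
  have "compact a" if "a \<in> A" for a
    using assms that unfolding plane_graph_def by (metis compact_arc_image)
  then show ?thesis using assms unfolding plane_graph_def
    by (metis compact_Un compact_Union finite_imp_compact)
qed

lemma plane_graph_Int:
  assumes "plane_graph P A" "a \<in> A" "b \<in> A" "a \<noteq> b"
  shows "a \<inter> b \<subseteq> P"
proof -
  have "\<forall>a\<in>A. \<forall>b\<in>A. a \<noteq> b \<longrightarrow> a \<inter> b \<subseteq> P" using assms(1) unfolding plane_graph_def by simp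
  then show ?thesis using assms(2-) by blast
qed

lemma plane_graph_edge:
  assumes "plane_graph P A" "a \<in> A"
  obtains g where "arc g" "path_image g = a" "a \<inter> P = {pathstart g, pathfinish g}"
    "path_image g \<inter> (P \<union> \<Union>(A - {a})) = {pathstart g, pathfinish g}"
    "P \<union> \<Union>A = (P \<union> \<Union>(A - {a})) \<union> path_image g"
proof -
  have "\<exists>g. arc g \<and> path_image g = a \<and> a \<inter> P = {pathstart g, pathfinish g}"
    using assms unfolding plane_graph_def by simp
  then obtain g where g: "arc g" "path_image g = a" "a \<inter> P = {pathstart g, pathfinish g}" by auto
  have "a \<inter> b \<subseteq> P" if "b \<in> A - {a}" for b
    using plane_graph_Int[OF assms, of b] that by auto
  then have "a \<inter> \<Union>(A - {a}) \<subseteq> P" by blast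
  then have "path_image g \<inter> (P \<union> \<Union>(A - {a})) = {pathstart g, pathfinish g}"
    unfolding g(2) using g(3) by blast
  then show thesis using that[OF g] g(2) assms(2) by blast
qed

section \<open>Connected components and Euler's inequality\<close>

lemma path_component_set_image:
  fixes X :: "complex set"
  assumes "X \<subseteq> Y" "p \<in> X"
  shows "path_component_set Y p = (\<Union>q\<in>path_component_set X p. path_component_set Y q)"
proof -
  have "path_component_set Y q = path_component_set Y p" if "q \<in> path_component_set X p" for q
    using that path_component_of_subset[OF assms(1)] path_component_eq by (metis mem_Collect_eq)
  moreover have "p \<in> path_component_set X p" using assms(2) by (simp add: path_component_refl)
  ultimately show ?thesis by blast
qed

text \<open>Enlarging the set maps the old classes onto the new ones, so their number cannot grow;
  if two vertices become joined, this map is not injective and the number drops.\<close>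

lemma card_path_classes_mono:
  assumes "finite P" "P \<subseteq> X" "X \<subseteq> Y"
  shows "card (path_classes P Y) \<le> card (path_classes P X)"
    and "\<lbrakk>u \<in> P; v \<in> P; path_component Y u v; \<not> path_component X u v\<rbrakk>
      \<Longrightarrow> card (path_classes P Y) < card (path_classes P X)"
proof -
  define h where "h = (\<lambda>S. \<Union>q\<in>S. path_component_set Y q)"
  have h: "path_component_set Y p = h (path_component_set X p)" if "p \<in> P" for p
    unfolding h_def using path_component_set_image assms that by blast
  have eq: "path_classes P Y = h ` path_classes P X"
    unfolding path_classes_def image_image using h by (rule image_cong[OF refl])
  have fin: "finite (path_classes P X)" using assms(1) by (simp add: path_classes_def)
  show le: "card (path_classes P Y) \<le> card (path_classes P X)"
    unfolding eq by (rule card_image_le[OF fin])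
  assume uv: "u \<in> P" "v \<in> P" "path_component Y u v" "\<not> path_component X u v"
  have "path_component_set Y u = path_component_set Y v" using uv(3) by (simp add: path_component_eq)
  moreover have "path_component_set X u \<noteq> path_component_set X v"
    using uv(4) uv(2) assms(2) path_component_refl by blast
  ultimately have "\<not> inj_on h (path_classes P X)"
    using h uv(1,2) unfolding path_classes_def inj_on_def by (metis imageI)
  then have "card (path_classes P Y) \<noteq> card (path_classes P X)"
    using eq_card_imp_inj_on fin unfolding eq by blast
  then show "card (path_classes P Y) < card (path_classes P X)" using le by simp
qed

lemma finite_complement_connected:
  fixes P :: "complex set"
  assumes "finite P"
  shows "connected (- P)" "- P \<noteq> {}"
proof -
  show "connected (- P)"
    using connected_open_delete_finite[of UNIV P] connected_UNIV assms by (simp add: Compl_eq_Diff_UNIV)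
  show "- P \<noteq> {}" using assms infinite_UNIV_char_0 by (metis finite_compl finite.emptyI finite_UNIV)
qed

text \<open>Arcs are added one at a time. An arc with unconnected ends lowers the number of classes
  and leaves at least as many faces as before; an arc with connected ends adds a face. Either way
  one side keeps up with the additional edge.\<close>

proposition plane_graph_Euler:
  assumes "plane_graph P A"
  shows "finite (components (- (P \<union> \<Union>A)))"
    and "card A + 1 + card (path_classes P (P \<union> \<Union>A)) \<le> card (components (- (P \<union> \<Union>A))) + card P"
proof -
  have "finite A" "finite P" using assms by (auto simp: plane_graph_def)
  have "finite (components (- (P \<union> \<Union>A))) \<and>
    card A + 1 + card (path_classes P (P \<union> \<Union>A)) \<le> card (components (- (P \<union> \<Union>A))) + card P"
    using \<open>finite A\<close> assms
  proof (induction A)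
    case empty
    have "components (- P) = {- P}"
      using finite_complement_connected[OF \<open>finite P\<close>] by (simp add: components_eq_sing_iff)
    moreover have "card (path_classes P P) \<le> card P"
      unfolding path_classes_def using \<open>finite P\<close> by (rule card_image_le)
    ultimately show ?case by simp
  next
    case (insert a A)
    have pA: "plane_graph P A" using plane_graph_subset[OF insert.prems] by blast
    note IH = insert.IH[OF pA]
    obtain g where g: "arc g" "path_image g = a" "a \<inter> P = {pathstart g, pathfinish g}"
      "path_image g \<inter> (P \<union> \<Union>(insert a A - {a})) = {pathstart g, pathfinish g}"
      "P \<union> \<Union>(insert a A) = (P \<union> \<Union>(insert a A - {a})) \<union> path_image g"
      using plane_graph_edge[OF insert.prems, of a] by blast
    have A: "insert a A - {a} = A" using insert.hyps by blast
    let ?X = "P \<union> \<Union>A"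
    have X: "compact ?X" using plane_graph_compact[OF pA] .
    note gX = g(4)[unfolded A]
    note Y = g(5)[unfolded A]
    note c = card_components_attach_arc[OF X g(1) gX] 
    have uv: "pathstart g \<in> P" "pathfinish g \<in> P" using g(3) by auto
    note pc = card_path_classes_mono[OF \<open>finite P\<close>, of ?X "?X \<union> path_image g"]
    have "path_component (?X \<union> path_image g) (pathstart g) (pathfinish g)"
      unfolding path_component_def using g(1) arc_imp_path by blast
    then have "card (path_classes P (?X \<union> path_image g)) + 2 \<le>
        card (path_classes P ?X) + card (components_touching (?X \<union> path_image g) (g ` {0<..<1})) "
      using card_components_touching_loop[OF X g(1) gX] pc(1) pc(2)[OF _ _ uv] c(3) IH
      by (cases "path_component ?X (pathstart g) (pathfinish g)") fastforce+
    then show ?case unfolding Y using IH c insert.hyps by simp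
  qed
  then show "finite (components (- (P \<union> \<Union>A)))"
    and "card A + 1 + card (path_classes P (P \<union> \<Union>A)) \<le> card (components (- (P \<union> \<Union>A))) + card P"
    by auto
qed


text \<open>Some vertex lies on exactly one edge of \<open>B\<close>. Demanding this of every
  non-empty set of edges is a way to say "forest" without mentioning cycles.\<close>

definition has_leaf :: "complex set \<Rightarrow> complex set set \<Rightarrow> bool" where
  "has_leaf P B \<longleftrightarrow> (\<exists>a\<in>B. \<exists>u\<in>a \<inter> P. \<forall>b\<in>B - {a}. u \<notin> b)"

text \<open>Take away a leaf edge together with its leaf vertex: the rest meets that arc in one
  point, the rest does not separate the plane by induction, nor does an arc, and Janiszewski's
  theorem puts them together. The leaf has to go too, since otherwise the intersection would consist
  of two points; hence the induction over varying \<open>P\<close>.\<close>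

lemma forest_complement_connected:
  assumes "plane_graph P A" and "\<And>B. B \<subseteq> A \<Longrightarrow> B \<noteq> {} \<Longrightarrow> has_leaf P B"
  shows "connected (- (P \<union> \<Union>A))"
  using assms
proof (induction "card A" arbitrary: P A)
  case 0
  then have "finite P" "A = {}" by (auto simp: plane_graph_def)
  then show ?case using finite_complement_connected by simp
next
  case (Suc n)
  have "A \<noteq> {}" using Suc.hyps(2) by auto
  then obtain a u where a: "a \<in> A" "u \<in> a" "u \<in> P" "\<forall>b\<in>A - {a}. u \<notin> b"
    using Suc.prems(2)[of A] unfolding has_leaf_def by blast
  obtain g where g: "arc g" "path_image g = a" "a \<inter> P = {pathstart g, pathfinish g}"
    "path_image g \<inter> (P \<union> \<Union>(A - {a})) = {pathstart g, pathfinish g}"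
    "P \<union> \<Union>A = (P \<union> \<Union>(A - {a})) \<union> path_image g"
    using plane_graph_edge[OF Suc.prems(1) a(1)] by blast
  let ?P = "P - {u}" and ?A = "A - {a}"
  have pg: "plane_graph ?P ?A"
  proof -
    have eq: "b \<inter> ?P = b \<inter> P" if "b \<in> ?A" for b using a(4) that by blast
    note pA = plane_graph_subset[OF Suc.prems(1), of ?A, unfolded plane_graph_def]
    show ?thesis unfolding plane_graph_def
    proof (intro conjI ballI impI)
      fix b assume b: "b \<in> ?A"
      show "\<exists>g. arc g \<and> path_image g = b \<and> b \<inter> ?P = {pathstart g, pathfinish g}"
        unfolding eq[OF b] using pA b by simp
    next
      fix b c assume "b \<in> ?A" "c \<in> ?A" "b \<noteq> c"
      moreover have "b \<inter> c \<subseteq> P"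
        using plane_graph_Int[OF Suc.prems(1), of b c] \<open>b \<in> ?A\<close> \<open>c \<in> ?A\<close> \<open>b \<noteq> c\<close> by blast
      ultimately show "b \<inter> c \<subseteq> ?P" using a(4) by blast
    qed (use pA in auto)
  qed
  have "connected (- (?P \<union> \<Union>?A))"
  proof (rule Suc.hyps(1)[OF _ pg])
    show "n = card ?A" using Suc.hyps(2) a(1) by simp
    fix B assume B: "B \<subseteq> ?A" "B \<noteq> {}"
    have "has_leaf P B" using Suc.prems(2)[of B] B by blast
    then obtain b w where b: "b \<in> B" "w \<in> b \<inter> P" "\<forall>c\<in>B - {b}. w \<notin> c"
      unfolding has_leaf_def by blast
    have "w \<noteq> u" using a(4) B(1) b(1,2) by blast
    then show "has_leaf ?P B" using b unfolding has_leaf_def by blast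
  qed
  moreover have "connected (- path_image g)" using connected_arc_complement[OF g(1)] by simp
  moreover have "connected ((?P \<union> \<Union>?A) \<inter> path_image g)"
  proof -
    have "pathstart g \<noteq> pathfinish g" using arc_distinct_ends[OF g(1)] by simp
    moreover have "u \<in> {pathstart g, pathfinish g}" using a(2,3) g(3) by blast
    moreover have "(?P \<union> \<Union>?A) \<inter> path_image g = {pathstart g, pathfinish g} - {u}"
      using g(4) a(4) by blast
    ultimately obtain z where "(?P \<union> \<Union>?A) \<inter> path_image g = {z}"
      by (metis Diff_insert_absorb insert_commute insert_iff singletonD)
    then show ?thesis by simp
  qed
  ultimately have "connected (- ((?P \<union> \<Union>?A) \<union> path_image g))"
    using Janiszewski_connected[OF plane_graph_compact[OF pg]] closed_arc_image[OF g(1)] by blast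
  moreover have "(?P \<union> \<Union>?A) \<union> path_image g = P \<union> \<Union>A"
    using g(5) a(2) g(2) by blast
  ultimately show ?case by simp
qed

text \<open>Here girth enters only through the hypothesis that fewer than k edges always have a leaf.\<close>

proposition plane_graph_face_bound:
  assumes pg: "plane_graph P A"
    and girth: "\<And>B. B \<subseteq> A \<Longrightarrow> B \<noteq> {} \<Longrightarrow> card B < k \<Longrightarrow> has_leaf P B"
    and F: "card (components (- (P \<union> \<Union>A))) \<ge> 2"
  shows "k * card (components (- (P \<union> \<Union>A))) \<le> 2 * card A"
proof -
  let ?X = "P \<union> \<Union>A"
  let ?F = "components (- ?X)"
  define inc where "inc = (\<lambda>a f. closure f \<inter> (a - P) \<noteq> {})"
  have fin: "finite A" "finite P" "finite ?F" using pg plane_graph_Euler(1)[OF pg] by (auto simp: plane_graph_def)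
  have two: "card {f \<in> ?F. inc a f} \<le> 2" if "a \<in> A" for a
  proof -
    obtain g where g: "arc g" "path_image g = a" "a \<inter> P = {pathstart g, pathfinish g}"
      "path_image g \<inter> (P \<union> \<Union>(A - {a})) = {pathstart g, pathfinish g}"
      "P \<union> \<Union>A = (P \<union> \<Union>(A - {a})) \<union> path_image g"
      using plane_graph_edge[OF pg \<open>a \<in> A\<close>] by blast
    have cX: "compact (P \<union> \<Union>(A - {a}))" by (intro plane_graph_compact plane_graph_subset[OF pg]) simp
    have "g ` {0<..<1} = a - P" using arc_open_image[OF g(1)] g(2,3) by blast
    then have "{f \<in> ?F. inc a f} = components_touching ((P \<union> \<Union>(A - {a})) \<union> path_image g) (g ` {0<..<1})"
      unfolding components_touching_def inc_def g(5) by simp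
    then show ?thesis using card_components_touching_le_2(2)[OF cX g(1) g(4)] by simp
  qed
  \<comment> \<open>If fewer than \<open>k\<close> edges touched \<open>f\<close>, they would form a
    forest, whose complement is connected. The frontier of \<open>f\<close> lies on this forest, so
    \<open>f\<close> fills its whole complement, the graph is nothing but the forest, and there is
    only one face.\<close>
  have many: "k \<le> card {a \<in> A. inc a f}" if f: "f \<in> ?F" for f
  proof (rule ccontr)
    let ?B = "{a \<in> A. inc a f}"
    assume "\<not> k \<le> card ?B"
    then have less: "card ?B < k" by simp
    have pgB: "plane_graph P ?B" by (rule plane_graph_subset[OF pg]) simp
    have "connected (- (P \<union> \<Union>?B))"
    proof (rule forest_complement_connected[OF pgB])
      fix B assume B: "B \<subseteq> ?B" "B \<noteq> {}"
      have "card B \<le> card ?B" by (rule card_mono[OF _ B(1)]) (use fin in simp)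
      then show "has_leaf P B" using girth[of B] B less by auto
    qed
    moreover have fX: "f \<inter> ?X = {}" "f \<noteq> {}"
      using f in_components_subset in_components_nonempty by blast+
    moreover have "closed ?X" using plane_graph_compact[OF pg] by (rule compact_imp_closed)
    then have fr: "frontier f \<subseteq> ?X" using frontier_of_components_closed_complement f by blast
    have "frontier f \<subseteq> P \<union> \<Union>?B"
    proof
      fix z assume z: "z \<in> frontier f"
      then have "z \<in> closure f" by (simp add: frontier_def)
      then show "z \<in> P \<union> \<Union>?B" using fr z unfolding inc_def by blast
    qed
    moreover have "f \<subseteq> - (P \<union> \<Union>?B)" using fX(1) by blast
    ultimately have sub: "- (P \<union> \<Union>?B) \<subseteq> f"
      using connected_Int_frontier[of "- (P \<union> \<Union>?B)" f] by blast
    have "?X = P \<union> \<Union>?B"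
    proof -
      have "a \<subseteq> P \<union> \<Union>?B" if "a \<in> A" for a
      proof
        fix z assume "z \<in> a"
        then have "z \<notin> f" using fX(1) that by blast
        then show "z \<in> P \<union> \<Union>?B" using sub by blast
      qed
      then show ?thesis by blast
    qed
    then have "card ?F \<le> 1"
      using \<open>connected (- (P \<union> \<Union>?B))\<close> fX(2) f components_eq_sing_iff[of "- ?X"]
      by (metis card_1_singleton_iff One_nat_def components_empty empty_iff le_refl)
    then show False using F by simp
  qed
  have "k * card ?F = (\<Sum>f\<in>?F. k)" by simp
  also have "\<dots> \<le> (\<Sum>f\<in>?F. card {a \<in> A. inc a f})" using many by (rule sum_mono)
  also have "\<dots> = (\<Sum>a\<in>A. card {f \<in> ?F. inc a f})"
    using sum_multicount_gen[of ?F A "\<lambda>f a. inc a f" "\<lambda>a. card {f \<in> ?F. inc a f}"] fin by auto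
  also have "\<dots> \<le> (\<Sum>a\<in>A. 2)" using two by (rule sum_mono)
  finally show ?thesis by simp
qed

proposition plane_graph_girth_bound:
  assumes pg: "plane_graph P A"
    and girth: "\<And>B. B \<subseteq> A \<Longrightarrow> B \<noteq> {} \<Longrightarrow> card B < k \<Longrightarrow> has_leaf P B"
    and k: "k = 3 \<or> k = 4" and P: "card P \<ge> 3"
  shows "k * card A + 2 * k \<le> k * card P + 2 * card A"
proof -
  let ?F = "components (- (P \<union> \<Union>A))"
  have "finite P" using pg by (simp add: plane_graph_def)
  then have "path_classes P (P \<union> \<Union>A) \<noteq> {}" "finite (path_classes P (P \<union> \<Union>A))"
    using P by (auto simp: path_classes_def)
  then have "card (path_classes P (P \<union> \<Union>A)) \<ge> 1" by (simp add: Suc_leI card_gt_0_iff)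
  then have e: "card A + 2 \<le> card ?F + card P" using plane_graph_Euler(2)[OF pg] by linarith
  show ?thesis
  proof (cases "card ?F \<ge> 2")
    case True
    have "k * card ?F \<le> 2 * card A" by (rule plane_graph_face_bound[OF pg girth True])
    then show ?thesis using e k by auto
  next
    case False
    \<comment> \<open>With one face at most, \<open>card A + 1 \<le> card P\<close>, and as
      \<open>card P \<ge> 3\<close> and \<open>k \<le> 4\<close> the inequality still holds.\<close>
    then show ?thesis using e k P by auto
  qed
qed

section \<open>Edge bounds for simple and for bipartite plane graphs\<close>

lemma no_leaf_next:
  assumes "\<not> has_leaf P B" "a \<in> B" "u \<in> a" "u \<in> P"
  obtains b where "b \<in> B" "b \<noteq> a" "u \<in> b"
proof -
  have "\<not> (\<forall>b\<in>B - {a}. u \<notin> b)" using assms unfolding has_leaf_def by (meson IntI)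
  then show thesis using that by blast
qed

lemma plane_graph_ends:
  assumes "plane_graph P A" "a \<in> A" "u \<in> a \<inter> P"
  obtains v where "v \<noteq> u" "a \<inter> P = {u, v}"
proof -
  have "\<exists>g. arc g \<and> path_image g = a \<and> a \<inter> P = {pathstart g, pathfinish g}"
    using assms unfolding plane_graph_def by simp
  then obtain g where g: "arc g" "a \<inter> P = {pathstart g, pathfinish g}" by auto
  have "pathstart g \<noteq> pathfinish g" using arc_distinct_ends[OF g(1)] by simp
  moreover have "u = pathstart g \<or> u = pathfinish g" using assms(3) unfolding g(2) by simp
  ultimately show thesis using that g(2) by (metis insert_commute)
qed

text \<open>Without leaves one can always walk on to a new edge, and simplicity forbids a return
  after two steps. So a leafless set has at least three edges, and the girth bound applies with
  \<open>k = 3\<close>.\<close>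

theorem plane_graph_simple_bound:
  assumes pg: "plane_graph P A" and simple: "inj_on (\<lambda>a. a \<inter> P) A" and P: "card P \<ge> 3"
  shows "card A + 6 \<le> 3 * card P"
proof -
  have "has_leaf P B" if B: "B \<subseteq> A" "B \<noteq> {}" "card B < 3" for B
  proof (rule ccontr)
    assume nl: "\<not> has_leaf P B"
    note nxt = no_leaf_next[OF nl]
    have fB: "finite B" using pg finite_subset[OF B(1)] by (simp add: plane_graph_def)
    have ends: "\<exists>v. v \<noteq> u \<and> a \<inter> P = {u, v}" if "a \<in> B" "u \<in> a \<inter> P" for a u
      using plane_graph_ends[OF pg] that B(1) by blast
    obtain a where a: "a \<in> B" using B by blast
    then obtain u where "u \<in> a \<inter> P" using plane_graph_edge[OF pg, of a] B(1) by (metis insertI1 subsetD)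
    then obtain v where v: "v \<noteq> u" "a \<inter> P = {u, v}" using ends a by blast
    obtain b where b: "b \<in> B" "b \<noteq> a" "v \<in> b" using nxt[OF a, of v] v by blast
    obtain w where w: "w \<noteq> v" "b \<inter> P = {v, w}" using ends[of b v] b v by blast
    have "w \<noteq> u"
    proof
      assume "w = u"
      then have "a \<inter> P = b \<inter> P" using v w by (simp add: insert_commute)
      then have "a = b" using inj_onD[OF simple] a b B(1) by (meson subsetD)
      then show False using b by simp
    qed
    obtain c where c: "c \<in> B" "c \<noteq> b" "w \<in> c" using nxt[OF b(1), of w] w by blast
    have "c \<noteq> a" using c w v \<open>w \<noteq> u\<close> by blast
    then have "card {a, b, c} = 3" using b c by auto
    moreover have "card {a, b, c} \<le> card B"
      using a b(1) c(1) by (intro card_mono[OF fB]) simp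
    ultimately show False using B by simp
  qed
  then show ?thesis using plane_graph_girth_bound[OF pg, of 3] P by auto
qed

text \<open>The walk of the simple case is continued by one edge: the bipartition forbids a return
  after three steps, which gives four edges and \<open>k = 4\<close>.\<close>

theorem plane_graph_bipartite_bound:
  assumes pg: "plane_graph P A" and simple: "inj_on (\<lambda>a. a \<inter> P) A" and P: "card P \<ge> 3"
    and bip: "\<And>a u v. a \<in> A \<Longrightarrow> a \<inter> P = {u, v} \<Longrightarrow> u \<in> Q \<longleftrightarrow> v \<notin> Q"
  shows "card A + 4 \<le> 2 * card P"
proof -
  have "has_leaf P B" if B: "B \<subseteq> A" "B \<noteq> {}" "card B < 4" for B
  proof (rule ccontr)
    assume nl: "\<not> has_leaf P B"
    note nxt = no_leaf_next[OF nl]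
    have fB: "finite B" using pg finite_subset[OF B(1)] by (simp add: plane_graph_def)
    have ends: "\<exists>v. v \<noteq> u \<and> a \<inter> P = {u, v}" if "a \<in> B" "u \<in> a \<inter> P" for a u
      using plane_graph_ends[OF pg] that B(1) by blast
    obtain a where a: "a \<in> B" using B by blast
    then obtain u where "u \<in> a \<inter> P" using plane_graph_edge[OF pg, of a] B(1) by (metis insertI1 subsetD)
    then obtain v where v: "v \<noteq> u" "a \<inter> P = {u, v}" using ends a by blast
    obtain b where b: "b \<in> B" "b \<noteq> a" "v \<in> b" using nxt[OF a, of v] v by blast
    obtain w where w: "w \<noteq> v" "b \<inter> P = {v, w}" using ends[of b v] b v by blast
    have wu: "w \<noteq> u"
    proof
      assume "w = u"
      then have "a \<inter> P = b \<inter> P" using v w by (simp add: insert_commute)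
      then have "a = b" using inj_onD[OF simple] a b B(1) by (meson subsetD)
      then show False using b by simp
    qed
    obtain c where c: "c \<in> B" "c \<noteq> b" "w \<in> c" using nxt[OF b(1), of w] w by blast
    have ca: "c \<noteq> a" using c w v wu by blast
    obtain x where x: "x \<noteq> w" "c \<inter> P = {w, x}" using ends[of c w] c w by blast
    have xv: "x \<noteq> v"
    proof
      assume "x = v"
      then have "c \<inter> P = b \<inter> P" using v w x by (simp add: insert_commute)
      then have "c = b" using inj_onD[OF simple] a b c B(1) by (meson subsetD)
      then show False using b c by simp
    qed
    have xu: "x \<noteq> u"
      using bip[of a u v] bip[of b v w] bip[of c w x] a b(1) c(1) B(1) v(2) w(2) x(2) by (metis subsetD)
    obtain d where d: "d \<in> B" "d \<noteq> c" "x \<in> d" using nxt[OF c(1), of x] x by blast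
    have "d \<noteq> a" "d \<noteq> b" using d x w v xv xu by blast+
    then have "card {a, b, c, d} = 4" using b c ca d by auto
    moreover have "card {a, b, c, d} \<le> card B"
      using a b(1) c(1) d(1) by (intro card_mono[OF fB]) simp
    ultimately show False using B by simp
  qed
  then show ?thesis using plane_graph_girth_bound[OF pg, of 4] P by auto
qed

section \<open>The edge bound for 1-plane drawings\<close>

lemma crosses_at_mem: "crosses_at A B x \<Longrightarrow> x \<in> A \<and> x \<in> B"
proof -
  assume "crosses_at A B x"
  then obtain U h k where U: "x \<in> U" "homeomorphism U (ball 0 1) h k" "h x = 0"
    "h ` (A \<inter> U) = {z \<in> ball 0 1. Im z = 0}" "h ` (B \<inter> U) = {z \<in> ball 0 1. Re z = 0}"
    unfolding crosses_at_def by (elim exE conjE) (rule that; assumption)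
  have inj: "y = x" if "y \<in> U" "h y = 0" for y
    using that U(1-3) unfolding homeomorphism_def by metis
  have "0 \<in> h ` (A \<inter> U)" "0 \<in> h ` (B \<inter> U)" unfolding U(4,5) by auto
  then show ?thesis using inj by fastforce
qed

text \<open>Multiplication by \<i> turns the disc by a right angle and interchanges the two axes of
  the chart.\<close>

lemma crosses_at_sym:
  assumes "crosses_at A B x" shows "crosses_at B A x"
proof -
  obtain U h k where U: "open U" "x \<in> U" "homeomorphism U (ball 0 1) h k" "h x = 0"
    "h ` (A \<inter> U) = {z \<in> ball 0 1. Im z = 0}" "h ` (B \<inter> U) = {z \<in> ball 0 1. Re z = 0}"
    using assms unfolding crosses_at_def by (elim exE conjE) (rule that; assumption)
  let ?r = "\<lambda>z. \<i> * z" and ?s = "\<lambda>z. - \<i> * z"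
  have inv: "?s (?r z) = z" "?r (?s z) = z" for z by (simp_all add: complex_eq_iff)
  have rs: "?r ` S = {z. ?s z \<in> S}" "?s ` S = {z. ?r z \<in> S}" for S
    using inv by (metis (mono_tags, lifting) Collect_cong image_eqI image_iff mem_Collect_eq set_eqI)+
  have "?r ` ball 0 1 = ball 0 1" "?s ` ball 0 1 = ball 0 1"
    unfolding rs by (auto simp: norm_mult)
  then have "homeomorphism (ball 0 1) (ball 0 1) ?r ?s"
    unfolding homeomorphism_def using inv by (auto intro!: continuous_intros)
  then have hom: "homeomorphism U (ball 0 1) (?r \<circ> h) (k \<circ> ?s)"
    using homeomorphism_compose[OF U(3)] by blast
  have "(?r \<circ> h) ` (B \<inter> U) = {z \<in> ball 0 1. Im z = 0}"
    unfolding image_comp[symmetric] U(6) rs by (auto simp: norm_mult)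
  moreover have "(?r \<circ> h) ` (A \<inter> U) = {z \<in> ball 0 1. Re z = 0}"
    unfolding image_comp[symmetric] U(5) rs by (auto simp: norm_mult)
  moreover have "(?r \<circ> h) x = 0" using U(4) by simp
  ultimately show ?thesis unfolding crosses_at_def using U(1,2) hom by blast
qed

lemma arc_split_at:
  fixes g :: "real \<Rightarrow> 'a::real_normed_vector"
  assumes g: "arc g" and x: "x \<in> path_image g" "x \<noteq> pathstart g" "x \<noteq> pathfinish g"
  obtains g1 g2 where "arc g1" "arc g2" "pathstart g1 = pathstart g" "pathfinish g1 = x"
    "pathstart g2 = pathfinish g" "pathfinish g2 = x"
    "path_image g1 \<union> path_image g2 = path_image g" "path_image g1 \<inter> path_image g2 = {x}"
proof -
  obtain t where t: "t \<in> {0..1}" "x = g t" using x(1) by (auto simp: path_image_def)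
  have t01: "t \<noteq> 0" "t \<noteq> 1" using x t by (auto simp: pathstart_def pathfinish_def)
  have inj: "inj_on g {0..1}" using g by (simp add: arc_def)
  let ?g1 = "subpath 0 t g" and ?g2 = "subpath 1 t g"
  have im: "path_image ?g1 = g ` {0..t}" "path_image ?g2 = g ` {t..1}"
    using t t01 by (simp_all add: path_image_subpath)
  have "g ` {0..t} \<inter> g ` {t..1} = g ` ({0..t} \<inter> {t..1})"
    using t by (intro inj_on_image_Int[OF inj, symmetric]) auto
  moreover have "{0..t} \<inter> {t..1} = {t}" "{0..t} \<union> {t..1} = {0..1}" using t by auto
  ultimately have "path_image ?g1 \<inter> path_image ?g2 = {x}" "path_image ?g1 \<union> path_image ?g2 = path_image g"
    unfolding im using t by (auto simp: path_image_def simp flip: image_Un)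
  moreover have "arc ?g1" "arc ?g2" using arc_subpath_arc[OF g] t t01 by auto
  ultimately show thesis using that[of ?g1 ?g2] t(2) by (simp add: pathstart_def pathfinish_def subpath_def)
qed

lemma card_ge_double_image:
  assumes "finite C" and "\<And>e. e \<in> C \<Longrightarrow> \<exists>f\<in>C. f \<noteq> e \<and> p f = p e"
  shows "2 * card (p ` C) \<le> card C"
proof -
  have two: "2 \<le> card {e \<in> C. p e = x}" if x: "x \<in> p ` C" for x
  proof -
    obtain e where e: "e \<in> C" "p e = x" using x by blast
    then obtain f where f: "f \<in> C" "f \<noteq> e" "p f = x" using assms(2) by metis
    have "card {e, f} \<le> card {e \<in> C. p e = x}"
      using e f assms(1) by (intro card_mono) auto
    then show ?thesis using f by simp
  qed
  have "2 * card (p ` C) = (\<Sum>x\<in>p ` C. 2)" by simp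
  also have "\<dots> \<le> (\<Sum>x\<in>p ` C. card {e \<in> C. p e = x})" using two by (rule sum_mono)
  also have "\<dots> = card C"
    using sum.image_gen[OF assms(1), of "\<lambda>_. 1::nat" p] by simp
  finally show ?thesis .
qed

text \<open>With c crossings, k crossed and u uncrossed edges, the half-edges at the crossings form a
  bipartite plane graph with 2k edges and all pieces together a simple one with u + 2k edges, both on
  n + c vertices; moreover 2c is at most k.\<close>

theorem one_plane_edge_bound:
  assumes G: "one_plane G" and n: "card (verts G) \<ge> 3"
  shows "card (edges G) + 8 \<le> 4 * card (verts G)"
proof -
  define V E L where "V = verts G" and "E = edges G" and "L = loc G"
  have good: "good_drawing G" and one: "\<And>e f g. e \<in> E \<Longrightarrow> f \<in> E \<Longrightarrow> g \<in> E \<Longrightarrow> crosses G e f \<Longrightarrow> crosses G e g \<Longrightarrow> f = g"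
    using G unfolding one_plane_def E_def by blast+
  have drw: "drawing G" using good unfolding good_drawing_def by blast
  have pt1: "\<And>e f x y. e \<in> E \<Longrightarrow> f \<in> E \<Longrightarrow> e \<noteq> f \<Longrightarrow> x \<in> crossings G e f \<Longrightarrow> y \<in> crossings G e f \<Longrightarrow> x = y"
    using good unfolding good_drawing_def E_def by simp
  have adj: "\<And>e f. e \<in> E \<Longrightarrow> f \<in> E \<Longrightarrow> e \<inter> f \<noteq> {} \<Longrightarrow> \<not> crosses G e f"
    using good unfolding good_drawing_def E_def by simp
  have sg: "simple_graph V E" and injL: "inj_on L V"
    and arcs: "\<And>e. e \<in> E \<Longrightarrow> \<exists>g. arc g \<and> path_image g = curve G e \<and> {pathstart g, pathfinish g} = L ` e"
    and cV: "\<And>e. e \<in> E \<Longrightarrow> curve G e \<inter> L ` V = L ` e"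
    and cc: "\<And>e f. e \<in> E \<Longrightarrow> f \<in> E \<Longrightarrow> e \<noteq> f \<Longrightarrow> curve G e \<inter> curve G f = L ` (e \<inter> f) \<union> crossings G e f"
    using drw unfolding drawing_def E_def V_def L_def by simp_all
  have finV: "finite V" and eV: "\<And>e. e \<in> E \<Longrightarrow> e \<subseteq> V" "\<And>e. e \<in> E \<Longrightarrow> card e = 2"
    using sg unfolding simple_graph_def by auto
  have finE: "finite E" using eV(1) finV by (meson finite_Pow_iff finite_subset PowI subsetI)
  have crs: "crossings G f e = crossings G e f" for e f
    unfolding crossings_def using crosses_at_sym by blast
  have crs': "crosses G e f \<Longrightarrow> crosses G f e" for e f
    unfolding crosses_def crs[of f e] by auto
  define C where "C = {e \<in> E. \<exists>f\<in>E. crosses G e f}"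
  have "\<exists>x. \<exists>f\<in>E. e \<noteq> f \<and> x \<in> crossings G e f" if "e \<in> C" for e
    using that unfolding C_def crosses_def by blast
  \<comment> \<open>An edge is crossed by at most one other edge, and at most once. So
    \<open>cp\<close> picks its only crossing point, and two edges that cross have the same
    value.\<close>
  then obtain cp where cp: "\<And>e. e \<in> C \<Longrightarrow> \<exists>f\<in>E. e \<noteq> f \<and> cp e \<in> crossings G e f" by metis
  have cp_unique: "x = cp e" if "e \<in> E" "f \<in> E" "e \<noteq> f" "x \<in> crossings G e f" for e f x
  proof -
    have "crosses G e f" using that unfolding crosses_def by blast
    then have "e \<in> C" using that unfolding C_def by blast
    then obtain f' where f': "f' \<in> E" "e \<noteq> f'" "cp e \<in> crossings G e f'" using cp by blast
    then have "crosses G e f'" unfolding crosses_def by blast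
    then have "f' = f" using one \<open>crosses G e f\<close> that f' by blast
    then show ?thesis using pt1[OF that(1,2,3)] that(4) f'(3) by blast
  qed
  have CE: "C \<subseteq> E" unfolding C_def by blast
  have finC: "finite C" using finE CE finite_subset by blast
  have cpc: "cp e \<in> curve G e" if "e \<in> C" for e
    using cp[OF that] crosses_at_mem unfolding crossings_def by blast
  have cpV: "cp e \<notin> L ` V" if eC: "e \<in> C" for e
  proof
    assume a: "cp e \<in> L ` V"
    obtain f where f: "f \<in> E" "e \<noteq> f" "cp e \<in> crossings G e f" using cp[OF eC] by blast
    have e: "e \<in> E" using eC CE by blast
    have "cp e \<in> curve G e" "cp e \<in> curve G f" using f crosses_at_mem unfolding crossings_def by blast+
    then have "cp e \<in> L ` e" "cp e \<in> L ` f" using cV[OF e] cV[OF f(1)] a by blast+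
    then have "cp e \<in> L ` (e \<inter> f)"
      using inj_on_image_Int[OF injL eV(1)[OF e] eV(1)[OF f(1)]] by simp
    then have "e \<inter> f \<noteq> {}" by blast
    moreover have "crosses G e f" using f unfolding crosses_def by blast
    ultimately show False using adj e f(1) by blast
  qed
  define X where "X = cp ` C"
  define P where "P = L ` V \<union> X"
  have finP: "finite P" unfolding P_def X_def using finV finC by simp
  have "\<forall>x\<in>X. x \<notin> L ` V" using cpV unfolding X_def by simp
  then have disj: "L ` V \<inter> X = {}" by blast
  have curveX: "curve G e \<inter> X \<subseteq> {cp e}" if e: "e \<in> E" for e
  proof
    fix x assume x: "x \<in> curve G e \<inter> X"
    then obtain f where f: "f \<in> C" "x = cp f" unfolding X_def by blast
    show "x \<in> {cp e}"
    proof (cases "f = e")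
      case False
      have "x \<in> curve G e \<inter> curve G f" using x f cpc by blast
      moreover have "x \<notin> L ` (e \<inter> f)" using cpV[OF f(1)] eV(1)[OF e] f(2) by auto
      ultimately have "x \<in> crossings G e f" using cc[OF e, of f] CE f(1) False by blast
      then show ?thesis using cp_unique[OF e, of f x] CE f(1) False by blast
    qed (use f in simp)
  qed
  have curveX0: "curve G e \<inter> X = {}" if e: "e \<in> E - C" for e
  proof -
    have False if x: "x \<in> curve G e" "x \<in> X" for x
    proof -
      obtain f where f: "f \<in> C" "x = cp f" using x(2) unfolding X_def by blast
      have ef: "e \<noteq> f" "e \<in> E" "f \<in> E" using e f CE by auto
      have "x \<in> curve G e \<inter> curve G f" using x f cpc by blast
      moreover have "x \<notin> L ` (e \<inter> f)" using cpV[OF f(1)] eV(1)[OF ef(2)] f(2) by auto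
      ultimately have "x \<in> crossings G e f" using cc[OF ef(2,3,1)] by blast
      then have "crosses G e f" using ef unfolding crosses_def by blast
      then show False using e ef(3) unfolding C_def by blast
    qed
    then show ?thesis by blast
  qed
  have curvesP: "curve G e \<inter> curve G f \<subseteq> P" if "e \<in> E" "f \<in> E" "e \<noteq> f" for e f
  proof -
    have "crossings G e f \<subseteq> X"
    proof
      fix x assume x: "x \<in> crossings G e f"
      have "crosses G e f" using x that unfolding crosses_def by blast
      then have "e \<in> C" using that unfolding C_def by blast
      then show "x \<in> X" using cp_unique[OF that x] unfolding X_def by blast
    qed
    moreover have "L ` (e \<inter> f) \<subseteq> L ` V" using eV(1)[OF that(1)] by blast
    ultimately show ?thesis unfolding cc[OF that] P_def by blast
  qed
  define half where "half = (\<lambda>e a. \<exists>g u. arc g \<and> path_image g = a \<and> u \<in> e \<and>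
    a \<inter> P = {pathstart g, pathfinish g} \<and> pathstart g = L u \<and> pathfinish g = cp e)"
  have "\<exists>a b. half e a \<and> half e b \<and> a \<union> b = curve G e \<and> a \<inter> b = {cp e} \<and> a \<noteq> b" if e: "e \<in> C" for e
  proof -
    have eE: "e \<in> E" using e CE by blast
    obtain g where g: "arc g" "path_image g = curve G e" "{pathstart g, pathfinish g} = L ` e"
      using arcs[OF eE] by auto
    have LV: "L ` e \<subseteq> L ` V" using eV(1)[OF eE] by blast
    have "cp e \<noteq> pathstart g" "cp e \<noteq> pathfinish g" using cpV[OF e] g(3) LV by auto
    moreover have "cp e \<in> path_image g" using cpc[OF e] g(2) by simp
    ultimately obtain g1 g2 where s: "arc g1" "arc g2" "pathstart g1 = pathstart g" "pathfinish g1 = cp e"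
      "pathstart g2 = pathfinish g" "pathfinish g2 = cp e"
      "path_image g1 \<union> path_image g2 = path_image g" "path_image g1 \<inter> path_image g2 = {cp e}"
      using arc_split_at[OF g(1)] by metis
    have xP: "cp e \<in> P" using e unfolding P_def X_def by blast
    have cP: "curve G e \<inter> P \<subseteq> {pathstart g, pathfinish g, cp e}"
      using cV[OF eE] curveX[OF eE] g(3) unfolding P_def by blast
    have ends: "pathstart g \<in> P" "pathfinish g \<in> P" using g(3) LV unfolding P_def by blast+
    have mem: "pathstart g1 \<in> path_image g1" "pathstart g2 \<in> path_image g2"
      "cp e \<in> path_image g1" "cp e \<in> path_image g2"
      using pathstart_in_path_image[of g1] pathstart_in_path_image[of g2] s(8) by auto
    have ne: "pathstart g1 \<noteq> cp e" "pathstart g2 \<noteq> cp e"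
      using \<open>cp e \<noteq> pathstart g\<close> \<open>cp e \<noteq> pathfinish g\<close> s by auto
    have no: "pathfinish g \<notin> path_image g1"
    proof
      assume "pathfinish g \<in> path_image g1"
      then have "pathstart g2 \<in> path_image g1 \<inter> path_image g2" using mem(2) s(5) by simp
      then show False using s(8) ne(2) by simp
    qed
    have no': "pathstart g \<notin> path_image g2"
    proof
      assume "pathstart g \<in> path_image g2"
      then have "pathstart g1 \<in> path_image g1 \<inter> path_image g2" using mem(1) s(3) by simp
      then show False using s(8) ne(1) by simp
    qed
    have "pathstart g \<in> L ` e" "pathfinish g \<in> L ` e" using g(3) by (metis insertI1 insertI2)+
    then obtain u v where u: "u \<in> e" "pathstart g = L u" and v: "v \<in> e" "pathfinish g = L v" by blast
    have sub: "path_image g1 \<subseteq> curve G e" "path_image g2 \<subseteq> curve G e" using s(7) g(2) by blast+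
    have "path_image g1 \<inter> P = {pathstart g1, pathfinish g1}"
      using subset_trans[OF Int_mono[OF sub(1) subset_refl] cP] no ends(1) xP mem(1,3) s(3,4) by auto
    then have h1: "half e (path_image g1)" unfolding half_def using s(1,3,4) u by metis
    have "path_image g2 \<inter> P = {pathstart g2, pathfinish g2}"
      using subset_trans[OF Int_mono[OF sub(2) subset_refl] cP] no' ends(2) xP mem(2,4) s(5,6) by auto
    then have h2: "half e (path_image g2)" unfolding half_def using s(2,5,6) v by metis
    have "path_image g1 \<noteq> path_image g2" using mem(1) s(3) no' by auto
    then show ?thesis using h1 h2 s(7,8) g(2) by metis
  qed
  then obtain a b where ab: "\<And>e. e \<in> C \<Longrightarrow> half e (a e)" "\<And>e. e \<in> C \<Longrightarrow> half e (b e)"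
    "\<And>e. e \<in> C \<Longrightarrow> a e \<union> b e = curve G e" "\<And>e. e \<in> C \<Longrightarrow> a e \<inter> b e = {cp e}" "\<And>e. e \<in> C \<Longrightarrow> a e \<noteq> b e"
    by metis
  define HH where "HH = (\<Union>e\<in>C. {a e, b e})"
  define UU where "UU = curve G ` (E - C)"
  have HHE: "\<exists>e\<in>C. (h = a e \<or> h = b e) \<and> half e h \<and> h \<subseteq> curve G e" if "h \<in> HH" for h
    using that ab(1,2,3) unfolding HH_def by blast
  have arcsH: "\<exists>g. arc g \<and> path_image g = h \<and> h \<inter> P = {pathstart g, pathfinish g}" if hH: "h \<in> HH" for h
  proof -
    obtain e where "half e h" using HHE[OF hH] by blast
    then show ?thesis unfolding half_def by auto
  qed
  have UUP: "curve G e \<inter> P = L ` e" if "e \<in> E - C" for e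
    using curveX0[OF that] cV[of e] that unfolding P_def by blast
  have arcsU: "\<exists>g. arc g \<and> path_image g = h \<and> h \<inter> P = {pathstart g, pathfinish g}" if hU: "h \<in> UU" for h
  proof -
    obtain e where e: "h = curve G e" "e \<in> E - C" using hU unfolding UU_def by blast
    then obtain g where g: "arc g" "path_image g = h" "{pathstart g, pathfinish g} = L ` e"
      using arcs[of e] by auto
    have "h \<inter> P = {pathstart g, pathfinish g}" using UUP[OF e(2)] e(1) g(3) by simp
    then show ?thesis using g(1,2) by blast
  qed
  have notsub: "\<not> h \<subseteq> P" if h: "\<exists>g. arc g \<and> path_image g = h \<and> h \<inter> P = {pathstart g, pathfinish g}" for h
  proof -
    obtain g where g: "arc g" "path_image g = h" "h \<inter> P = {pathstart g, pathfinish g}" using h by auto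
    have "g (1/2) \<in> g ` {0<..<1}" by auto
    then show ?thesis using arc_open_image[OF g(1)] g(2,3) by blast
  qed
  have HHdisj: "h \<inter> h' \<subseteq> P" if hh: "h \<in> HH" "h' \<in> HH" "h \<noteq> h'" for h h'
  proof -
    obtain e where e: "e \<in> C" "h = a e \<or> h = b e" "h \<subseteq> curve G e" using HHE[OF hh(1)] by blast
    obtain e' where e': "e' \<in> C" "h' = a e' \<or> h' = b e'" "h' \<subseteq> curve G e'" using HHE[OF hh(2)] by blast
    show ?thesis
    proof (cases "e = e'")
      case True
      then have "h \<inter> h' = {cp e}" using e(2) e'(2) hh(3) ab(4)[OF e(1)] by blast
      then show ?thesis using e(1) unfolding P_def X_def by blast
    next
      case False
      then show ?thesis using curvesP[of e e'] e e' CE by blast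
    qed
  qed
  have HUdisj: "h \<inter> h' \<subseteq> P" if h: "h \<in> HH" "h' \<in> UU" for h h'
  proof -
    obtain e where e: "e \<in> C" "h \<subseteq> curve G e" using HHE[OF h(1)] by blast
    obtain e' where e': "e' \<in> E - C" "h' = curve G e'" using h(2) unfolding UU_def by blast
    then show ?thesis using curvesP[of e e'] e e' CE by blast
  qed
  have HUneq: "HH \<inter> UU = {}"
  proof -
    have False if "h \<in> HH" "h \<in> UU" for h
      using HUdisj[OF that] notsub[OF arcsU[OF that(2)]] by simp
    then show ?thesis by blast
  qed
  have UUdisj: "h \<inter> h' \<subseteq> P" if h: "h \<in> UU" "h' \<in> UU" "h \<noteq> h'" for h h'
  proof -
    obtain e where e: "e \<in> E - C" "h = curve G e" using h(1) unfolding UU_def by blast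
    obtain e' where e': "e' \<in> E - C" "h' = curve G e'" using h(2) unfolding UU_def by blast
    have "e \<noteq> e'" using e e' h(3) by blast
    then show ?thesis using curvesP[of e e'] e e' by blast
  qed
  have finA: "finite (HH \<union> UU)" unfolding HH_def UU_def using finC finE by simp
  have pg: "plane_graph P (HH \<union> UU)"
    unfolding plane_graph_def
  proof (intro conjI ballI impI finP finA)
    fix h assume "h \<in> HH \<union> UU"
    then show "\<exists>g. arc g \<and> path_image g = h \<and> h \<inter> P = {pathstart g, pathfinish g}"
      using arcsH arcsU by (elim UnE) simp_all
  next
    fix h h' assume "h \<in> HH \<union> UU" "h' \<in> HH \<union> UU" "h \<noteq> h'"
    then show "h \<inter> h' \<subseteq> P"
      using HHdisj[of h h'] HUdisj[of h h'] HUdisj[of h' h] UUdisj[of h h'] by (elim UnE) (simp_all add: Int_commute)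
  qed
  have injHU: "inj_on (\<lambda>h. h \<inter> P) (HH \<union> UU)"
  proof -
    have HHP: "\<exists>u. u \<in> e \<and> h \<inter> P = {L u, cp e}" if he: "half e h" for e h
      using he unfolding half_def by auto
    \<comment> \<open>Two half-edges with the same ends: if they belong to one edge, they meet only
      in the crossing point and so differ in their outer ends; if they belong to two edges, these
      cross and share a vertex, which a good drawing excludes.\<close>
    have *: "h = h'" if h: "h \<in> HH" "h' \<in> HH" "h \<inter> P = h' \<inter> P" for h h'
    proof -
      obtain e where e: "e \<in> C" "h = a e \<or> h = b e" "half e h" "h \<subseteq> curve G e" using HHE[OF h(1)] by blast
      obtain e' where e': "e' \<in> C" "h' = a e' \<or> h' = b e'" "half e' h'" "h' \<subseteq> curve G e'" using HHE[OF h(2)] by blast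
      obtain u where u: "u \<in> e" "h \<inter> P = {L u, cp e}" using HHP[OF e(3)] by blast
      obtain u' where u': "u' \<in> e'" "h' \<inter> P = {L u', cp e'}" using HHP[OF e'(3)] by blast
      have uV: "u \<in> V" "u' \<in> V" using u u' eV(1) e(1) e'(1) CE by blast+
      have "L u = L u'" "cp e = cp e'"
        using h(3) cpV[OF e(1)] cpV[OF e'(1)] uV unfolding u(2) u'(2) by (metis doubleton_eq_iff imageI)+
      then have "u = u'" using inj_onD[OF injL] uV by blast
      show "h = h'"
      proof (rule ccontr)
        assume "h \<noteq> h'"
        have Lu: "L u \<in> h \<inter> h'" "cp e \<in> h \<inter> h'"
          using u(2) u'(2) \<open>L u = L u'\<close> \<open>cp e = cp e'\<close> by blast+
        show False
        proof (cases "e = e'")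
          case True
          then have "h \<inter> h' = {cp e}" using e(2) e'(2) \<open>h \<noteq> h'\<close> ab(4)[OF e(1)] by blast
          then have "L u = cp e" using Lu(1) by simp
          then show False using cpV[OF e(1)] uV(1) by (metis imageI)
        next
          case False
          have "cp e \<in> curve G e \<inter> curve G e'" using Lu e(4) e'(4) by blast
          moreover have ee: "e \<in> E" "e' \<in> E" using e(1) e'(1) CE by blast+
          moreover have "cp e \<notin> L ` (e \<inter> e')" using cpV[OF e(1)] eV(1)[OF ee(1)] by auto
          ultimately have "cp e \<in> crossings G e e'" using cc[OF ee False] by blast
          then have "crosses G e e'" unfolding crosses_def using False by blast
          then show False using adj[OF ee] u(1) u'(1) \<open>u = u'\<close> by blast
        qed
      qed
    qed
    have **: False if h: "h \<in> HH" "h' \<in> UU" "h \<inter> P = h' \<inter> P" for h h'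
    proof -
      obtain e where e: "e \<in> C" "half e h" using HHE[OF h(1)] by blast
      obtain e' where e': "e' \<in> E - C" "h' = curve G e'" using h(2) unfolding UU_def by blast
      have "cp e \<in> h \<inter> P" using HHP[OF e(2)] by blast
      moreover have "h' \<inter> P \<subseteq> L ` V" using UUP[OF e'(1)] eV(1)[of e'] e' by blast
      ultimately show False using h(3) cpV[OF e(1)] by blast
    qed
    have ***: "h = h'" if h: "h \<in> UU" "h' \<in> UU" "h \<inter> P = h' \<inter> P" for h h'
    proof -
      obtain e where e: "e \<in> E - C" "h = curve G e" using h(1) unfolding UU_def by blast
      obtain e' where e': "e' \<in> E - C" "h' = curve G e'" using h(2) unfolding UU_def by blast
      have "L ` e = L ` e'" using h(3) UUP[OF e(1)] UUP[OF e'(1)] e(2) e'(2) by simp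
      then have "e = e'" using inj_on_image_eq_iff[OF injL] eV(1) e(1) e'(1) by blast
      then show ?thesis using e(2) e'(2) by simp
    qed
    show ?thesis
    proof (rule inj_onI)
      fix h h' assume hh: "h \<in> HH \<union> UU" "h' \<in> HH \<union> UU" and eq: "h \<inter> P = h' \<inter> P"
      from hh show "h = h'"
      proof (elim UnE)
        assume "h \<in> HH" "h' \<in> HH" then show ?thesis using *[OF _ _ eq] by simp
      next
        assume "h \<in> HH" "h' \<in> UU" then show ?thesis using **[OF _ _ eq] by simp
      next
        assume "h \<in> UU" "h' \<in> HH" then show ?thesis using **[OF _ _ eq[symmetric]] by simp
      next
        assume "h \<in> UU" "h' \<in> UU" then show ?thesis using ***[OF _ _ eq] by simp
      qed
    qed
  qed
  have cardU: "card UU = card (E - C)"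
    unfolding UU_def
  proof (intro card_image inj_onI)
    fix e f assume ef: "e \<in> E - C" "f \<in> E - C" "curve G e = curve G f"
    have "L ` e = L ` f" using UUP[OF ef(1)] UUP[OF ef(2)] ef(3) by simp
    then show "e = f" using inj_on_image_eq_iff[OF injL] eV(1) ef(1,2) by blast
  qed
  have cardH: "card HH = 2 * card C"
  proof -
    have "{a e, b e} \<inter> {a f, b f} = {}" if ef: "e \<in> C" "f \<in> C" "e \<noteq> f" for e f
    proof -
      have False if h: "h \<in> {a e, b e}" "h \<in> {a f, b f}" for h
      proof -
        have "h \<subseteq> curve G e \<inter> curve G f" using h ab(3)[OF ef(1)] ab(3)[OF ef(2)] by blast
        then have "h \<subseteq> P" using curvesP[of e f] ef CE by blast
        moreover have "h \<in> HH" using h ef unfolding HH_def by blast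
        ultimately show False using notsub[OF arcsH] by blast
      qed
      then show ?thesis by blast
    qed
    then have "card HH = (\<Sum>e\<in>C. card {a e, b e})"
      unfolding HH_def using finC by (intro card_UN_disjoint) auto
    also have "\<dots> = (\<Sum>e\<in>C. 2)" using ab(5) by (intro sum.cong) auto
    finally show ?thesis by simp
  qed
  have cardX: "2 * card X \<le> card C"
    unfolding X_def
  proof (rule card_ge_double_image[OF finC])
    fix e assume e: "e \<in> C"
    then obtain f where f: "f \<in> E" "e \<noteq> f" "cp e \<in> crossings G e f" using cp by blast
    have "crosses G e f" using f(2,3) unfolding crosses_def by blast
    then have "crosses G f e" by (rule crs')
    then have "f \<in> C" using f(1) e CE unfolding C_def by blast
    moreover have "cp f = cp e" using cp_unique[of f e "cp e"] f e CE by (auto simp: crs[of f e])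
    ultimately show "\<exists>f\<in>C. f \<noteq> e \<and> cp f = cp e" using f(2) by blast
  qed
  have cardP: "card P = card V + card X"
    unfolding P_def using card_Un_disjoint[of "L ` V" X] disj finV finC card_image[OF injL]
    by (simp add: X_def)
  have nP: "card P \<ge> 3" using cardP n V_def by simp
  have "card (HH \<union> UU) + 6 \<le> 3 * card P" by (rule plane_graph_simple_bound[OF pg injHU nP])
  moreover have "card (HH \<union> UU) = card HH + card UU"
    using finA HUneq by (intro card_Un_disjoint) auto
  moreover have "card HH + 4 \<le> 2 * card P"
  proof (rule plane_graph_bipartite_bound[where Q = X])
    show "plane_graph P HH" by (rule plane_graph_subset[OF pg]) simp
    show "inj_on (\<lambda>a. a \<inter> P) HH" by (rule inj_on_subset[OF injHU]) simp
    fix h p q assume h: "h \<in> HH" "h \<inter> P = {p, q}"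
    obtain e where e: "e \<in> C" "half e h" using HHE[OF h(1)] by blast
    obtain u where u: "u \<in> e" "h \<inter> P = {L u, cp e}" using e(2) unfolding half_def by auto
    have "L u \<notin> X" "cp e \<in> X" using disj u(1) eV(1)[of e] e(1) CE unfolding X_def by blast+
    then show "(p \<in> X) = (q \<notin> X)" using h(2) unfolding u(2) by (metis doubleton_eq_iff)
  qed (rule nP)
  moreover have "card E = card C + card (E - C)"
    using card_Diff_subset[OF finC CE] card_mono[OF finE CE] by simp
  \<comment> \<open>In the notation above: \<open>2c \<le> k\<close> and
    \<open>k + 2 \<le> n + c\<close> give \<open>c \<le> n - 2\<close>. Then
    \<open>u + 2k \<le> 3n + 3c - 6\<close> yields
    \<open>u + k \<le> 3n - 6 + 3c - k \<le> 3n - 6 + c \<le> 4n - 8\<close>.\<close>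
  ultimately show ?thesis
    using cardU cardH cardX cardP unfolding E_def[symmetric] V_def[symmetric] by linarith
qed

section \<open>Local crossings\<close>

lemma crosses_at_homeomorphism:
  assumes T: "homeomorphism UNIV UNIV T T'" and c: "crosses_at A B x"
  shows "crosses_at (T ` A) (T ` B) (T x)"
proof -
  obtain U h k where U: "open U" "x \<in> U" "homeomorphism U (ball 0 1) h k" "h x = 0"
    "h ` (A \<inter> U) = {z \<in> ball 0 1. Im z = 0}" "h ` (B \<inter> U) = {z \<in> ball 0 1. Re z = 0}"
    using c unfolding crosses_at_def by (elim exE conjE) (rule that; assumption)
  have TT: "T' (T z) = z" "T (T' z) = z" for z using T unfolding homeomorphism_def by auto
  have cT': "continuous_on UNIV T'" using T unfolding homeomorphism_def by auto
  have cT: "continuous_on UNIV T" using T unfolding homeomorphism_def by auto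
  have im: "T ` U = T' -` U"
  proof (intro equalityI subsetI)
    fix v assume "v \<in> T' -` U"
    then show "v \<in> T ` U" by (intro image_eqI[of _ _ "T' v"]) (simp_all add: TT)
  qed (auto simp: TT)
  have op: "open (T ` U)" unfolding im using cT' U(1) by (simp add: open_vimage)
  have "homeomorphism (T ` U) U T' T"
    unfolding homeomorphism_def using continuous_on_subset[OF cT] continuous_on_subset[OF cT']
    by (simp add: image_image TT)
  then have hom: "homeomorphism (T ` U) (ball 0 1) (h \<circ> T') (T \<circ> k)"
    using U(3) by (rule homeomorphism_compose)
  have "inj T" by (rule inj_on_inverseI[of _ T']) (simp add: TT)
  then have "T ` S \<inter> T ` U = T ` (S \<inter> U)" for S by (simp add: image_Int)
  then have img: "(h \<circ> T') ` (T ` S \<inter> T ` U) = h ` (S \<inter> U)" for S by (simp add: image_image TT)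
  have "(h \<circ> T') (T x) = 0" using TT U(4) by simp
  moreover have "T x \<in> T ` U" using U(2) by simp
  ultimately show ?thesis unfolding crosses_at_def
    using op hom img[of A, unfolded U(5)] img[of B, unfolded U(6)] by blast
qed

text \<open>The chart is the affine map that takes \<open>d1\<close> and \<open>d2\<close>, scaled
  by \<epsilon>, to the unit vectors of the axes. Only inclusion in the lines and a short piece
  around \<open>z\<close> are asked for, so closed segments and straightened bent edges are covered
  alike.\<close>

lemma crosses_at_lines:
  fixes z d1 d2 :: complex
  assumes D: "Re d1 * Im d2 - Im d1 * Re d2 \<noteq> 0" and e: "\<epsilon> > 0"
    and A: "A \<subseteq> range (\<lambda>t. z + of_real t * d1)" "\<And>t. \<bar>t\<bar> < \<epsilon> \<Longrightarrow> z + of_real t * d1 \<in> A"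
    and B: "B \<subseteq> range (\<lambda>t. z + of_real t * d2)" "\<And>t. \<bar>t\<bar> < \<epsilon> \<Longrightarrow> z + of_real t * d2 \<in> B"
  shows "crosses_at A B z"
proof -
  define D where "D = Re d1 * Im d2 - Im d1 * Re d2"
  have D0: "D \<noteq> 0" using assms(1) by (simp add: D_def)
  define k where "k = (\<lambda>w. z + of_real (\<epsilon> * Re w) * d1 + of_real (\<epsilon> * Im w) * d2)"
  \<comment> \<open>The inverse of \<open>k\<close>, by Cramer's rule.\<close>
  define h where "h = (\<lambda>v. Complex ((Re (v - z) * Im d2 - Im (v - z) * Re d2) / (D * \<epsilon>))
    ((Re d1 * Im (v - z) - Im d1 * Re (v - z)) / (D * \<epsilon>)))"
  have hk: "h (k w) = w" for w
  proof -
    have "(Re (k w - z) * Im d2 - Im (k w - z) * Re d2) = Re w * (D * \<epsilon>)"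
      "(Re d1 * Im (k w - z) - Im d1 * Re (k w - z)) = Im w * (D * \<epsilon>)"
      by (simp_all add: k_def D_def algebra_simps)
    then show ?thesis unfolding h_def using D0 e by simp
  qed
  have kh: "k (h v) = v" for v
  proof -
    let ?x = "Re (v - z)" and ?y = "Im (v - z)"
    have "(?x * Im d2 - ?y * Re d2) * Re d1 + (Re d1 * ?y - Im d1 * ?x) * Re d2 = ?x * D"
      "(?x * Im d2 - ?y * Re d2) * Im d1 + (Re d1 * ?y - Im d1 * ?x) * Im d2 = ?y * D"
      by (simp_all add: D_def algebra_simps)
    then have "(?x * Im d2 - ?y * Re d2) / D * Re d1 + (Re d1 * ?y - Im d1 * ?x) / D * Re d2 = ?x"
      "(?x * Im d2 - ?y * Re d2) / D * Im d1 + (Re d1 * ?y - Im d1 * ?x) / D * Im d2 = ?y"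
      using D0 by (simp_all add: add_divide_distrib[symmetric])
    moreover have "\<epsilon> * (r / (D * \<epsilon>)) = r / D" for r using e D0 by simp
    ultimately show ?thesis unfolding k_def h_def by (simp add: complex_eq_iff)
  qed
  have ch: "continuous_on UNIV h" and ck: "continuous_on UNIV k"
    unfolding h_def k_def Complex_eq using D0 e by (auto intro!: continuous_intros)
  define U where "U = h -` ball 0 1"
  have hz: "h z = 0" by (simp add: h_def complex_eq_iff)
  have U: "open U" "z \<in> U" "h z = 0"
    using ch hz by (simp_all add: U_def open_vimage)
  have "h ` U = ball 0 1" "k ` ball 0 1 = U"
  proof -
    show "h ` U = ball 0 1" unfolding U_def using hk by (metis surj_def surj_image_vimage_eq)
    show "k ` ball 0 1 = U"
    proof (intro equalityI subsetI)
      fix v assume "v \<in> U"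
      then show "v \<in> k ` ball 0 1" unfolding U_def by (intro image_eqI[of _ _ "h v"]) (simp_all add: kh)
    qed (auto simp: U_def hk)
  qed
  then have hom: "homeomorphism U (ball 0 1) h k"
    unfolding homeomorphism_def
    using hk kh continuous_on_subset[OF ch] continuous_on_subset[OF ck] by simp
  have h1: "h (z + of_real t * d1) = of_real (t / \<epsilon>)" for t
    using hk[of "of_real (t / \<epsilon>)"] e by (simp add: k_def)
  have h2: "h (z + of_real t * d2) = \<i> * of_real (t / \<epsilon>)" for t
    using hk[of "\<i> * of_real (t / \<epsilon>)"] e by (simp add: k_def)
  have "h ` (A \<inter> U) = {w \<in> ball 0 1. Im w = 0}"
  proof (intro equalityI subsetI)
    fix w assume "w \<in> h ` (A \<inter> U)"
    then obtain v where v: "v \<in> A" "v \<in> U" "w = h v" by blast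
    then obtain t where "v = z + of_real t * d1" using A(1) by blast
    then have "w = of_real (t / \<epsilon>)" using v(3) h1 by simp
    moreover have "w \<in> ball 0 1" using v by (simp add: U_def)
    ultimately show "w \<in> {w \<in> ball 0 1. Im w = 0}" by simp
  next
    fix w :: complex assume w: "w \<in> {w \<in> ball 0 1. Im w = 0}"
    let ?v = "z + of_real (\<epsilon> * Re w) * d1"
    have "\<bar>Re w\<bar> < 1" using w abs_Re_le_cmod[of w] by simp
    then have "\<bar>\<epsilon> * Re w\<bar> < \<epsilon>" using e by (simp add: abs_mult)
    then have "?v \<in> A" by (rule A(2))
    moreover have "h ?v = w" unfolding h1 using e w by (simp add: complex_eq_iff)
    ultimately show "w \<in> h ` (A \<inter> U)" using w unfolding U_def by (metis (no_types, lifting) IntI imageI mem_Collect_eq vimageI)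
  qed
  moreover have "h ` (B \<inter> U) = {w \<in> ball 0 1. Re w = 0}"
  proof (intro equalityI subsetI)
    fix w assume "w \<in> h ` (B \<inter> U)"
    then obtain v where v: "v \<in> B" "v \<in> U" "w = h v" by blast
    then obtain t where "v = z + of_real t * d2" using B(1) by blast
    then have "w = \<i> * of_real (t / \<epsilon>)" using v(3) h2 by simp
    moreover have "w \<in> ball 0 1" using v by (simp add: U_def)
    ultimately show "w \<in> {w \<in> ball 0 1. Re w = 0}" by simp
  next
    fix w :: complex assume w: "w \<in> {w \<in> ball 0 1. Re w = 0}"
    let ?v = "z + of_real (\<epsilon> * Im w) * d2"
    have "\<bar>Im w\<bar> < 1" using w abs_Im_le_cmod[of w] by simp
    then have "\<bar>\<epsilon> * Im w\<bar> < \<epsilon>" using e by (simp add: abs_mult)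
    then have "?v \<in> B" by (rule B(2))
    moreover have "h ?v = w" unfolding h2 using e w by (simp add: complex_eq_iff)
    ultimately show "w \<in> h ` (B \<inter> U)" using w unfolding U_def by (metis (no_types, lifting) IntI imageI mem_Collect_eq vimageI)
  qed
  ultimately show ?thesis unfolding crosses_at_def using U hom by blast
qed

text \<open>In the chart the arc would be a full diameter through 0, but it leaves its start on one
  side only: on a short initial piece the chart values are real, non-zero and depend continuously on
  the parameter, so their sign is constant, and the rest of the arc stays away from the start. Hence
  curves that meet only in common ends do not cross.\<close>

lemma crosses_at_not_pathstart:
  assumes g: "arc g" and c: "crosses_at (path_image g) B (pathstart g)"
  shows False
proof -
  let ?x = "pathstart g"
  obtain U h k where U: "open U" "?x \<in> U" "homeomorphism U (ball 0 1) h k" "h ?x = 0"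
    "h ` (path_image g \<inter> U) = {z \<in> ball 0 1. Im z = 0}" "h ` (B \<inter> U) = {z \<in> ball 0 1. Re z = 0}"
    using c unfolding crosses_at_def by (elim exE conjE) (rule that; assumption)
  have cont: "continuous_on {0..1} g" and inj: "inj_on g {0..1}" using g by (auto simp: arc_def path_def)
  have hk: "\<And>w. w \<in> ball 0 1 \<Longrightarrow> h (k w) = w" "\<And>v. v \<in> U \<Longrightarrow> k (h v) = v" "k ` ball 0 1 = U"
    and ch: "continuous_on U h" and ck: "continuous_on (ball 0 1) k"
    using U(3) by (auto simp: homeomorphism_def)
  obtain r where r: "r > 0" "ball ?x r \<subseteq> U" using U(1,2) open_contains_ball by blast
  have "(0::real) \<in> {0..1}" by simp
  then obtain d where d: "d > 0" "\<And>t. t \<in> {0..1} \<Longrightarrow> dist t 0 < d \<Longrightarrow> dist (g t) (g 0) < r"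
    using cont r(1) unfolding continuous_on_iff by blast
  define e where "e = min (d/2) (1/2)"
  have e: "e > 0" "e < 1" "e < d" using d by (auto simp: e_def)
  have gU: "g t \<in> U" if "t \<in> {0..e}" for t
  proof -
    have "dist (g t) (g 0) < r" using d(2)[of t] that e by (auto simp: dist_real_def)
    then show ?thesis using r(2) by (auto simp: pathstart_def dist_commute subset_iff)
  qed
  have x0: "?x = g 0" by (simp add: pathstart_def)
  define \<phi> where "\<phi> = (\<lambda>t. Re (h (g t)))"
  have hreal: "h v = of_real (Re (h v))" if "v \<in> path_image g" "v \<in> U" for v
  proof -
    have "h v \<in> {z \<in> ball 0 1. Im z = 0}" using U(5) that by blast
    then show ?thesis by (simp add: complex_eq_iff)
  qed
  have gp: "g t \<in> path_image g" if "t \<in> {0..1}" for t using that by (auto simp: path_image_def)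
  have ne0: "\<phi> t \<noteq> 0" if t: "t \<in> {0<..e}" for t
  proof
    assume "\<phi> t = 0"
    then have "h (g t) = h ?x" using hreal[of "g t"] gp[of t] gU[of t] t e U(4) by (simp add: \<phi>_def)
    then have "g t = g 0" using hk(2) gU[of t] U(2) t x0 by (metis atLeastAtMost_iff greaterThanAtMost_iff less_imp_le)
    then show False using inj_onD[OF inj, of t 0] t e by auto
  qed
  have "continuous_on {0<..e} \<phi>"
    unfolding \<phi>_def using e gU
    by (auto intro!: continuous_intros continuous_on_compose2[OF ch] continuous_on_subset[OF cont])
  then have "connected (\<phi> ` {0<..e})" by (intro connected_continuous_image) auto
  then have iv: "is_interval (\<phi> ` {0<..e})" by (simp add: is_interval_connected_1)
  have "(\<forall>t\<in>{0<..e}. \<phi> t > 0) \<or> (\<forall>t\<in>{0<..e}. \<phi> t < 0)"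
  proof (rule ccontr)
    assume "\<not> ?thesis"
    then obtain t u where "t \<in> {0<..e}" "\<phi> t \<le> 0" "u \<in> {0<..e}" "\<phi> u \<ge> 0" by fastforce
    then have "0 \<in> \<phi> ` {0<..e}"
      using iv unfolding is_interval_1 by (meson imageI)
    then show False using ne0 by auto
  qed
  then obtain \<sigma> :: real where s: "\<bar>\<sigma>\<bar> = 1" "\<forall>t\<in>{0<..e}. \<sigma> * \<phi> t < 0"
    by (metis abs_1 abs_minus_cancel minus_mult_left mult_1 neg_less_0_iff_less)
  have cK: "compact (g ` {e..1})"
    using e by (intro compact_continuous_image continuous_on_subset[OF cont]) auto
  have "?x \<notin> g ` {e..1}"
  proof
    assume "?x \<in> g ` {e..1}"
    then obtain t where "t \<in> {e..1}" "g 0 = g t" using x0 by auto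
    then show False using inj_onD[OF inj, of 0 t] e by auto
  qed
  then obtain q where q: "q > 0" "ball ?x q \<subseteq> - g ` {e..1}"
    using openE[OF open_Compl[OF compact_imp_closed[OF cK]], of ?x] by blast
  have k0: "k 0 = ?x" using hk(2)[OF U(2)] U(4) by simp
  have "(0::complex) \<in> ball 0 1" by simp
  then obtain d' where d': "d' > 0" "\<And>w. w \<in> ball 0 1 \<Longrightarrow> dist w 0 < d' \<Longrightarrow> dist (k w) (k 0) < q"
    using ck q(1) unfolding continuous_on_iff by blast
  \<comment> \<open>A point of the diameter close to 0, on the side that the initial piece does not
    reach.\<close>
  define w where "w = complex_of_real (\<sigma> * min (d'/2) (1/2))"
  have "norm w = min (d'/2) (1/2)" using d' s(1) by (simp add: w_def norm_mult abs_mult)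
  then have w: "w \<in> ball 0 1" "dist w 0 < d'" "w \<noteq> 0" using d' by (auto simp: dist_norm)
  have kq: "k w \<in> ball ?x q" using d'(2)[OF w(1,2)] k0 by (simp add: dist_commute)
  have "w \<in> h ` (path_image g \<inter> U)" unfolding U(5) using w(1) by (simp add: w_def)
  then obtain v where v: "v \<in> path_image g" "v \<in> U" "h v = w" by blast
  then have kv: "k w = v" using hk(2) by blast
  obtain t where t: "t \<in> {0..1}" "v = g t" using v(1) by (auto simp: path_image_def)
  have "t < e"
  proof (rule ccontr)
    assume "\<not> t < e"
    then have "v \<in> g ` {e..1}" using t by auto
    then show False using q(2) kq kv by blast
  qed
  moreover have "t \<noteq> 0" using v(3) w(3) U(4) t(2) x0 by auto
  ultimately have "\<sigma> * \<phi> t < 0" using s(2) t(1) by auto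
  moreover have "\<phi> t = \<sigma> * min (d'/2) (1/2)" unfolding \<phi>_def using v(3) t(2) by (simp add: w_def)
  moreover have "\<sigma> * (\<sigma> * m) = m" for m using s(1) by (metis abs_mult_self_eq mult.assoc mult_1)
  ultimately show False using d' by simp
qed

lemma crosses_at_not_endpoint:
  assumes "arc g" "crosses_at (path_image g) B x"
  shows "x \<noteq> pathstart g" "x \<noteq> pathfinish g"
  using crosses_at_not_pathstart[of g B] crosses_at_not_pathstart[of "reversepath g" B] assms
  by (auto simp: arc_reversepath)

section \<open>Straight-line drawings\<close>

text \<open>Twice the signed area of the triangle \<open>p q r\<close>; it is positive when
  \<open>r\<close> lies to the left of the line from \<open>p\<close> to \<open>q\<close>.\<close>

definition ori :: "complex \<Rightarrow> complex \<Rightarrow> complex \<Rightarrow> real" where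
  "ori p q r = (Re q - Re p) * (Im r - Im p) - (Im q - Im p) * (Re r - Re p)"

lemma hull_pair_iff:
  "v \<in> convex hull {p, q::complex} \<longleftrightarrow>
    (\<exists>t. 0 \<le> t \<and> t \<le> 1 \<and> Re v = Re p + t * (Re q - Re p) \<and> Im v = Im p + t * (Im q - Im p))"
  unfolding segment_convex_hull[symmetric] in_segment by (auto simp: complex_eq_iff algebra_simps)

lemma ori_hull:
  assumes "Re v = Re r + t * (Re u - Re r)" "Im v = Im r + t * (Im u - Im r)"
  shows "ori p q v = ori p q r + t * (ori p q u - ori p q r)"
  unfolding ori_def assms by (simp add: algebra_simps)

lemma ori_hull_zero:
  assumes "v \<in> convex hull {p, q}" shows "ori p q v = 0"
proof -
  obtain t where t: "Re v = Re p + t * (Re q - Re p)" "Im v = Im p + t * (Im q - Im p)"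
    using assms unfolding hull_pair_iff by blast
  show ?thesis unfolding ori_def t by (simp add: algebra_simps)
qed

definition tame :: "complex set \<Rightarrow> complex set \<Rightarrow> bool" where
  "tame s t \<longleftrightarrow> convex hull s \<inter> convex hull t \<subseteq> s \<inter> t"

text \<open>Proper crossing: each segment has its ends strictly on different sides of the line
  through the other. Quantifying over the ends makes it a relation between unordered pairs.\<close>

definition cross_segs :: "complex set \<Rightarrow> complex set \<Rightarrow> bool" where
  "cross_segs s t \<longleftrightarrow> (\<exists>p q r u. s = {p, q} \<and> t = {r, u} \<and>
     ori p q r * ori p q u < 0 \<and> ori r u p * ori r u q < 0)"

lemma tame_sym: "tame s t \<Longrightarrow> tame t s"
  unfolding tame_def by blast

lemma cross_segs_sym: "cross_segs s t \<Longrightarrow> cross_segs t s"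
  unfolding cross_segs_def by blast

text \<open>The strict signs put the common point of the two lines strictly inside both segments,
  and the distance of its parameters to 0 and 1 is the room that \<open>crosses_at_lines\<close>
  needs.\<close>

lemma cross_segs_point:
  assumes "cross_segs s t"
  obtains z where "convex hull s \<inter> convex hull t = {z}" "z \<notin> s" "z \<notin> t"
    "crosses_at (convex hull s) (convex hull t) z"
proof -
  obtain p q r u where st: "s = {p, q}" "t = {r, u}"
    and o: "ori p q r * ori p q u < 0" "ori r u p * ori r u q < 0"
    using assms unfolding cross_segs_def by blast
  define D where "D = Re (q - p) * Im (u - r) - Im (q - p) * Re (u - r)"
  have D1: "ori p q u - ori p q r = D" "ori r u p - ori r u q = D"
    by (simp_all add: ori_def D_def algebra_simps)
  have D0: "D \<noteq> 0"
    using o(1) D1(1) by (metis diff_eq_diff_eq diff_self eq_iff_diff_eq_0 not_square_less_zero)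
  define a b where "a = ori r u p / D" and "b = - ori p q r / D"
  have frac: "0 < x / (x - y) \<and> x / (x - y) < 1" if "x * y < 0" for x y :: real
    using that by (auto simp: mult_less_0_iff field_simps)
  have bq: "b = ori p q r / (ori p q r - ori p q u)"
    using minus_divide_divide[of "ori p q r" "ori p q r - ori p q u"] unfolding b_def D1(1)[symmetric] by simp
  have ab: "0 < a" "a < 1" "0 < b" "b < 1"
    using frac[OF o(2)] frac[OF o(1)] bq unfolding a_def D1(2)[symmetric] by simp_all
  define z where "z = p + of_real a * (q - p)"
  have zr: "z = r + of_real b * (u - r)"
  proof -
    have "Re (p - r) * D + ori r u p * Re (q - p) = - ori p q r * Re (u - r)"
      "Im (p - r) * D + ori r u p * Im (q - p) = - ori p q r * Im (u - r)"
      by (simp_all add: ori_def D_def algebra_simps)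
    moreover have "ori r u p = a * D" "- ori p q r = b * D" using D0 by (simp_all add: a_def b_def)
    ultimately have "D * (Re (p - r) + a * Re (q - p)) = D * (b * Re (u - r))"
      "D * (Im (p - r) + a * Im (q - p)) = D * (b * Im (u - r))"
      by (simp_all only:) (simp_all only: ac_simps distrib_left distrib_right)
    then have "Re (p - r) + a * Re (q - p) = b * Re (u - r)" "Im (p - r) + a * Im (q - p) = b * Im (u - r)"
      using D0 by simp_all
    then show ?thesis unfolding z_def by (simp add: complex_eq_iff algebra_simps)
  qed
  have un: "v = z" if v: "v \<in> convex hull {p, q}" "v \<in> convex hull {r, u}" for v
  proof -
    obtain x where x: "Re v = Re p + x * (Re q - Re p)" "Im v = Im p + x * (Im q - Im p)"
      using v(1) unfolding hull_pair_iff by blast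
    have "0 = ori r u p + x * (ori r u q - ori r u p)"
      using ori_hull[OF x, of r u] ori_hull_zero[OF v(2)] by simp
    then have "x = a" unfolding a_def using D1(2) D0 by (simp add: field_simps)
    then show ?thesis unfolding z_def by (simp add: complex_eq_iff x)
  qed
  have zin: "z \<in> convex hull {p, q}"
    unfolding hull_pair_iff using ab by (intro exI[of _ a]) (simp add: z_def)
  moreover have "z \<in> convex hull {r, u}"
    unfolding hull_pair_iff using ab by (intro exI[of _ b]) (simp add: zr)
  ultimately have zin: "z \<in> convex hull {p, q}" "z \<in> convex hull {r, u}" by auto
  have pq: "q - p \<noteq> 0" "u - r \<noteq> 0" using D0 by (auto simp: D_def)
  have nin: "z \<notin> {p, q}" "z \<notin> {r, u}"
  proof -
    have "z \<noteq> p" unfolding z_def using pq ab by simp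
    moreover have "z - q = of_real (a - 1) * (q - p)" unfolding z_def by (simp add: algebra_simps)
    then have "z \<noteq> q" using pq ab by auto
    moreover have "z \<noteq> r" unfolding zr using pq ab by simp
    moreover have "z - u = of_real (b - 1) * (u - r)" unfolding zr by (simp add: algebra_simps)
    then have "z \<noteq> u" using pq ab by auto
    ultimately show "z \<notin> {p, q}" "z \<notin> {r, u}" by auto
  qed
  define e where "e = min (min a (1 - a)) (min b (1 - b))"
  have e: "e > 0" "e \<le> a" "e \<le> 1 - a" "e \<le> b" "e \<le> 1 - b" using ab by (auto simp: e_def)
  have "crosses_at (convex hull {p, q}) (convex hull {r, u}) z"
  proof (rule crosses_at_lines[where ?d1.0 = "q - p" and ?d2.0 = "u - r" and \<epsilon> = e])
    show "Re (q - p) * Im (u - r) - Im (q - p) * Re (u - r) \<noteq> 0" using D0 by (simp add: D_def)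
    show "e > 0" by (rule e)
    show "convex hull {p, q} \<subseteq> range (\<lambda>t. z + complex_of_real t * (q - p))"
    proof
      fix v assume "v \<in> convex hull {p, q}"
      then obtain x where "Re v = Re p + x * (Re q - Re p)" "Im v = Im p + x * (Im q - Im p)"
        unfolding hull_pair_iff by blast
      then have "v = z + of_real (x - a) * (q - p)"
        unfolding z_def by (simp add: complex_eq_iff algebra_simps)
      then show "v \<in> range (\<lambda>t. z + complex_of_real t * (q - p))" by blast
    qed
    show "convex hull {r, u} \<subseteq> range (\<lambda>t. z + complex_of_real t * (u - r))"
    proof
      fix v assume "v \<in> convex hull {r, u}"
      then obtain x where "Re v = Re r + x * (Re u - Re r)" "Im v = Im r + x * (Im u - Im r)"
        unfolding hull_pair_iff by blast
      then have "v = z + of_real (x - b) * (u - r)"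
        unfolding zr by (simp add: complex_eq_iff algebra_simps)
      then show "v \<in> range (\<lambda>t. z + complex_of_real t * (u - r))" by blast
    qed
    show "z + complex_of_real x * (q - p) \<in> convex hull {p, q}" if "\<bar>x\<bar> < e" for x
      unfolding hull_pair_iff using that e by (intro exI[of _ "a + x"]) (auto simp: z_def algebra_simps abs_less_iff)
    show "z + complex_of_real x * (u - r) \<in> convex hull {r, u}" if "\<bar>x\<bar> < e" for x
      unfolding hull_pair_iff using that e by (intro exI[of _ "b + x"]) (auto simp: zr algebra_simps abs_less_iff)
  qed
  moreover have "convex hull {p, q} \<inter> convex hull {r, u} = {z}" using un zin by blast
  ultimately show thesis using that nin unfolding st by blast
qed

lemma cross_segs_not_tame: "cross_segs s t \<Longrightarrow> \<not> tame s t"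
  by (rule cross_segs_point[of s t]) (auto simp: tame_def)

text \<open>The signed area vanishes on the first segment, and on the second it is a convex
  combination of two numbers of the same strict sign.\<close>

lemma tame_one_side:
  assumes "ori p q r * ori p q u > 0"
  shows "tame {p, q} {r, u}" "{p, q} \<noteq> {r, u}"
proof -
  have False if v: "v \<in> convex hull {p, q}" "v \<in> convex hull {r, u}" for v
  proof -
    obtain x where x: "0 \<le> x" "x \<le> 1" "Re v = Re r + x * (Re u - Re r)" "Im v = Im r + x * (Im u - Im r)"
      using v(2) unfolding hull_pair_iff by blast
    have z: "(1 - x) * ori p q r + x * ori p q u = 0"
      using ori_hull[OF x(3,4), of p q] ori_hull_zero[OF v(1)] by (simp add: algebra_simps)
    have "ori p q r > 0 \<and> ori p q u > 0 \<or> ori p q r < 0 \<and> ori p q u < 0"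
      using assms by (auto simp: zero_less_mult_iff)
    then show False
    proof
      assume o: "ori p q r > 0 \<and> ori p q u > 0"
      have "0 \<le> (1 - x) * ori p q r" "0 \<le> x * ori p q u" using o x by auto
      then have "(1 - x) * ori p q r = 0" "x * ori p q u = 0" using z by linarith+
      then show False using o by auto
    next
      assume o: "ori p q r < 0 \<and> ori p q u < 0"
      have "(1 - x) * ori p q r \<le> 0" "x * ori p q u \<le> 0" using o x by (auto simp: mult_le_0_iff)
      then have "(1 - x) * ori p q r = 0" "x * ori p q u = 0" using z by linarith+
      then show False using o by auto
    qed
  qed
  then have dis: "convex hull {p, q} \<inter> convex hull {r, u} = {}" by blast
  then show "tame {p, q} {r, u}" by (simp add: tame_def)
  show "{p, q} \<noteq> {r, u}" using dis hull_inc[of p "{p, q}" convex] by auto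
qed

lemma tame_shared:
  assumes "ori p q u \<noteq> 0"
  shows "tame {p, q} {p, u}" "{p, q} \<noteq> {p, u}"
proof -
  have "v = p" if v: "v \<in> convex hull {p, q}" "v \<in> convex hull {p, u}" for v
  proof -
    obtain x where x: "Re v = Re p + x * (Re u - Re p)" "Im v = Im p + x * (Im u - Im p)"
      using v(2) unfolding hull_pair_iff by blast
    have "0 = ori p q p + x * (ori p q u - ori p q p)"
      using ori_hull[OF x(1,2), of p q] ori_hull_zero[OF v(1)] by simp
    moreover have "ori p q p = 0" by (simp add: ori_def)
    ultimately have "x = 0" using assms by simp
    then show ?thesis using x by (simp add: complex_eq_iff)
  qed
  then show "tame {p, q} {p, u}" unfolding tame_def by blast
  show "{p, q} \<noteq> {p, u}" using assms by (auto simp: doubleton_eq_iff ori_def)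
qed

lemma tame_separated:
  assumes "bounded_linear f" "f p < m" "f q < m" "m \<le> f r" "m \<le> (f u :: real)"
  shows "tame {p, q} {r, u}" "{p, q} \<noteq> {r, u::complex}"
proof -
  have "linear f" using assms(1) by (simp add: bounded_linear.linear)
  then have "convex (f -` {..<m})" "convex (f -` {m..})"
    by (simp_all add: convex_linear_vimage)
  then have "convex hull {p, q} \<subseteq> f -` {..<m}" "convex hull {r, u} \<subseteq> f -` {m..}"
    using assms by (simp_all add: hull_minimal)
  then have dis: "convex hull {p, q} \<inter> convex hull {r, u} = {}" by fastforce
  then show "tame {p, q} {r, u}" by (simp add: tame_def)
  show "{p, q} \<noteq> {r, u}" using dis hull_inc[of p "{p, q}" convex] by auto
qed

text \<open>The vertices are implicit: they are the elements of \<open>\<Union>S\<close>.\<close>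

definition straight_drawing :: "complex set set \<Rightarrow> bool" where
  "straight_drawing S \<longleftrightarrow> finite S \<and> (\<forall>s\<in>S. card s = 2) \<and>
     (\<forall>s\<in>S. \<forall>t\<in>S. s \<noteq> t \<longrightarrow> tame s t \<or> cross_segs s t) \<and>
     (\<forall>s\<in>S. \<forall>t\<in>S. \<forall>u\<in>S. cross_segs s t \<longrightarrow> cross_segs s u \<longrightarrow> t = u)"

text \<open>Tame pairs meet only in common ends and a proper crossing avoids all ends. This is the
  requirement of \<open>drawing\<close> that an edge pass through no vertex but its own.\<close>

lemma straight_drawing_vertex:
  assumes "straight_drawing S" "s \<in> S" "t \<in> S" "v \<in> t" "v \<in> convex hull s"
  shows "v \<in> s"
proof (cases "s = t")
  case False
  have vt: "v \<in> convex hull t" using assms(4) by (simp add: hull_inc)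
  have "tame s t \<or> cross_segs s t" using assms False unfolding straight_drawing_def by simp
  then show ?thesis
  proof
    assume "tame s t" then show ?thesis using assms(5) vt unfolding tame_def by blast
  next
    assume "cross_segs s t"
    then obtain z where "convex hull s \<inter> convex hull t = {z}" "z \<notin> t" using cross_segs_point by metis
    then show ?thesis using assms(4,5) vt by (metis IntI singletonD)
  qed
qed (use assms in simp)

section \<open>Drawings with integer coordinates\<close>

type_synonym ipt = "int \<times> int"
type_synonym iseg = "ipt \<times> ipt"

definition pt :: "ipt \<Rightarrow> complex" where
  "pt v = Complex (of_int (fst v)) (of_int (snd v))"

definition seg :: "iseg \<Rightarrow> complex set" where
  "seg s = {pt (fst s), pt (snd s)}"

definition oriz :: "ipt \<Rightarrow> ipt \<Rightarrow> ipt \<Rightarrow> int" where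
  "oriz p q r = (fst q - fst p) * (snd r - snd p) - (snd q - snd p) * (fst r - fst p)"

fun below :: "int \<Rightarrow> int \<Rightarrow> int \<Rightarrow> int \<Rightarrow> bool" where
  "below a b c d \<longleftrightarrow> a < c \<and> a < d \<and> b < c \<and> b < d"

text \<open>Sufficient criteria only: a coordinate separates the segments, or they share an end and
  are not collinear, or one lies strictly beside the line of the other. This is enough for the
  concrete patterns.\<close>

fun tame_test :: "iseg \<Rightarrow> iseg \<Rightarrow> bool" where
  "tame_test (p, q) (r, u) \<longleftrightarrow>
     below (fst p) (fst q) (fst r) (fst u) \<or> below (fst r) (fst u) (fst p) (fst q) \<or>
     below (snd p) (snd q) (snd r) (snd u) \<or> below (snd r) (snd u) (snd p) (snd q) \<or>
     (p = r \<and> oriz p q u \<noteq> 0) \<or> (p = u \<and> oriz p q r \<noteq> 0) \<or>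
     (q = r \<and> oriz p q u \<noteq> 0) \<or> (q = u \<and> oriz p q r \<noteq> 0) \<or>
     oriz p q r * oriz p q u > 0 \<or> oriz r u p * oriz r u q > 0"

fun cross_test :: "iseg \<Rightarrow> iseg \<Rightarrow> bool" where
  "cross_test (p, q) (r, u) \<longleftrightarrow> oriz p q r * oriz p q u < 0 \<and> oriz r u p * oriz r u q < 0"

text \<open>\<open>sorted_wrt\<close> inspects every unordered pair once. It also yields that no
  segment is listed twice, in either direction, since neither test accepts two segments with the
  same ends.\<close>

definition drawing_test :: "iseg list \<Rightarrow> bool" where
  "drawing_test L \<longleftrightarrow> sorted_wrt (\<lambda>s t. tame_test s t \<or> cross_test s t) L \<and>
     list_all (\<lambda>s. fst s \<noteq> snd s) L \<and> list_all (\<lambda>s. length (filter (cross_test s) L) \<le> 1) L"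

definition corners :: "ipt list" where
  "corners = [(-1, -1), (1, -1), (1, 1), (-1, 1)]"

fun outside_test :: "iseg \<Rightarrow> bool" where
  "outside_test (p, q) \<longleftrightarrow> (fst p \<ge> 1 \<and> fst q \<ge> 1) \<or> (fst p \<le> -1 \<and> fst q \<le> -1) \<or>
     (snd p \<ge> 1 \<and> snd q \<ge> 1) \<or> (snd p \<le> -1 \<and> snd q \<le> -1) \<or>
     list_all (\<lambda>k. oriz p q k > 0) corners \<or> list_all (\<lambda>k. oriz p q k < 0) corners"

definition incident :: "ipt \<Rightarrow> iseg \<Rightarrow> bool" where
  "incident v s \<longleftrightarrow> v = fst s \<or> v = snd s"

text \<open>\<open>P\<close> prescribes which vertices have odd degree. The non-empty filter says
  that each listed vertex is an end, so that \<open>V\<close> is exactly the vertex set of the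
  segments.\<close>

definition vertices_test :: "iseg list \<Rightarrow> ipt list \<Rightarrow> (ipt \<Rightarrow> bool) \<Rightarrow> bool" where
  "vertices_test L V P \<longleftrightarrow> distinct V \<and> list_all (\<lambda>s. fst s \<in> set V \<and> snd s \<in> set V) L \<and>
     list_all (\<lambda>v. filter (incident v) L \<noteq> [] \<and> odd (length (filter (incident v) L)) = P v) V"

text \<open>The bent edges run from (-60,-20) through (0,70) to (20,30) and from (60,-20) through (0,70)
  to (-20,30).\<close>

definition bends :: "iseg list" where
  "bends = [((-60, -20), (0, 70)), ((0, 70), (20, 30)), ((60, -20), (0, 70)), ((0, 70), (-20, 30))]"

text \<open>The corners of the unbounded quadrilateral face, whose diagonals are the bent
  edges.\<close>

definition frame :: "ipt list" where
  "frame = [(-60, -20), (60, -20), (20, 30), (-20, 30)]"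

text \<open>The clauses in terms of the finished graph: the base edge and the pieces of the bent
  edges are uncrossed; everything stays out of the open square; a corner of the square or the frame
  has odd degree because the diagonal in the square or in the unbounded face is still missing; the
  bend is no vertex; the vertices off the base edge lie above it, which makes room for merging; the
  diagonals of the frame are not yet present as segments. With 2 bent edges and 2 diagonals of the
  square, \<open>length L + 4\<close> edges have to equal \<open>4 * length V - 8\<close>.\<close>

definition pattern_test :: "iseg list \<Rightarrow> ipt list \<Rightarrow> bool" where
  "pattern_test L V \<longleftrightarrow> drawing_test (L @ bends) \<and>
     list_all (\<lambda>s. list_all (\<lambda>t. \<not> cross_test s t) (L @ bends)) (((-60, -20), (60, -20)) # bends) \<and>
     list_all outside_test (L @ bends) \<and>
     vertices_test L V (\<lambda>v. (v \<in> set corners) \<noteq> (v \<in> set frame)) \<and>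
     list_all (\<lambda>v. v \<in> set V) (corners @ frame) \<and> (0, 70) \<notin> set V \<and>
     list_all (\<lambda>v. snd v > -20 \<or> v = (-60, -20) \<or> v = (60, -20)) V \<and>
     list_all (\<lambda>s. s \<notin> set L) [((-60, -20), (20, 30)), ((20, 30), (-60, -20)), ((60, -20), (-20, 30)), ((-20, 30), (60, -20))] \<and>
     (((-60, -20), (60, -20)) \<in> set L \<or> ((60, -20), (-60, -20)) \<in> set L) \<and>
     length L + 12 = 4 * length V"

section \<open>Soundness of the integer tests\<close>

lemma inj_pt: "inj pt"
  by (auto simp: inj_def pt_def)

lemma pt_simps [simp]: "Re (pt v) = of_int (fst v)" "Im (pt v) = of_int (snd v)" "pt v = pt w \<longleftrightarrow> v = w"
  using inj_pt by (auto simp: pt_def inj_def prod_eq_iff)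

lemma ori_pt: "ori (pt p) (pt q) (pt r) = of_int (oriz p q r)"
  by (simp add: ori_def oriz_def)

lemma tame_below:
  fixes f :: "complex \<Rightarrow> real"
  assumes "bounded_linear f" "below a b c d" "f p = of_int a" "f q = of_int b" "f r = of_int c" "f u = of_int d"
  shows "tame {p, q} {r, u}" "{p, q} \<noteq> {r, u}"
  using tame_separated[OF assms(1), of p "of_int (min c d)" q r u] assms(2-) by auto

lemma tame_test_sound:
  assumes "tame_test s t" shows "tame (seg s) (seg t) \<and> seg s \<noteq> seg t"
proof -
  obtain p q r u where st: "s = (p, q)" "t = (r, u)" by (metis surj_pair)
  have sides: "oriz p q r * oriz p q u > 0 \<Longrightarrow> ori (pt p) (pt q) (pt r) * ori (pt p) (pt q) (pt u) > 0" for p q r u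
    by (simp add: ori_pt flip: of_int_mult)
  have sh: "oriz p q u \<noteq> 0 \<Longrightarrow> ori (pt p) (pt q) (pt u) \<noteq> 0" for p q u by (simp add: ori_pt)
  have sw: "oriz q p r = - oriz p q r" for p q r by (simp add: oriz_def algebra_simps)
  let ?goal = "tame {pt p, pt q} {pt r, pt u} \<and> {pt p, pt q} \<noteq> {pt r, pt u}"
  show ?thesis
    using assms unfolding st tame_test.simps seg_def fst_conv snd_conv
  proof (elim disjE conjE)
    assume "below (fst p) (fst q) (fst r) (fst u)"
    from tame_below[OF bounded_linear_Re this] show ?goal
      by simp
  next
    assume "below (fst r) (fst u) (fst p) (fst q)"
    from tame_below[OF bounded_linear_Re this] show ?goal
      by (metis pt_simps(1) tame_sym)
  next
    assume "below (snd p) (snd q) (snd r) (snd u)"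
    from tame_below[OF bounded_linear_Im this] show ?goal
      by simp
  next
    assume "below (snd r) (snd u) (snd p) (snd q)"
    from tame_below[OF bounded_linear_Im this] show ?goal
      by (metis pt_simps(2) tame_sym)
  next
    assume "p = r" "oriz p q u \<noteq> 0"
    then show ?goal using tame_shared[OF sh] by simp
  next
    assume "p = u" "oriz p q r \<noteq> 0"
    then show ?goal
      using tame_shared[OF sh] by (metis insert_commute)
  next
    assume "q = r" "oriz p q u \<noteq> 0"
    then show ?goal
      using tame_shared[OF sh, of q p u] sw[of p q u] by (metis insert_commute neg_equal_0_iff_equal)
  next
    assume "q = u" "oriz p q r \<noteq> 0"
    then show ?goal
      using tame_shared[OF sh, of q p r] sw[of p q r] by (metis insert_commute neg_equal_0_iff_equal)
  next
    assume "0 < oriz p q r * oriz p q u"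
    then show ?goal using tame_one_side[OF sides] by blast
  next
    assume "0 < oriz r u p * oriz r u q"
    then show ?goal
      using tame_one_side[OF sides] tame_sym by metis
  qed
qed

text \<open>Exchanging the ends of a segment changes the sign of both factors in one product and the
  order of the factors in the other, so the signs of the products depend only on the point
  sets.\<close>

lemma cross_segs_iff:
  "cross_segs {p, q} {r, u} \<longleftrightarrow> ori p q r * ori p q u < 0 \<and> ori r u p * ori r u q < 0"
proof
  have sw: "ori q p r = - ori p q r" for p q r by (simp add: ori_def algebra_simps)
  assume "cross_segs {p, q} {r, u}"
  then obtain p' q' r' u' where "{p, q} = {p', q'}" "{r, u} = {r', u'}"
    and o: "ori p' q' r' * ori p' q' u' < 0" "ori r' u' p' * ori r' u' q' < 0"
    unfolding cross_segs_def by blast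
  then have "(p' = p \<and> q' = q \<or> p' = q \<and> q' = p) \<and> (r' = r \<and> u' = u \<or> r' = u \<and> u' = r)"
    by (auto simp: doubleton_eq_iff)
  then show "ori p q r * ori p q u < 0 \<and> ori r u p * ori r u q < 0"
    using o sw[of p q] sw[of r u] by (elim conjE disjE) (simp_all add: mult.commute)
qed (unfold cross_segs_def, blast)

lemma cross_test_iff: "cross_segs (seg s) (seg t) \<longleftrightarrow> cross_test s t"
proof -
  obtain p q r u where st: "s = (p, q)" "t = (r, u)" by (metis surj_pair)
  show ?thesis
    unfolding st seg_def cross_test.simps fst_conv snd_conv cross_segs_iff ori_pt
    by (simp flip: of_int_mult)
qed

lemma sorted_wrt_distinct_map: "sorted_wrt (\<lambda>s t. f s \<noteq> f t) L \<Longrightarrow> distinct (map f L)"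
  by (induction L) auto

lemma sorted_wrt_pair:
  "sorted_wrt R L \<Longrightarrow> s \<in> set L \<Longrightarrow> t \<in> set L \<Longrightarrow> s \<noteq> t \<Longrightarrow> R s t \<or> R t s"
  by (induction L) auto

lemma set_length_le_1: "length xs \<le> 1 \<Longrightarrow> x \<in> set xs \<Longrightarrow> y \<in> set xs \<Longrightarrow> x = y"
  by (cases xs) auto

lemma drawing_test_sound:
  assumes "drawing_test L"
  shows "straight_drawing (seg ` set L)" "distinct (map seg L)"
proof -
  have ne: "seg s \<noteq> seg t" if "tame_test s t \<or> cross_test s t" for s t
  proof -
    have "\<not> cross_segs (seg s) (seg s)"
      by (cases s) (auto simp: seg_def cross_segs_iff ori_def)
    then show ?thesis using that tame_test_sound cross_test_iff by metis
  qed
  have sorted: "sorted_wrt (\<lambda>s t. tame_test s t \<or> cross_test s t) L"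
    and one: "\<And>s. s \<in> set L \<Longrightarrow> length (filter (cross_test s) L) \<le> 1"
    and nd: "\<And>s. s \<in> set L \<Longrightarrow> fst s \<noteq> snd s"
    using assms by (auto simp: drawing_test_def list_all_iff)
  show "distinct (map seg L)"
    using sorted_wrt_mono_rel[of L _ "\<lambda>s t. seg s \<noteq> seg t", OF _ sorted] ne by (auto intro: sorted_wrt_distinct_map)
  show "straight_drawing (seg ` set L)"
    unfolding straight_drawing_def
  proof (intro conjI ballI impI)
    fix s assume "s \<in> seg ` set L"
    then show "card s = 2" using nd by (auto simp: seg_def card_insert_if)
  next
    fix s t assume "s \<in> seg ` set L" "t \<in> seg ` set L" "s \<noteq> t"
    then obtain s' t' where s': "s = seg s'" "t = seg t'" "s' \<in> set L" "t' \<in> set L" "s' \<noteq> t'" by blast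
    have "tame_test s' t' \<or> cross_test s' t' \<or> tame_test t' s' \<or> cross_test t' s'"
      using sorted_wrt_pair[OF sorted s'(3-5)] by blast
    then show "tame s t \<or> cross_segs s t"
      unfolding s' using tame_test_sound tame_sym cross_test_iff cross_segs_sym by meson
  next
    fix s t u assume "s \<in> seg ` set L" "t \<in> seg ` set L" "u \<in> seg ` set L" "cross_segs s t" "cross_segs s u"
    then obtain s' t' u' where s': "s = seg s'" "t = seg t'" "u = seg u'" "s' \<in> set L" "t' \<in> set L" "u' \<in> set L"
      "cross_test s' t'" "cross_test s' u'" using cross_test_iff by blast
    have "t' \<in> set (filter (cross_test s') L)" "u' \<in> set (filter (cross_test s') L)" using s' by auto
    then show "t = u" using set_length_le_1[OF one[OF s'(4)]] s'(1-3) by metis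
  qed simp
qed

lemma vertices_test_sound:
  assumes "distinct (map seg L)" "vertices_test L V P"
  shows "\<Union>(seg ` set L) = pt ` set V" "card (\<Union>(seg ` set L)) = length V" "card (seg ` set L) = length L"
    "odd (card {s \<in> seg ` set L. v \<in> s}) \<longleftrightarrow> v \<in> pt ` {w \<in> set V. P w}"
proof -
  have V: "distinct V" "\<And>s. s \<in> set L \<Longrightarrow> fst s \<in> set V \<and> snd s \<in> set V"
    "\<And>v. v \<in> set V \<Longrightarrow> filter (incident v) L \<noteq> [] \<and> odd (length (filter (incident v) L)) = P v"
    using assms(2) by (auto simp: vertices_test_def list_all_iff)
  have inc: "pt w \<in> seg s \<longleftrightarrow> incident w s" for w s by (auto simp: seg_def incident_def)
  have sub: "\<Union>(seg ` set L) \<subseteq> pt ` set V" using V(2) by (auto simp: seg_def)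
  have "pt w \<in> \<Union>(seg ` set L)" if wV: "w \<in> set V" for w
  proof -
    obtain s where "s \<in> set (filter (incident w) L)" using V(3)[OF wV] by (metis last_in_set)
    then show ?thesis using inc by auto
  qed
  then show eq: "\<Union>(seg ` set L) = pt ` set V" using sub by blast
  show "card (\<Union>(seg ` set L)) = length V"
    unfolding eq using card_image[OF inj_on_subset[OF inj_pt subset_UNIV], of "set V"] distinct_card[OF V(1)] by simp
  show "card (seg ` set L) = length L"
    using distinct_card[OF assms(1)] by simp
  show "odd (card {s \<in> seg ` set L. v \<in> s}) \<longleftrightarrow> v \<in> pt ` {w \<in> set V. P w}"
  proof (cases "v \<in> pt ` set V")
    case True
    then obtain w where w: "w \<in> set V" "v = pt w" by blast
    have "{s \<in> seg ` set L. v \<in> s} = seg ` {s \<in> set L. pt w \<in> seg s}" unfolding w(2) by blast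
    then have "{s \<in> seg ` set L. v \<in> s} = set (map seg (filter (incident w) L))"
      by (simp only: inc set_map set_filter)
    moreover have "distinct (map seg (filter (incident w) L))"
      using assms(1) by (simp add: distinct_map inj_on_def)
    ultimately have "card {s \<in> seg ` set L. v \<in> s} = length (filter (incident w) L)"
      by (simp only: distinct_card length_map)
    then show ?thesis using V(3)[OF w(1)] w by auto
  next
    case False
    then have "{s \<in> seg ` set L. v \<in> s} = {}" using sub by blast
    then show ?thesis using False by (auto simp del: Collect_empty_eq)
  qed
qed

subsection \<open>Filling a square\<close>

definition box_corners :: "complex set" where
  "box_corners = pt ` set corners"

text \<open>The sides of the square belong to the surrounding drawing; a filling may touch them only
  in the corners, and only with ends of its segments.\<close>

definition square_filling :: "complex set set \<Rightarrow> bool" where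
  "square_filling S \<longleftrightarrow> straight_drawing S \<and>
     (\<forall>s\<in>S. \<forall>v\<in>convex hull s. \<bar>Re v\<bar> \<le> 1 \<and> \<bar>Im v\<bar> \<le> 1 \<and>
        (\<bar>Re v\<bar> = 1 \<or> \<bar>Im v\<bar> = 1 \<longrightarrow> v \<in> s \<and> v \<in> box_corners))"

definition off_square :: "complex set \<Rightarrow> bool" where
  "off_square s \<longleftrightarrow> (\<forall>v\<in>convex hull s. \<bar>Re v\<bar> \<ge> 1 \<or> \<bar>Im v\<bar> \<ge> 1)"

text \<open>A common point of an outer and an inner segment lies on the boundary of the square,
  hence is a corner and an end of the inner segment. Corners are vertices of the outer drawing too,
  so by \<open>straight_drawing_vertex\<close> it is also an end of the outer segment.\<close>

lemma square_filling_glue: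
  assumes A: "straight_drawing A" "\<forall>s\<in>A. off_square s" "box_corners \<subseteq> \<Union>A"
    and S: "square_filling S"
  shows "straight_drawing (A \<union> S)" "A \<inter> S = {}" "\<And>s t. s \<in> A \<Longrightarrow> t \<in> S \<Longrightarrow> tame s t"
proof -
  have S': "straight_drawing S" using S by (simp add: square_filling_def)
  show tm: "tame s t" if s: "s \<in> A" and t: "t \<in> S" for s t
    unfolding tame_def
  proof
    fix v assume v: "v \<in> convex hull s \<inter> convex hull t"
    then have "\<bar>Re v\<bar> = 1 \<or> \<bar>Im v\<bar> = 1"
      using S bspec[OF A(2) s] t unfolding square_filling_def off_square_def by (metis IntD1 IntD2 order_antisym)
    then have vt: "v \<in> t" "v \<in> box_corners" using S t v unfolding square_filling_def by blast+
    then obtain s' where "s' \<in> A" "v \<in> s'" using A(3) by blast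
    then have "v \<in> s" using straight_drawing_vertex[OF A(1) s] v by blast
    then show "v \<in> s \<inter> t" using vt by blast
  qed
  show dis: "A \<inter> S = {}"
  proof -
    have False if s: "s \<in> A" "s \<in> S" for s
    proof -
      have "card s = 2" using s(1) A(1) by (simp add: straight_drawing_def)
      \<comment> \<open>A segment in both drawings would be tame to itself, which its midpoint
        refutes.\<close>
      then obtain p q where pq: "s = {p, q}" "p \<noteq> q" by (meson card_2_iff)
      have "convex hull s \<subseteq> s" using tm[OF s] by (simp add: tame_def)
      moreover have "midpoint p q \<in> convex hull s"
        unfolding pq(1) segment_convex_hull[symmetric] by simp
      ultimately have "midpoint p q = p \<or> midpoint p q = q" unfolding pq(1) by blast
      then show False using pq(2) by (auto simp: midpoint_eq_endpoint)
    qed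
    then show ?thesis by blast
  qed
  have tm': "tame s t" if "s \<in> S" "t \<in> A" for s t using tm[OF that(2,1)] by (rule tame_sym)
  show "straight_drawing (A \<union> S)"
    unfolding straight_drawing_def
  proof (intro conjI ballI impI)
    show "finite (A \<union> S)" using A(1) S' by (simp add: straight_drawing_def)
  next
    fix s assume "s \<in> A \<union> S"
    then show "card s = 2" using A(1) S' by (auto simp: straight_drawing_def)
  next
    fix s t assume "s \<in> A \<union> S" "t \<in> A \<union> S" "s \<noteq> t"
    then show "tame s t \<or> cross_segs s t"
      using A(1) S' tm tm' unfolding straight_drawing_def by (metis Un_iff)
  next
    fix s t u assume stu: "s \<in> A \<union> S" "t \<in> A \<union> S" "u \<in> A \<union> S" "cross_segs s t" "cross_segs s u"
    have "\<not> tame s t" "\<not> tame s u" using stu(4,5) cross_segs_not_tame by blast+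
    then consider "s \<in> A" "t \<in> A" "u \<in> A" | "s \<in> S" "t \<in> S" "u \<in> S"
      using stu(1-3) tm tm' by blast
    then show "t = u"
      using A(1) S' stu(4,5) unfolding straight_drawing_def by cases metis+
  qed
qed

lemma outside_test_sound:
  assumes "outside_test s" shows "off_square (seg s)"
proof -
  obtain p q where s: "s = (p, q)" by (metis surj_pair)
  show ?thesis
    unfolding off_square_def seg_def s fst_conv snd_conv
  proof
    fix v assume v: "v \<in> convex hull {pt p, pt q}"
    have half: "f v \<ge> 1" if "bounded_linear f" "f (pt p) \<ge> 1" "f (pt q) \<ge> 1" for f :: "complex \<Rightarrow> real"
    proof -
      have "convex (f -` {1..})" using that(1) by (simp add: convex_linear_vimage bounded_linear.linear)
      then have "convex hull {pt p, pt q} \<subseteq> f -` {1..}" using that by (intro hull_minimal) auto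
      then show ?thesis using v by auto
    qed
    \<comment> \<open>Both signs are treated at once through \<sigma>. The affine function
      \<open>a * Im w - b * Re w - c\<close>, multiplied by \<sigma>, is positive at all four
      corners; this pushes \<open>\<sigma> * c\<close> below the least value that the linear part
      can take within the square, so there is no zero inside.\<close>
    have line: False if "\<forall>k\<in>set corners. \<sigma> * of_int (oriz p q k) > 0" "\<bar>Re v\<bar> < 1" "\<bar>Im v\<bar> < 1" for \<sigma> :: real
    proof -
      define a b c where "a = Re (pt q) - Re (pt p)" and "b = Im (pt q) - Im (pt p)"
        and "c = a * Im (pt p) - b * Re (pt p)"
      have o: "ori (pt p) (pt q) w = a * Im w - b * Re w - c" for w
        by (simp add: ori_def a_def b_def c_def algebra_simps)
      have k: "0 < \<sigma> * ori (pt p) (pt q) (pt k)" if "k \<in> set corners" for k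
        using \<open>\<forall>k\<in>set corners. _\<close> that by (simp add: ori_pt)
      have "0 < \<sigma> * (- a + b - c)" "0 < \<sigma> * (- a - b - c)" "0 < \<sigma> * (a - b - c)" "0 < \<sigma> * (a + b - c)"
        using k[of "(-1,-1)"] k[of "(1,-1)"] k[of "(1,1)"] k[of "(-1,1)"] unfolding o by (simp_all add: corners_def)
      then have "\<sigma> * c < - \<bar>\<sigma> * a\<bar> - \<bar>\<sigma> * b\<bar>"
        by (simp add: algebra_simps abs_if)
      moreover have "\<sigma> * c = \<sigma> * a * Im v - \<sigma> * b * Re v"
        using ori_hull_zero[OF v] o[of v] by (simp add: algebra_simps)
      moreover have "\<bar>\<sigma> * a * Im v\<bar> \<le> \<bar>\<sigma> * a\<bar>" "\<bar>\<sigma> * b * Re v\<bar> \<le> \<bar>\<sigma> * b\<bar>"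
        using that(2,3) mult_left_mono[of "\<bar>Im v\<bar>" 1 "\<bar>\<sigma> * a\<bar>"] mult_left_mono[of "\<bar>Re v\<bar>" 1 "\<bar>\<sigma> * b\<bar>"]
        by (simp_all add: abs_mult)
      ultimately show False by linarith
    qed
    show "\<bar>Re v\<bar> \<ge> 1 \<or> \<bar>Im v\<bar> \<ge> 1"
      using assms unfolding s outside_test.simps list_all_iff
    proof (elim disjE conjE)
      assume "1 \<le> fst p" "1 \<le> fst q"
      then show ?thesis using half[OF bounded_linear_Re] by force
    next
      assume "fst p \<le> -1" "fst q \<le> -1"
      then show ?thesis using half[OF bounded_linear_minus[OF bounded_linear_Re]] by force
    next
      assume "1 \<le> snd p" "1 \<le> snd q"
      then show ?thesis using half[OF bounded_linear_Im] by force
    next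
      assume "snd p \<le> -1" "snd q \<le> -1"
      then show ?thesis using half[OF bounded_linear_minus[OF bounded_linear_Im]] by force
    next
      assume "\<forall>k\<in>set corners. 0 < oriz p q k"
      then show ?thesis using line[of 1] by force
    next
      assume "\<forall>k\<in>set corners. oriz p q k < 0"
      then show ?thesis using line[of "-1"] by force
    qed
  qed
qed

section \<open>Nested squares\<close>

abbreviation halve :: "complex \<Rightarrow> complex" where
  "halve \<equiv> \<lambda>v. (1/2) *\<^sub>R v"

lemma hull_halve: "convex hull (halve ` s) = halve ` (convex hull s)"
  by (rule convex_hull_linear_image[symmetric]) (simp add: linear_iff algebra_simps)

lemma inj_halve: "inj halve" by (simp add: inj_def)

lemma tame_halve: "tame s t \<Longrightarrow> tame (halve ` s) (halve ` t)"
  unfolding tame_def hull_halve using inj_halve by (simp add: image_Int[symmetric] image_mono)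

lemma cross_segs_halve: "cross_segs (halve ` s) (halve ` t) \<longleftrightarrow> cross_segs s t"
proof -
  have o: "ori (halve p) (halve q) (halve r) = ori p q r / 4" for p q r
    by (simp add: ori_def field_simps)
  have *: "cross_segs {halve p, halve q} {halve r, halve u} \<longleftrightarrow> cross_segs {p, q} {r, u}" for p q r u
    unfolding cross_segs_iff o by (simp add: divide_less_0_iff mult_less_0_iff zero_less_divide_iff)
  have 2: "\<exists>p q. s = {p, q}" if h: "halve ` s = {p, q}" for s p q
  proof -
    have "s = (*\<^sub>R) 2 ` (halve ` s)" by (simp add: image_image)
    then show ?thesis unfolding h by auto
  qed
  show ?thesis
  proof
    assume c: "cross_segs s t"
    then obtain p q r u where "s = {p, q}" "t = {r, u}" unfolding cross_segs_def by blast
    then show "cross_segs (halve ` s) (halve ` t)" using c * by simp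
  next
    assume c: "cross_segs (halve ` s) (halve ` t)"
    then obtain p q r u where h: "halve ` s = {p, q}" "halve ` t = {r, u}" unfolding cross_segs_def by blast
    obtain p' q' where s: "s = {p', q'}" using 2[OF h(1)] by blast
    obtain r' u' where t: "t = {r', u'}" using 2[OF h(2)] by blast
    show "cross_segs s t" using c *[of p' q' r' u'] by (simp add: s t)
  qed
qed

lemma straight_drawing_halve:
  assumes "straight_drawing S" shows "straight_drawing ((`) halve ` S)"
  unfolding straight_drawing_def
proof (intro conjI ballI impI)
  show "finite ((`) halve ` S)" using assms by (simp add: straight_drawing_def)
next
  fix s assume "s \<in> (`) halve ` S"
  then show "card s = 2" using assms card_image[OF inj_on_subset[OF inj_halve subset_UNIV]]
    by (auto simp: straight_drawing_def)
next
  fix s t assume "s \<in> (`) halve ` S" "t \<in> (`) halve ` S" "s \<noteq> t"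
  then obtain s' t' where s': "s = halve ` s'" "t = halve ` t'" "s' \<in> S" "t' \<in> S" "s' \<noteq> t'" by blast
  then have "tame s' t' \<or> cross_segs s' t'" using assms by (simp add: straight_drawing_def)
  then show "tame s t \<or> cross_segs s t" unfolding s'(1,2) using tame_halve cross_segs_halve by blast
next
  fix s t u assume "s \<in> (`) halve ` S" "t \<in> (`) halve ` S" "u \<in> (`) halve ` S" "cross_segs s t" "cross_segs s u"
  then obtain s' t' u' where s': "s = halve ` s'" "t = halve ` t'" "u = halve ` u'" "s' \<in> S" "t' \<in> S" "u' \<in> S"
    "cross_segs s' t'" "cross_segs s' u'" using cross_segs_halve by blast
  have "\<forall>s\<in>S. \<forall>t\<in>S. \<forall>u\<in>S. cross_segs s t \<longrightarrow> cross_segs s u \<longrightarrow> t = u"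
    using assms by (simp add: straight_drawing_def)
  then have "t' = u'" using s'(4-8) by blast
  then show "t = u" using s' by simp
qed

text \<open>The ring between two concentric squares: four spokes, the four inner sides, and two
  diagonals in each of the four trapezoids. The outer sides are left to the surrounding drawing. In
  each entry the second end is an inner corner. The ring brings 16 edges for 4 new vertices, which
  preserves the count 4n - 8.\<close>

definition annulus :: "iseg list" where
  "annulus = [((-2, -2), (-1, -1)), ((2, -2), (1, -1)), ((2, 2), (1, 1)), ((-2, 2), (-1, 1)),
    ((-1, -1), (1, -1)), ((1, -1), (1, 1)), ((1, 1), (-1, 1)), ((-1, 1), (-1, -1)),
    ((2, -2), (-1, -1)), ((-2, -2), (1, -1)), ((2, 2), (1, -1)), ((2, -2), (1, 1)),
    ((-2, 2), (1, 1)), ((2, 2), (-1, 1)), ((-2, -2), (-1, 1)), ((-2, 2), (-1, -1))]"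

definition annulus_vertices :: "ipt list" where
  "annulus_vertices = [(-2, -2), (2, -2), (2, 2), (-2, 2), (-1, -1), (1, -1), (1, 1), (-1, 1)]"

definition square_diagonals :: "iseg list" where
  "square_diagonals = [((-1, -1), (1, 1)), ((1, -1), (-1, 1))]"

text \<open>All degrees are odd: 3 at the outer corners (a spoke and two diagonals), 5 at the inner
  ones (two sides in addition).\<close>

lemma annulus_tests:
  "drawing_test annulus" "list_all outside_test annulus" "vertices_test annulus annulus_vertices (\<lambda>v. True)"
  by code_simp+

lemma square_diagonals_tests:
  "drawing_test square_diagonals" "vertices_test square_diagonals corners (\<lambda>v. True)"
  by code_simp+

text \<open>A ring is put around the previous nest and the result is shrunk, so that the filled
  square always has the same corners (+-1,+-1).\<close>

primrec nest :: "nat \<Rightarrow> complex set set" where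
  "nest 0 = seg ` set square_diagonals"
| "nest (Suc j) = (`) halve ` (seg ` set annulus \<union> nest j)"

lemma odd_card_Un:
  assumes "finite A" "finite B" "A \<inter> B = {}"
  shows "odd (card {s \<in> A \<union> B. v \<in> s}) \<longleftrightarrow> (odd (card {s \<in> A. v \<in> s}) \<noteq> odd (card {s \<in> B. v \<in> s}))"
proof -
  have "{s \<in> A \<union> B. v \<in> s} = {s \<in> A. v \<in> s} \<union> {s \<in> B. v \<in> s}" by blast
  moreover have "{s \<in> A. v \<in> s} \<inter> {s \<in> B. v \<in> s} = {}" using assms(3) by blast
  ultimately have "card {s \<in> A \<union> B. v \<in> s} = card {s \<in> A. v \<in> s} + card {s \<in> B. v \<in> s}"
    using assms(1,2) by (simp add: card_Un_disjoint)
  then show ?thesis by simp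
qed

lemma box_corners_eq: "v \<in> box_corners \<longleftrightarrow> \<bar>Re v\<bar> = 1 \<and> \<bar>Im v\<bar> = 1"
proof
  assume "v \<in> box_corners"
  then show "\<bar>Re v\<bar> = 1 \<and> \<bar>Im v\<bar> = 1" by (auto simp: box_corners_def corners_def)
next
  assume "\<bar>Re v\<bar> = 1 \<and> \<bar>Im v\<bar> = 1"
  then have "v = pt (-1, -1) \<or> v = pt (1, -1) \<or> v = pt (1, 1) \<or> v = pt (-1, 1)"
    by (auto simp: complex_eq_iff abs_if split: if_splits)
  then show "v \<in> box_corners" by (auto simp: box_corners_def corners_def)
qed

text \<open>Since the second end has coordinates of absolute value at most 1, the point at parameter
  \<open>t\<close> has coordinates of absolute value at most \<open>2 - t\<close>; the outer
  boundary is reached only for \<open>t = 0\<close>, at the first end.\<close>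

lemma annulus_hull:
  assumes s: "s \<in> seg ` set annulus" and v: "v \<in> convex hull s"
  shows "\<bar>Re v\<bar> \<le> 2" "\<bar>Im v\<bar> \<le> 2"
    "\<bar>Re v\<bar> = 2 \<or> \<bar>Im v\<bar> = 2 \<Longrightarrow> v \<in> s \<and> \<bar>Re v\<bar> = 2 \<and> \<bar>Im v\<bar> = 2"
proof -
  have "\<exists>p q. s = {p, q} \<and> \<bar>Re q\<bar> \<le> 1 \<and> \<bar>Im q\<bar> \<le> 1 \<and>
      (\<bar>Re p\<bar> \<le> 1 \<and> \<bar>Im p\<bar> \<le> 1 \<or> \<bar>Re p\<bar> = 2 \<and> \<bar>Im p\<bar> = 2)"
  proof -
    have "list_all (\<lambda>s. \<bar>fst (snd s)\<bar> \<le> 1 \<and> \<bar>snd (snd s)\<bar> \<le> 1 \<and>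
      (\<bar>fst (fst s)\<bar> \<le> 1 \<and> \<bar>snd (fst s)\<bar> \<le> 1 \<or> \<bar>fst (fst s)\<bar> = 2 \<and> \<bar>snd (fst s)\<bar> = 2)) annulus"
      by code_simp
    moreover obtain w where w: "w \<in> set annulus" "s = seg w" using s by blast
    ultimately have "\<bar>fst (snd w)\<bar> \<le> 1 \<and> \<bar>snd (snd w)\<bar> \<le> 1 \<and>
      (\<bar>fst (fst w)\<bar> \<le> 1 \<and> \<bar>snd (fst w)\<bar> \<le> 1 \<or> \<bar>fst (fst w)\<bar> = 2 \<and> \<bar>snd (fst w)\<bar> = 2)"
      by (simp add: list_all_iff)
    then have "{pt (fst w), pt (snd w)} = {pt (fst w), pt (snd w)} \<and> \<bar>Re (pt (snd w))\<bar> \<le> 1 \<and> \<bar>Im (pt (snd w))\<bar> \<le> 1 \<and>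
      (\<bar>Re (pt (fst w))\<bar> \<le> 1 \<and> \<bar>Im (pt (fst w))\<bar> \<le> 1 \<or> \<bar>Re (pt (fst w))\<bar> = 2 \<and> \<bar>Im (pt (fst w))\<bar> = 2)"
      by (simp flip: of_int_abs)
    then show ?thesis unfolding w(2) seg_def by blast
  qed
  then obtain p q where pq: "s = {p, q}" "\<bar>Re q\<bar> \<le> 1" "\<bar>Im q\<bar> \<le> 1"
    "\<bar>Re p\<bar> \<le> 1 \<and> \<bar>Im p\<bar> \<le> 1 \<or> \<bar>Re p\<bar> = 2 \<and> \<bar>Im p\<bar> = 2" by blast
  obtain t where t: "0 \<le> t" "t \<le> 1" "Re v = Re p + t * (Re q - Re p)" "Im v = Im p + t * (Im q - Im p)"
    using v unfolding pq(1) hull_pair_iff by blast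
  have bound: "\<bar>x + t * (y - x)\<bar> \<le> 2 - t" if "\<bar>y\<bar> \<le> 1" "\<bar>x\<bar> \<le> 2" for x y :: real
  proof -
    have "x + t * (y - x) = (1 - t) * x + t * y" by (simp add: algebra_simps)
    moreover have "\<bar>(1 - t) * x\<bar> \<le> (1 - t) * 2" "\<bar>t * y\<bar> \<le> t * 1"
      using that t mult_left_mono[of "\<bar>x\<bar>" 2 "1 - t"] mult_left_mono[of "\<bar>y\<bar>" 1 t]
      by (simp_all add: abs_mult)
    moreover have "\<bar>z\<bar> \<le> a + b" if "z = u + w" "\<bar>u\<bar> \<le> a" "\<bar>w\<bar> \<le> b" for z u w a b :: real
      using that by linarith
    ultimately have "\<bar>x + t * (y - x)\<bar> \<le> (1 - t) * 2 + t * 1" by blast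
    then show ?thesis by simp
  qed
  have p2: "\<bar>Re p\<bar> \<le> 2" "\<bar>Im p\<bar> \<le> 2" using pq(4) by auto
  have b: "\<bar>Re v\<bar> \<le> 2 - t" "\<bar>Im v\<bar> \<le> 2 - t"
    using bound[OF pq(2) p2(1)] bound[OF pq(3) p2(2)] t(3,4) by simp_all
  then show "\<bar>Re v\<bar> \<le> 2" "\<bar>Im v\<bar> \<le> 2" using t by linarith+
  assume "\<bar>Re v\<bar> = 2 \<or> \<bar>Im v\<bar> = 2"
  then have "t = 0" using b t(1) by linarith
  then have vp: "v = p" using t by (simp add: complex_eq_iff)
  then show "v \<in> s \<and> \<bar>Re v\<bar> = 2 \<and> \<bar>Im v\<bar> = 2"
    using \<open>\<bar>Re v\<bar> = 2 \<or> \<bar>Im v\<bar> = 2\<close> pq(1,4) by auto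
qed

lemma square_filling_diagonals: "square_filling (nest 0)"
  unfolding square_filling_def
proof (intro conjI ballI impI)
  show "straight_drawing (nest 0)"
    using drawing_test_sound[OF square_diagonals_tests(1)] by simp
next
  fix s v assume s: "s \<in> nest 0" and v: "v \<in> convex hull s"
  have "s = {pt (-1, -1), pt (1, 1)} \<or> s = {pt (1, -1), pt (-1, 1)}"
    using s by (auto simp: square_diagonals_def seg_def)
  \<comment> \<open>\<sigma> is the slope of the diagonal, which treats both diagonals
    together.\<close>
  then obtain \<sigma> :: real where s': "\<bar>\<sigma>\<bar> = 1" "s = {Complex (-1) (- \<sigma>), Complex 1 \<sigma>}"
  proof (elim disjE)
    assume "s = {pt (-1, -1), pt (1, 1)}" then show thesis using that[of 1] by (simp add: pt_def)
  next
    assume "s = {pt (1, -1), pt (-1, 1)}" then show thesis using that[of "-1"] by (simp add: pt_def insert_commute)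
  qed
  obtain t where t: "0 \<le> t" "t \<le> 1" "Re v = -1 + t * 2" "Im v = - \<sigma> + t * (2 * \<sigma>)"
    using v unfolding s'(2) hull_pair_iff by auto
  have im: "Im v = \<sigma> * Re v" unfolding t(3,4) by (simp add: algebra_simps)
  then have abs: "\<bar>Im v\<bar> = \<bar>Re v\<bar>" using s'(1) by (simp add: abs_mult)
  show "\<bar>Re v\<bar> \<le> 1" "\<bar>Im v\<bar> \<le> 1" using t abs by auto
  assume "\<bar>Re v\<bar> = 1 \<or> \<bar>Im v\<bar> = 1"
  then have R: "\<bar>Re v\<bar> = 1" using abs by auto
  then show "v \<in> box_corners" using abs by (simp add: box_corners_eq)
  have "Re v = 1 \<or> Re v = -1" using R by auto
  then show "v \<in> s" unfolding s'(2) using im by (auto simp: complex_eq_iff)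
qed

text \<open>The parity clause is chosen to fit the surroundings: the corners are odd in the nest and
  odd in the pattern, hence even after gluing.\<close>

proposition nest_properties:
  "square_filling (nest j)" "card (nest j) = 2 + 16 * j" "finite (\<Union>(nest j))"
  "card (\<Union>(nest j)) = 4 + 4 * j" "odd (card {s \<in> nest j. v \<in> s}) \<longleftrightarrow> v \<in> box_corners"
  "box_corners \<subseteq> \<Union>(nest j)"
proof -
  have "square_filling (nest j) \<and> card (nest j) = 2 + 16 * j \<and> finite (\<Union>(nest j)) \<and>
    card (\<Union>(nest j)) = 4 + 4 * j \<and> (\<forall>v. odd (card {s \<in> nest j. v \<in> s}) \<longleftrightarrow> v \<in> box_corners) \<and>
    box_corners \<subseteq> \<Union>(nest j)"
  proof (induction j)
    case 0
    note d = drawing_test_sound[OF square_diagonals_tests(1)]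
    note vs = vertices_test_sound[OF d(2) square_diagonals_tests(2)]
    have "length square_diagonals = 2" "length corners = 4" by (simp_all add: square_diagonals_def corners_def)
    then show ?case using vs square_filling_diagonals by (simp add: box_corners_def)
  next
    case (Suc j)
    let ?A = "seg ` set annulus" and ?S = "nest j"
    note d = drawing_test_sound[OF annulus_tests(1)]
    note vs = vertices_test_sound[OF d(2) annulus_tests(3)]
    have off: "\<forall>s\<in>?A. off_square s"
      using annulus_tests(2) outside_test_sound by (auto simp: list_all_iff)
    have sq: "square_filling ?S" and S: "straight_drawing ?S" using Suc by (auto simp: square_filling_def)
    have corn: "set corners \<subseteq> set annulus_vertices" by (simp add: corners_def annulus_vertices_def)
    then have bc: "box_corners \<subseteq> \<Union>?A" unfolding vs(1) box_corners_def by blast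
    note glue = square_filling_glue[OF d(1) off bc sq]
    have len: "length annulus = 16" "length annulus_vertices = 8" by (simp_all add: annulus_def annulus_vertices_def)
    have fin: "finite ?A" "finite ?S" using S by (auto simp: straight_drawing_def)
    define W where "W = pt ` {(-2, -2), (2, -2), (2, 2), (-2, 2)}"
    have AV: "pt ` set annulus_vertices = W \<union> box_corners"
      by (auto simp: W_def box_corners_def annulus_vertices_def corners_def)
    have inbox: "\<bar>Re v\<bar> \<le> 1" "\<bar>Im v\<bar> \<le> 1" if v: "v \<in> \<Union>?S" for v
    proof -
      obtain s where "s \<in> ?S" "v \<in> s" using v by blast
      then show "\<bar>Re v\<bar> \<le> 1" "\<bar>Im v\<bar> \<le> 1" using sq hull_inc[of v s convex] by (auto simp: square_filling_def)
    qed
    have W2: "v \<in> W \<longleftrightarrow> \<bar>Re v\<bar> = 2 \<and> \<bar>Im v\<bar> = 2" for v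
    proof
      assume "v \<in> W" then show "\<bar>Re v\<bar> = 2 \<and> \<bar>Im v\<bar> = 2" by (auto simp: W_def)
    next
      assume "\<bar>Re v\<bar> = 2 \<and> \<bar>Im v\<bar> = 2"
      then have "v = pt (-2, -2) \<or> v = pt (2, -2) \<or> v = pt (2, 2) \<or> v = pt (-2, 2)"
        by (auto simp: complex_eq_iff abs_if split: if_splits)
      then show "v \<in> W" by (auto simp: W_def)
    qed
    have Wdis: "W \<inter> \<Union>?S = {}" "W \<inter> box_corners = {}"
      using inbox W2 by (force simp: box_corners_eq)+
    have U: "\<Union>(?A \<union> ?S) = W \<union> \<Union>?S"
      using Suc vs(1) AV by auto
    have cW: "card W = 4"
      unfolding W_def using card_image[OF inj_on_subset[OF inj_pt subset_UNIV]] by simp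
    have finS: "finite (\<Union>?S)" using Suc by blast
    have cU: "card (\<Union>(?A \<union> ?S)) = 8 + 4 * j"
      unfolding U using card_Un_disjoint[OF _ finS Wdis(1)] cW Suc by (simp add: W_def)
    have cE: "card (?A \<union> ?S) = 18 + 16 * j"
      using card_Un_disjoint[OF fin glue(2)] vs(3) len Suc by simp
    \<comment> \<open>The inner corners are odd in the ring and odd in the nest, so they cancel;
      what remains odd are the outer corners \<open>W\<close>, which halving carries to
      \<open>box_corners\<close>.\<close>
    have par: "odd (card {s \<in> ?A \<union> ?S. v \<in> s}) \<longleftrightarrow> v \<in> W" for v
    proof -
      have "odd (card {s \<in> ?A. v \<in> s}) \<longleftrightarrow> v \<in> W \<union> box_corners" using vs(4)[of v] AV by simp
      moreover have "odd (card {s \<in> ?S. v \<in> s}) \<longleftrightarrow> v \<in> box_corners" using Suc by blast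
      ultimately show ?thesis
        using odd_card_Un[OF fin glue(2), of v] Wdis(2) by blast
    qed
    have N: "nest (Suc j) = (`) halve ` (?A \<union> ?S)" by simp
    have inj2: "inj ((`) halve)" using inj_image_eq_iff[OF inj_halve] by (auto intro: injI)
    have UN: "\<Union>(nest (Suc j)) = halve ` \<Union>(?A \<union> ?S)" unfolding N by blast
    have "card (nest (Suc j)) = 2 + 16 * Suc j"
      unfolding N using card_image[OF inj_on_subset[OF inj2 subset_UNIV]] cE by simp
    moreover have "card (\<Union>(nest (Suc j))) = 4 + 4 * Suc j"
      unfolding UN using card_image[OF inj_on_subset[OF inj_halve subset_UNIV]] cU by simp
    moreover have "finite (\<Union>(nest (Suc j)))" unfolding UN U using finS by (simp add: W_def)
    moreover have hW: "halve ` W = box_corners"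
    proof (intro equalityI subsetI)
      fix v assume "v \<in> halve ` W" then show "v \<in> box_corners" using W2 by (auto simp: box_corners_eq)
    next
      fix v assume "v \<in> box_corners"
      then have "2 *\<^sub>R v \<in> W" using W2 by (auto simp: box_corners_eq abs_mult)
      then show "v \<in> halve ` W" by (intro image_eqI[of _ _ "2 *\<^sub>R v"]) auto
    qed
    moreover have "odd (card {s \<in> nest (Suc j). v \<in> s}) \<longleftrightarrow> v \<in> box_corners" for v
    proof -
      have hv: "v \<in> halve ` s \<longleftrightarrow> 2 *\<^sub>R v \<in> s" for s
      proof
        assume "2 *\<^sub>R v \<in> s" then show "v \<in> halve ` s" by (intro image_eqI[of _ _ "2 *\<^sub>R v"]) auto
      qed auto
      have "{s \<in> nest (Suc j). v \<in> s} = (`) halve ` {s \<in> ?A \<union> ?S. 2 *\<^sub>R v \<in> s}"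
        unfolding N using hv by blast
      then have "card {s \<in> nest (Suc j). v \<in> s} = card {s \<in> ?A \<union> ?S. 2 *\<^sub>R v \<in> s}"
        using card_image[OF inj_on_subset[OF inj2 subset_UNIV]] by simp
      then have "odd (card {s \<in> nest (Suc j). v \<in> s}) \<longleftrightarrow> 2 *\<^sub>R v \<in> W" using par by simp
      also have "\<dots> \<longleftrightarrow> v \<in> halve ` W" using hv by blast
      finally show ?thesis unfolding hW .
    qed
    moreover have "box_corners \<subseteq> \<Union>(nest (Suc j))" unfolding UN U hW[symmetric] by blast
    moreover have "square_filling (nest (Suc j))"
      unfolding square_filling_def
    proof (intro conjI ballI impI)
      show "straight_drawing (nest (Suc j))" unfolding N by (rule straight_drawing_halve[OF glue(1)])
    next
      fix s v assume s: "s \<in> nest (Suc j)" and v: "v \<in> convex hull s"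
      obtain s' where s': "s' \<in> ?A \<union> ?S" "s = halve ` s'" using s unfolding N by blast
      obtain w where w: "w \<in> convex hull s'" "v = halve w" using v unfolding s'(2) hull_halve by blast
      have *: "\<bar>Re w\<bar> \<le> 2 \<and> \<bar>Im w\<bar> \<le> 2 \<and> (\<bar>Re w\<bar> = 2 \<or> \<bar>Im w\<bar> = 2 \<longrightarrow> w \<in> s' \<and> w \<in> W)"
        using s'(1)
      proof
        assume "s' \<in> ?A"
        then show ?thesis using annulus_hull[OF _ w(1)] W2[of w] by blast
      next
        assume "s' \<in> ?S"
        then have "\<bar>Re w\<bar> \<le> 1 \<and> \<bar>Im w\<bar> \<le> 1" using sq w(1) by (simp add: square_filling_def)
        then show ?thesis by auto
      qed
      then show "\<bar>Re v\<bar> \<le> 1" "\<bar>Im v\<bar> \<le> 1" using w(2) by auto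
      assume "\<bar>Re v\<bar> = 1 \<or> \<bar>Im v\<bar> = 1"
      then have "\<bar>Re w\<bar> = 2 \<or> \<bar>Im w\<bar> = 2" using w(2) by auto
      then have "w \<in> s'" "w \<in> W" using * by auto
      then show "v \<in> s" "v \<in> box_corners" using s'(2) w(2) hW by blast+
    qed
    ultimately show ?case by blast
  qed
  then show "square_filling (nest j)" "card (nest j) = 2 + 16 * j" "finite (\<Union>(nest j))"
    "card (\<Union>(nest j)) = 4 + 4 * j" "odd (card {s \<in> nest j. v \<in> s}) \<longleftrightarrow> v \<in> box_corners"
    "box_corners \<subseteq> \<Union>(nest j)"
    by blast+
qed

section \<open>Recognising and transporting 1-plane drawings\<close>

text \<open>\<open>X\<close> is a certificate for crossing that can be read off combinatorially. A
  pair without it meets in common ends only, and \<open>crosses_at_not_endpoint\<close> shows that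
  this is no crossing; a pair with it has one common point, a crossing away from all
  vertices.\<close>

lemma one_plane_pointsI:
  fixes G :: "complex drawn_graph"
  assumes fin: "finite (verts G)" and loc: "\<And>v. loc G v = v"
    and E: "\<And>e. e \<in> edges G \<Longrightarrow> e \<subseteq> verts G \<and> card e = 2"
    and arcs: "\<And>e. e \<in> edges G \<Longrightarrow> \<exists>g. arc g \<and> path_image g = curve G e \<and> {pathstart g, pathfinish g} = e"
    and cV: "\<And>e. e \<in> edges G \<Longrightarrow> curve G e \<inter> verts G = e"
    and dich: "\<And>e f. e \<in> edges G \<Longrightarrow> f \<in> edges G \<Longrightarrow> e \<noteq> f \<Longrightarrow> curve G e \<inter> curve G f \<subseteq> e \<inter> f \<or> X e f"
    and X: "\<And>e f. e \<in> edges G \<Longrightarrow> f \<in> edges G \<Longrightarrow> X e f \<Longrightarrow>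
      \<exists>z. curve G e \<inter> curve G f = {z} \<and> z \<notin> verts G \<and> crosses_at (curve G e) (curve G f) z"
    and uniq: "\<And>e f g. e \<in> edges G \<Longrightarrow> f \<in> edges G \<Longrightarrow> g \<in> edges G \<Longrightarrow> X e f \<Longrightarrow> X e g \<Longrightarrow> f = g"
  shows "one_plane G" and "\<And>e f. e \<in> edges G \<Longrightarrow> f \<in> edges G \<Longrightarrow> crosses G e f \<Longrightarrow> X e f"
proof -
  have esub: "e \<subseteq> curve G e" "e \<subseteq> verts G" if "e \<in> edges G" for e
    using cV[OF that] by blast+
  have none: "crossings G e f = {}" if ef: "e \<in> edges G" "curve G e \<inter> curve G f \<subseteq> e \<inter> f" for e f
  proof -
    have False if x: "x \<in> crossings G e f" for x
    proof -
      have c: "crosses_at (curve G e) (curve G f) x" using x by (simp add: crossings_def)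
      then have xe: "x \<in> e" using crosses_at_mem ef(2) by blast
      obtain g where g: "arc g" "path_image g = curve G e" "{pathstart g, pathfinish g} = e"
        using arcs[OF ef(1)] by auto
      have "x \<noteq> pathstart g" "x \<noteq> pathfinish g"
        using crosses_at_not_endpoint[OF g(1)] c g(2) by auto
      then show False using xe g(3) by auto
    qed
    then show ?thesis by blast
  qed
  have one: "crossings G e f = {z}" "e \<inter> f = {}"
    if ef: "e \<in> edges G" "f \<in> edges G" "curve G e \<inter> curve G f = {z}" "z \<notin> verts G"
      "crosses_at (curve G e) (curve G f) z" for e f z
  proof -
    show "crossings G e f = {z}" using ef(3,5) crosses_at_mem unfolding crossings_def by blast
    have "e \<inter> f \<subseteq> {z}" using esub(1)[OF ef(1)] esub(1)[OF ef(2)] ef(3) by blast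
    then show "e \<inter> f = {}" using esub(2)[OF ef(1)] ef(4) by blast
  qed
  have inter: "curve G e \<inter> curve G f = (e \<inter> f) \<union> crossings G e f"
    if ef: "e \<in> edges G" "f \<in> edges G" "e \<noteq> f" for e f
  proof -
    have "curve G e \<inter> curve G f \<subseteq> e \<inter> f \<or> X e f" by (rule dich[OF ef])
    then show ?thesis
    proof
      assume t: "curve G e \<inter> curve G f \<subseteq> e \<inter> f"
      moreover have "e \<inter> f \<subseteq> curve G e \<inter> curve G f" using esub(1)[OF ef(1)] esub(1)[OF ef(2)] by blast
      ultimately show ?thesis using none[OF ef(1) t] by blast
    next
      assume "X e f"
      then obtain z where z: "curve G e \<inter> curve G f = {z}" "z \<notin> verts G" "crosses_at (curve G e) (curve G f) z"
        using X[OF ef(1,2)] by blast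
      show ?thesis using one[OF ef(1,2) z] z(1) by simp
    qed
  qed
  show cX: "X e f" if ef: "e \<in> edges G" "f \<in> edges G" "crosses G e f" for e f
    using dich[OF ef(1,2)] none[OF ef(1), of f] ef(3) unfolding crosses_def by blast
  have cXz: "\<exists>z. crossings G e f = {z} \<and> e \<inter> f = {}" if ef: "e \<in> edges G" "f \<in> edges G" "X e f" for e f
    using X[OF ef] one[OF ef(1,2)] by blast
  have loc_id: "loc G = (\<lambda>v. v)" using loc by blast
  have drw: "drawing G"
    unfolding drawing_def simple_graph_def loc_id using fin E arcs cV inter by simp
  show "one_plane G"
    unfolding one_plane_def good_drawing_def
  proof (intro conjI ballI impI drw)
    fix e f x y assume "e \<in> edges G" "f \<in> edges G" "e \<noteq> f" "x \<in> crossings G e f" "y \<in> crossings G e f"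
    then have "crosses G e f" unfolding crosses_def by blast
    then obtain z where "crossings G e f = {z}" using cX cXz \<open>e \<in> edges G\<close> \<open>f \<in> edges G\<close> by meson
    then show "x = y" using \<open>x \<in> crossings G e f\<close> \<open>y \<in> crossings G e f\<close> by simp
  next
    fix e f assume "e \<in> edges G" "f \<in> edges G" "e \<inter> f \<noteq> {}"
    then show "\<not> crosses G e f" using cX cXz by meson
  next
    fix e f g assume "e \<in> edges G" "f \<in> edges G" "g \<in> edges G" "crosses G e f \<and> crosses G e g"
    then show "f = g" using cX uniq by meson
  qed
qed

text \<open>\<open>f\<close> renames the vertices and \<psi> moves the plane. The concrete drawings
  have points as vertices, the merged graph has natural numbers, and one of its two parts is
  reflected.\<close>

definition relabel :: "('a \<Rightarrow> 'b) \<Rightarrow> (complex \<Rightarrow> complex) \<Rightarrow> 'a drawn_graph \<Rightarrow> 'b drawn_graph" where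
  "relabel f \<psi> G = \<lparr>verts = f ` verts G, edges = (`) f ` edges G,
     loc = (\<lambda>v. \<psi> (loc G (inv_into (verts G) f v))),
     curve = (\<lambda>e. \<psi> ` curve G (inv_into (verts G) f ` e))\<rparr>"

context
  fixes f :: "'a \<Rightarrow> 'b" and \<psi> \<psi>' :: "complex \<Rightarrow> complex" and G :: "'a drawn_graph"
  assumes inj: "inj_on f (verts G)" and hom: "homeomorphism UNIV UNIV \<psi> \<psi>'"
    and sub: "\<forall>e\<in>edges G. e \<subseteq> verts G"
begin

lemma relabel_simps:
  "verts (relabel f \<psi> G) = f ` verts G" "edges (relabel f \<psi> G) = (`) f ` edges G"
  "v \<in> verts G \<Longrightarrow> loc (relabel f \<psi> G) (f v) = \<psi> (loc G v)"
  "e \<in> edges G \<Longrightarrow> curve (relabel f \<psi> G) (f ` e) = \<psi> ` curve G e"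
proof -
  assume "e \<in> edges G"
  then have "inv_into (verts G) f ` f ` e = e" using sub inj by (simp add: inv_into_image_cancel)
  then show "curve (relabel f \<psi> G) (f ` e) = \<psi> ` curve G e" by (simp add: relabel_def)
qed (use inj in \<open>simp_all add: relabel_def\<close>)

lemma inj_on_relabel_edges: "inj_on ((`) f) (edges G)"
  by (rule inj_onI) (rule iffD1[OF inj_on_image_eq_iff[OF inj bspec[OF sub] bspec[OF sub]]])

lemma relabel_crossings:
  assumes "e \<in> edges G" "e' \<in> edges G"
  shows "crossings (relabel f \<psi> G) (f ` e) (f ` e') = \<psi> ` crossings G e e'"
proof -
  have p: "\<psi>' (\<psi> z) = z" "\<psi> (\<psi>' z) = z" for z using hom unfolding homeomorphism_def by auto
  have *: "crosses_at (\<psi> ` A) (\<psi> ` B) (\<psi> x) \<longleftrightarrow> crosses_at A B x" for A B x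
    using crosses_at_homeomorphism[OF hom, of A B x]
      crosses_at_homeomorphism[OF homeomorphism_symD[OF hom], of "\<psi> ` A" "\<psi> ` B" "\<psi> x"]
    by (auto simp: image_image p)
  have "{x. crosses_at (\<psi> ` A) (\<psi> ` B) x} = \<psi> ` {x. crosses_at A B x}" for A B
  proof (intro equalityI subsetI)
    fix x assume "x \<in> {x. crosses_at (\<psi> ` A) (\<psi> ` B) x}"
    then have "crosses_at A B (\<psi>' x)" using *[of A B "\<psi>' x"] by (simp add: p)
    then show "x \<in> \<psi> ` {x. crosses_at A B x}"
      by (intro image_eqI[of _ _ "\<psi>' x"]) (simp_all add: p)
  qed (use * in auto)
  then show ?thesis unfolding crossings_def relabel_simps(4)[OF assms(1)] relabel_simps(4)[OF assms(2)] .
qed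

lemma relabel_crosses:
  assumes "e \<in> edges G" "e' \<in> edges G"
  shows "crosses (relabel f \<psi> G) (f ` e) (f ` e') \<longleftrightarrow> crosses G e e'"
  unfolding crosses_def relabel_crossings[OF assms]
  using inj_on_eq_iff[OF inj_on_relabel_edges assms] by simp

lemma one_plane_relabel:
  assumes G: "one_plane G" shows "one_plane (relabel f \<psi> G)"
proof -
  let ?R = "relabel f \<psi> G"
  have good: "good_drawing G" and drw: "drawing G" using G unfolding one_plane_def good_drawing_def by auto
  have p: "\<psi>' (\<psi> z) = z" for z using hom unfolding homeomorphism_def by auto
  have injp: "inj \<psi>" by (rule inj_on_inverseI[of _ \<psi>']) (simp add: p)
  have cont: "continuous_on S \<psi>" for S using hom unfolding homeomorphism_def by (meson continuous_on_subset subset_UNIV)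
  have locim: "loc ?R ` f ` S = \<psi> ` loc G ` S" if "S \<subseteq> verts G" for S
    using relabel_simps(3) that by (auto simp: image_image subset_iff intro!: image_cong)
  have d: "simple_graph (verts G) (edges G)" "inj_on (loc G) (verts G)"
    "\<forall>e\<in>edges G. \<exists>g. arc g \<and> path_image g = curve G e \<and> {pathstart g, pathfinish g} = loc G ` e"
    "\<forall>e\<in>edges G. curve G e \<inter> loc G ` verts G = loc G ` e"
    "\<forall>e\<in>edges G. \<forall>f\<in>edges G. e \<noteq> f \<longrightarrow> curve G e \<inter> curve G f = loc G ` (e \<inter> f) \<union> crossings G e f"
    using drw unfolding drawing_def by auto
  have dR: "drawing ?R"
    unfolding drawing_def relabel_simps(1,2)
  proof (intro conjI ballI impI)
    show "simple_graph (f ` verts G) ((`) f ` edges G)"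
      using d(1) card_image[OF inj_on_subset[OF inj]] unfolding simple_graph_def by (auto simp: subset_iff)
    show "inj_on (loc ?R) (f ` verts G)"
    proof (rule inj_onI)
      fix x y assume "x \<in> f ` verts G" "y \<in> f ` verts G" "loc ?R x = loc ?R y"
      then obtain u v where uv: "u \<in> verts G" "v \<in> verts G" "x = f u" "y = f v" "\<psi> (loc G u) = \<psi> (loc G v)"
        using relabel_simps(3) by auto
      then have "loc G u = loc G v" using injp by (simp add: inj_eq)
      then show "x = y" using inj_onD[OF d(2)] uv by blast
    qed
  next
    fix e' assume "e' \<in> (`) f ` edges G"
    then obtain e where e: "e \<in> edges G" "e' = f ` e" by blast
    obtain g where g: "arc g" "path_image g = curve G e" "{pathstart g, pathfinish g} = loc G ` e"
      using d(3) e(1) by auto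
    have "arc (\<psi> \<circ> g)"
      using g(1) path_continuous_image[of g \<psi>] cont inj_on_subset[OF injp] by (simp add: arc_def comp_inj_on)
    moreover have "path_image (\<psi> \<circ> g) = curve ?R e'"
      unfolding e(2) relabel_simps(4)[OF e(1)] path_image_compose g(2) ..
    moreover have "{pathstart (\<psi> \<circ> g), pathfinish (\<psi> \<circ> g)} = loc ?R ` e'"
      unfolding e(2) locim[OF bspec[OF sub e(1)]] g(3)[symmetric] by (simp add: pathstart_compose pathfinish_compose)
    ultimately show "\<exists>g. arc g \<and> path_image g = curve ?R e' \<and> {pathstart g, pathfinish g} = loc ?R ` e'" by blast
    have "\<psi> ` curve G e \<inter> \<psi> ` loc G ` verts G = \<psi> ` loc G ` e"
      using d(4) e(1) injp by (simp add: image_Int[symmetric])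
    then show "curve ?R e' \<inter> loc ?R ` f ` verts G = loc ?R ` e'"
      unfolding e(2) locim[OF bspec[OF sub e(1)]] locim[OF subset_refl] relabel_simps(4)[OF e(1)] .
  next
    fix e1 e2 assume "e1 \<in> (`) f ` edges G" "e2 \<in> (`) f ` edges G" "e1 \<noteq> e2"
    then obtain a b where e: "a \<in> edges G" "b \<in> edges G" "a \<noteq> b" "e1 = f ` a" "e2 = f ` b" by blast
    have i: "f ` a \<inter> f ` b = f ` (a \<inter> b)"
      using inj_on_image_Int[OF inj bspec[OF sub e(1)] bspec[OF sub e(2)]] by simp
    have ab: "a \<inter> b \<subseteq> verts G" using bspec[OF sub e(1)] by blast
    have "\<psi> ` curve G a \<inter> \<psi> ` curve G b = \<psi> ` loc G ` (a \<inter> b) \<union> \<psi> ` crossings G a b"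
      using d(5) e(1-3) injp by (simp add: image_Int[symmetric] image_Un[symmetric])
    then show "curve ?R e1 \<inter> curve ?R e2 = loc ?R ` (e1 \<inter> e2) \<union> crossings ?R e1 e2"
      unfolding e(4,5) i locim[OF ab] relabel_simps(4)[OF e(1)] relabel_simps(4)[OF e(2)]
        relabel_crossings[OF e(1,2)] .
  qed
  have pt1: "x = y" if h: "e1 \<in> (`) f ` edges G" "e2 \<in> (`) f ` edges G" "e1 \<noteq> e2"
    "x \<in> crossings ?R e1 e2" "y \<in> crossings ?R e1 e2" for e1 e2 x y
  proof -
    obtain a b where e: "a \<in> edges G" "b \<in> edges G" "a \<noteq> b" "e1 = f ` a" "e2 = f ` b" using h(1-3) by blast
    obtain x' y' where "x' \<in> crossings G a b" "y' \<in> crossings G a b" "x = \<psi> x'" "y = \<psi> y'"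
      using h(4,5) unfolding e(4,5) relabel_crossings[OF e(1,2)] by blast
    then show ?thesis using good e unfolding good_drawing_def by metis
  qed
  have adj: "\<not> crosses ?R e1 e2" if h: "e1 \<in> (`) f ` edges G" "e2 \<in> (`) f ` edges G" "e1 \<inter> e2 \<noteq> {}" for e1 e2
  proof -
    obtain a b where e: "a \<in> edges G" "b \<in> edges G" "e1 = f ` a" "e2 = f ` b" using h(1,2) by blast
    have "f ` a \<inter> f ` b = f ` (a \<inter> b)"
      using inj_on_image_Int[OF inj bspec[OF sub e(1)] bspec[OF sub e(2)]] by simp
    then have "a \<inter> b \<noteq> {}" using h(3) e(3,4) by auto
    then have "\<not> crosses G a b" using good e(1,2) unfolding good_drawing_def by simp
    then show ?thesis unfolding e(3,4) relabel_crosses[OF e(1,2)] .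
  qed
  have one: "e2 = e3" if h: "e1 \<in> (`) f ` edges G" "e2 \<in> (`) f ` edges G" "e3 \<in> (`) f ` edges G"
    "crosses ?R e1 e2 \<and> crosses ?R e1 e3" for e1 e2 e3
  proof -
    obtain a where a: "a \<in> edges G" "e1 = f ` a" using h(1) by blast
    obtain b where b: "b \<in> edges G" "e2 = f ` b" using h(2) by blast
    obtain c where c: "c \<in> edges G" "e3 = f ` c" using h(3) by blast
    note e = a(1) b(1) c(1) a(2) b(2) c(2)
    have "crosses G a b \<and> crosses G a c"
      using h(4) unfolding e(4-6) relabel_crosses[OF e(1,2)] relabel_crosses[OF e(1,3)] .
    then have "b = c" using G e(1-3) unfolding one_plane_def by blast
    then show ?thesis using e by simp
  qed
  show ?thesis
    unfolding one_plane_def good_drawing_def relabel_simps(2)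
    by (intro conjI ballI impI dR) (rule pt1 adj one; assumption)+
qed

lemma relabel_card: "card (verts (relabel f \<psi> G)) = card (verts G)" "card (edges (relabel f \<psi> G)) = card (edges G)"
  unfolding relabel_simps(1,2) using card_image[OF inj] card_image[OF inj_on_relabel_edges] by auto

lemma relabel_vertex_degree:
  assumes v: "v \<in> verts G" shows "vertex_degree (relabel f \<psi> G) (f v) = vertex_degree G v"
proof -
  have "f v \<in> f ` e \<longleftrightarrow> v \<in> e" if "e \<in> edges G" for e
    using inj_on_image_mem_iff[OF inj v bspec[OF sub that]] .
  then have "{e \<in> (`) f ` edges G. f v \<in> e} = (`) f ` {e \<in> edges G. v \<in> e}" by blast
  moreover have "inj_on ((`) f) {e \<in> edges G. v \<in> e}"
    by (rule inj_on_subset[OF inj_on_relabel_edges]) blast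
  ultimately show ?thesis unfolding vertex_degree_def relabel_simps(2) by (simp add: card_image)
qed

lemma relabel_skeleton: "skeleton (relabel f \<psi> G) = \<psi> ` skeleton G"
proof -
  have "loc (relabel f \<psi> G) ` f ` verts G = \<psi> ` loc G ` verts G"
    using relabel_simps(3) by (auto simp: image_image intro!: image_cong)
  moreover have "(\<Union>e\<in>edges G. curve (relabel f \<psi> G) (f ` e)) = (\<Union>e\<in>edges G. \<psi> ` curve G e)"
    using relabel_simps(4) by (rule SUP_cong[OF refl])
  ultimately show ?thesis
    unfolding skeleton_def relabel_simps(1,2) by (simp add: image_Un image_UN)
qed

lemma relabel_non_crossing:
  assumes "non_crossing G e" shows "non_crossing (relabel f \<psi> G) (f ` e)"
  using assms relabel_crosses[of e] unfolding non_crossing_def relabel_simps(2) by auto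

end

lemma optimal_one_planeI:
  assumes G: "one_plane G" and n: "card (verts G) \<ge> 3" and m: "card (edges G) + 8 = 4 * card (verts G)"
  shows "optimal_one_plane G"
proof -
  have "\<not> one_planar (verts G) (insert e (edges G))" if e: "e \<notin> edges G" for e
  proof
    assume "one_planar (verts G) (insert e (edges G))"
    then obtain G' where G': "one_plane G'" "verts G' = verts G" "edges G' = insert e (edges G)"
      unfolding one_planar_def by blast
    have "finite (edges G)" using m n by (intro card_ge_0_finite) linarith
    then have "card (edges G') = card (edges G) + 1" using e by (simp add: G'(3))
    then show False using one_plane_edge_bound[OF G'(1)] n m G'(2) by simp
  qed
  then show ?thesis
    using G m unfolding optimal_one_plane_def optimal_one_planar_def maximal_one_planar_def one_planar_def by blast
qed

section \<open>Closing a pattern with two bent edges\<close>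

abbreviation "vA \<equiv> pt (-60, -20)"
abbreviation "vB \<equiv> pt (60, -20)"
abbreviation "vC \<equiv> pt (20, 30)"
abbreviation "vD \<equiv> pt (-20, 30)"
abbreviation "vX \<equiv> pt (0, 70)"

definition bentAC :: "complex set" where "bentAC = convex hull {vA, vX} \<union> convex hull {vX, vC}"
definition bentBD :: "complex set" where "bentBD = convex hull {vB, vX} \<union> convex hull {vX, vD}"

text \<open>The shear below straightens both bent edges.\<close>

lemma bent_edges_cross: "crosses_at bentAC bentBD vX"
proof -
  \<comment> \<open>The legs of the first bent edge have slopes 3/2 and -2; adding
    \<open>7/4 * \<bar>Re v\<bar>\<close> makes both equal to -1/4. By symmetry both legs of the
    other bent edge get slope 1/4.\<close>
  define T where "T = (\<lambda>v. Complex (Re v) (Im v + 7/4 * \<bar>Re v\<bar>))"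
  define T' where "T' = (\<lambda>v. Complex (Re v) (Im v - 7/4 * \<bar>Re v\<bar>))"
  have inv: "T' (T v) = v" "T (T' v) = v" for v by (simp_all add: T_def T'_def)
  have sur: "T ` UNIV = UNIV" "T' ` UNIV = UNIV" using inv by (metis surj_def)+
  have "continuous_on UNIV T" "continuous_on UNIV T'"
    unfolding T_def T'_def Complex_eq by (auto intro!: continuous_intros)
  then have hom: "homeomorphism UNIV UNIV T T'"
    unfolding homeomorphism_def using inv sur by simp
  have TX: "T vX = vX" by (simp add: T_def complex_eq_iff)
  have "crosses_at (T ` bentAC) (T ` bentBD) vX"
  \<comment> \<open>The short legs reach only to real part 20 or -20, which bounds
    \<epsilon>.\<close>
  proof (rule crosses_at_lines[where ?d1.0 = "Complex 1 (-1/4)" and ?d2.0 = "Complex 1 (1/4)" and \<epsilon> = 20])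
    show "T ` bentAC \<subseteq> range (\<lambda>t. vX + complex_of_real t * Complex 1 (-1/4))"
    proof
      fix w assume "w \<in> T ` bentAC"
      then obtain v where v: "v \<in> bentAC" "w = T v" by blast
      from v(1) consider "v \<in> convex hull {vA, vX}" | "v \<in> convex hull {vX, vC}" unfolding bentAC_def by blast
      then have "w = vX + complex_of_real (Re v) * Complex 1 (-1/4)"
      proof cases
        case 1
        then obtain t where "0 \<le> t" "t \<le> 1" "Re v = -60 + t * 60" "Im v = -20 + t * 90" unfolding hull_pair_iff by auto
        then show ?thesis unfolding v(2) T_def by (simp add: complex_eq_iff abs_if field_simps)
      next
        case 2
        then obtain t where "0 \<le> t" "t \<le> 1" "Re v = t * 20" "Im v = 70 - t * 40" unfolding hull_pair_iff by auto
        then show ?thesis unfolding v(2) T_def by (simp add: complex_eq_iff abs_if field_simps)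
      qed
      then show "w \<in> range (\<lambda>t. vX + complex_of_real t * Complex 1 (-1/4))" by blast
    qed
    show "T ` bentBD \<subseteq> range (\<lambda>t. vX + complex_of_real t * Complex 1 (1/4))"
    proof
      fix w assume "w \<in> T ` bentBD"
      then obtain v where v: "v \<in> bentBD" "w = T v" by blast
      from v(1) consider "v \<in> convex hull {vB, vX}" | "v \<in> convex hull {vX, vD}" unfolding bentBD_def by blast
      then have "w = vX + complex_of_real (Re v) * Complex 1 (1/4)"
      proof cases
        case 1
        then obtain t where "0 \<le> t" "t \<le> 1" "Re v = 60 - t * 60" "Im v = -20 + t * 90" unfolding hull_pair_iff by auto
        then show ?thesis unfolding v(2) T_def by (simp add: complex_eq_iff abs_if field_simps)
      next
        case 2
        then obtain t where "0 \<le> t" "t \<le> 1" "Re v = - (t * 20)" "Im v = 70 - t * 40" unfolding hull_pair_iff by auto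
        then show ?thesis unfolding v(2) T_def by (simp add: complex_eq_iff abs_if field_simps)
      qed
      then show "w \<in> range (\<lambda>t. vX + complex_of_real t * Complex 1 (1/4))" by blast
    qed
    show "vX + complex_of_real x * Complex 1 (-1/4) \<in> T ` bentAC" if "\<bar>x\<bar> < 20" for x
    proof (cases "x \<le> 0")
      case True
      let ?v = "Complex x (70 + 3/2 * x)"
      have "?v \<in> convex hull {vA, vX}"
        unfolding hull_pair_iff using that True by (intro exI[of _ "1 + x/60"]) auto
      moreover have "T ?v = vX + complex_of_real x * Complex 1 (-1/4)"
        using True by (simp add: T_def complex_eq_iff)
      ultimately show ?thesis unfolding bentAC_def by (metis UnI1 image_eqI)
    next
      case False
      let ?v = "Complex x (70 - 2 * x)"
      have "?v \<in> convex hull {vX, vC}"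
        unfolding hull_pair_iff using that False by (intro exI[of _ "x/20"]) auto
      moreover have "T ?v = vX + complex_of_real x * Complex 1 (-1/4)"
        using False by (simp add: T_def complex_eq_iff)
      ultimately show ?thesis unfolding bentAC_def by (metis UnI2 image_eqI)
    qed
    show "vX + complex_of_real x * Complex 1 (1/4) \<in> T ` bentBD" if "\<bar>x\<bar> < 20" for x
    proof (cases "x \<ge> 0")
      case True
      let ?v = "Complex x (70 - 3/2 * x)"
      have "?v \<in> convex hull {vB, vX}"
        unfolding hull_pair_iff using that True by (intro exI[of _ "1 - x/60"]) auto
      moreover have "T ?v = vX + complex_of_real x * Complex 1 (1/4)"
        using True by (simp add: T_def complex_eq_iff)
      ultimately show ?thesis unfolding bentBD_def by (metis UnI1 image_eqI)
    next
      case False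
      let ?v = "Complex x (70 + 2 * x)"
      have "?v \<in> convex hull {vX, vD}"
        unfolding hull_pair_iff using that False by (intro exI[of _ "- x/20"]) auto
      moreover have "T ?v = vX + complex_of_real x * Complex 1 (1/4)"
        using False by (simp add: T_def complex_eq_iff)
      ultimately show ?thesis unfolding bentBD_def by (metis UnI2 image_eqI)
    qed
  qed simp_all
  then have "crosses_at (T' ` T ` bentAC) (T' ` T ` bentBD) (T' vX)"
    by (rule crosses_at_homeomorphism[OF homeomorphism_symD[OF hom]])
  moreover have "T' vX = vX" using inv(1)[of vX] TX by simp
  ultimately show ?thesis by (simp add: image_image inv)
qed

text \<open>The bend \<open>vX\<close> is not a vertex: both bent edges turn there, and it is their
  crossing point.\<close>

definition nested_drawing :: "iseg list \<Rightarrow> nat \<Rightarrow> complex drawn_graph" where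
  "nested_drawing L j = (let S = seg ` set L \<union> nest j in
    \<lparr>verts = \<Union>S, edges = S \<union> {{vA, vC}, {vB, vD}}, loc = (\<lambda>v. v),
     curve = (\<lambda>e. if e = {vA, vC} then bentAC else if e = {vB, vD} then bentBD else convex hull e)\<rparr>)"

text \<open>Two such drawings, one of them reflected in the line Im z = -20, can be merged along ab.\<close>

definition resting :: "complex drawn_graph \<Rightarrow> bool" where
  "resting G \<longleftrightarrow> one_plane G \<and> (\<forall>v. loc G v = v) \<and> vA \<in> verts G \<and> vB \<in> verts G \<and>
     (\<forall>v\<in>verts G. even (vertex_degree G v)) \<and> non_crossing G {vA, vB} \<and>
     curve G {vA, vB} = convex hull {vA, vB} \<and>
     (\<forall>z\<in>skeleton G. z \<in> convex hull {vA, vB} \<or> Im z > -20)"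

text \<open>The four legs of the bent edges are first regarded as ordinary segments
  \<open>BS\<close> with an auxiliary vertex \<open>vX\<close>. The whole is then one straight
  drawing, to which the gluing lemma applies, and only afterwards are the legs joined in
  pairs.\<close>

proposition nested_drawing_properties:
  fixes j :: nat
  assumes test: "pattern_test L V"
  defines "G \<equiv> nested_drawing L j"
  shows "resting G" "card (verts G) = length V + 4 * j" "card (edges G) + 8 = 4 * card (verts G)"
proof -
  define P where "P = seg ` set L"
  define N where "N = nest j"
  define S where "S = P \<union> N"
  define W where "W = \<Union>S"
  have G: "verts G = W" "edges G = S \<union> {{vA, vC}, {vB, vD}}" "loc G v = v"
    "curve G e = (if e = {vA, vC} then bentAC else if e = {vB, vD} then bentBD else convex hull e)" for v e
    by (simp_all add: G_def nested_drawing_def Let_def W_def S_def P_def N_def)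
  have t: "drawing_test (L @ bends)"
    "\<And>s u. s \<in> insert ((-60, -20), (60, -20)) (set bends) \<Longrightarrow> u \<in> set (L @ bends) \<Longrightarrow> \<not> cross_test s u"
    "\<And>s. s \<in> set (L @ bends) \<Longrightarrow> outside_test s"
    "vertices_test L V (\<lambda>v. (v \<in> set corners) \<noteq> (v \<in> set frame))"
    "set corners \<subseteq> set V" "set frame \<subseteq> set V" "(0, 70) \<notin> set V"
    "\<And>v. v \<in> set V \<Longrightarrow> snd v > -20 \<or> v = (-60, -20) \<or> v = (60, -20)"
    "((-60, -20), (20, 30)) \<notin> set L" "((20, 30), (-60, -20)) \<notin> set L"
    "((60, -20), (-20, 30)) \<notin> set L" "((-20, 30), (60, -20)) \<notin> set L"
    "((-60, -20), (60, -20)) \<in> set L \<or> ((60, -20), (-60, -20)) \<in> set L"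
    "length L + 12 = 4 * length V"
    using test unfolding pattern_test_def list_all_iff by auto
  define BS where "BS = seg ` set bends"
  have BS: "BS = {{vA, vX}, {vX, vC}, {vB, vX}, {vX, vD}}"
    by (simp add: BS_def bends_def seg_def)
  have PB: "seg ` set (L @ bends) = P \<union> BS" by (simp add: P_def BS_def image_Un)
  note dr = drawing_test_sound[OF t(1), unfolded PB]
  have dmL: "distinct (map seg L)" using dr(2) by simp
  note vs = vertices_test_sound[OF dmL t(4), folded P_def]
  note nest = nest_properties[of j, folded N_def]
  have bcP: "box_corners \<subseteq> \<Union>P" unfolding vs(1) box_corners_def using t(5) by blast
  have off: "\<forall>s\<in>P \<union> BS. off_square s"
    using outside_test_sound t(3) unfolding PB[symmetric] by blast
  have bcPB: "box_corners \<subseteq> \<Union>(P \<union> BS)" using bcP by blast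
  note glue = square_filling_glue[OF dr(1) off bcPB nest(1)]
  have SD: "straight_drawing (S \<union> BS)" using glue(1) unfolding S_def by (simp add: Un_ac)
  have finS: "finite S" using SD by (simp add: straight_drawing_def)
  have AB: "{vA, vB} \<in> P" using t(13) by (force simp: P_def seg_def image_iff insert_commute)
  \<comment> \<open>The base edge and the legs are crossed by nothing: the pattern is excluded by
    the test, the nest by the gluing lemma.\<close>
  have special: "tame s u \<and> \<not> cross_segs s u" if s: "s \<in> insert {vA, vB} BS" and u: "u \<in> S \<union> BS" "s \<noteq> u" for s u
  proof -
    have sP: "s \<in> P \<union> BS" using s AB by blast
    have "\<not> cross_segs s u"
    proof (cases "u \<in> N")
      case True then show ?thesis using glue(3)[OF sP True] cross_segs_not_tame by blast
    next
      case False
      then have "u \<in> seg ` set (L @ bends)" using u(1) unfolding PB S_def by blast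
      then obtain u' where u': "u' \<in> set (L @ bends)" "u = seg u'" by blast
      have "s \<in> seg ` insert ((-60, -20), (60, -20)) (set bends)" using s by (simp add: BS_def seg_def)
      then obtain s' where "s' \<in> insert ((-60, -20), (60, -20)) (set bends)" "s = seg s'" by blast
      then show ?thesis using t(2) u' cross_test_iff by blast
    qed
    moreover have "s \<in> S \<union> BS" using sP unfolding S_def by blast
    moreover have "\<forall>s\<in>S \<union> BS. \<forall>t\<in>S \<union> BS. s \<noteq> t \<longrightarrow> tame s t \<or> cross_segs s t"
      using SD by (simp add: straight_drawing_def)
    ultimately show ?thesis using u by blast
  qed
  have inbox: "\<bar>Re v\<bar> \<le> 1" "\<bar>Im v\<bar> \<le> 1" if v: "v \<in> \<Union>N" for v
  proof -
    obtain s where "s \<in> N" "v \<in> s" using v by blast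
    then show "\<bar>Re v\<bar> \<le> 1" "\<bar>Im v\<bar> \<le> 1" using nest(1) hull_inc[of v s convex] by (auto simp: square_filling_def)
  qed
  have W: "W = pt ` set V \<union> \<Union>N" unfolding W_def S_def using vs(1) by blast
  have frameW: "vA \<in> W" "vB \<in> W" "vC \<in> W" "vD \<in> W" using t(6) unfolding W frame_def by auto
  have XW: "vX \<notin> W"
  proof -
    have "vX \<notin> pt ` set V" using t(7) by (auto simp: image_iff)
    moreover have "vX \<notin> \<Union>N" using inbox(2)[of vX] by auto
    ultimately show ?thesis unfolding W by blast
  qed
  have finW: "finite W" unfolding W using nest(3) by simp
  have cardS: "s \<in> S \<Longrightarrow> card s = 2" and Ssub: "s \<in> S \<Longrightarrow> s \<subseteq> W" for s
    using SD unfolding straight_drawing_def W_def by auto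
  have bentS: "{vA, vC} \<notin> S" "{vB, vD} \<notin> S"
  proof -
    have "{vA, vC} \<notin> P" "{vB, vD} \<notin> P"
      using t(9-12) unfolding P_def seg_def by (auto simp: doubleton_eq_iff)
    moreover have "vA \<notin> \<Union>N" "vB \<notin> \<Union>N" using inbox(1)[of vA] inbox(1)[of vB] by auto
    then have "{vA, vC} \<notin> N" "{vB, vD} \<notin> N" by blast+
    ultimately show "{vA, vC} \<notin> S" "{vB, vD} \<notin> S" unfolding S_def by blast+
  qed
  have ne: "{vA, vC} \<noteq> {vB, vD}" by (simp add: doubleton_eq_iff)
  have curve: "curve G {vA, vC} = bentAC" "curve G {vB, vD} = bentBD" "s \<in> S \<Longrightarrow> curve G s = convex hull s" for s
    using G(4) ne bentS by auto
  have tameS: "convex hull s \<inter> convex hull b \<subseteq> s \<inter> b" if "s \<in> S" "b \<in> BS" for s b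
  proof -
    have "b \<noteq> s" using that XW Ssub[OF that(1)] unfolding BS by blast
    then show ?thesis using special[of b s] that tame_def tame_sym by blast
  qed
  have tameB: "convex hull s \<inter> convex hull b \<subseteq> s \<inter> b" if "s \<in> BS" "b \<in> BS" "s \<noteq> b" for s b
    using special[of s b] that tame_def by blast
  have straight_bent: "convex hull s \<inter> bentAC \<subseteq> s \<inter> {vA, vC}" "convex hull s \<inter> bentBD \<subseteq> s \<inter> {vB, vD}"
    if s: "s \<in> S" for s
  proof -
    have X: "vX \<notin> s" using XW Ssub[OF s] by blast
    show "convex hull s \<inter> bentAC \<subseteq> s \<inter> {vA, vC}"
      using tameS[OF s, of "{vA, vX}"] tameS[OF s, of "{vX, vC}"] X unfolding bentAC_def BS by auto
    show "convex hull s \<inter> bentBD \<subseteq> s \<inter> {vB, vD}"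
      using tameS[OF s, of "{vB, vX}"] tameS[OF s, of "{vX, vD}"] X unfolding bentBD_def BS by auto
  qed
  have bent_bent: "bentAC \<inter> bentBD = {vX}"
  proof
    have n: "{vA, vX} \<noteq> {vB, vX}" "{vA, vX} \<noteq> {vX, vD}" "{vX, vC} \<noteq> {vB, vX}" "{vX, vC} \<noteq> {vX, vD}"
      by (simp_all add: doubleton_eq_iff)
    show "bentAC \<inter> bentBD \<subseteq> {vX}"
      using tameB[OF _ _ n(1)] tameB[OF _ _ n(2)] tameB[OF _ _ n(3)] tameB[OF _ _ n(4)]
      unfolding bentAC_def bentBD_def BS by auto
    show "{vX} \<subseteq> bentAC \<inter> bentBD" unfolding bentAC_def bentBD_def by (simp add: hull_inc)
  qed
  have bent_arc: "\<exists>g. arc g \<and> path_image g = convex hull {p, vX} \<union> convex hull {vX, q} \<and> {pathstart g, pathfinish g} = {p, q}"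
    if "{p, vX} \<in> BS" "{vX, q} \<in> BS" "p \<noteq> q" "p \<noteq> vX" "q \<noteq> vX" for p q
  proof -
    have "{p, vX} \<noteq> {vX, q}" using that(3) by (auto simp: doubleton_eq_iff)
    then have "convex hull {p, vX} \<inter> convex hull {vX, q} \<subseteq> {p, vX} \<inter> {vX, q}" using tameB that by blast
    then have "arc (linepath p vX +++ linepath vX q)"
      using that(3-5) by (intro arc_join) (auto simp: segment_convex_hull)
    then show ?thesis by (intro exI[of _ "linepath p vX +++ linepath vX q"])
        (simp add: path_image_join segment_convex_hull)
  qed
  have curveAB: "curve G {vA, vB} = convex hull {vA, vB}" using curve(3) AB unfolding S_def by blast
  have E: "e \<subseteq> verts G \<and> card e = 2" if "e \<in> edges G" for e
    using that cardS Ssub frameW unfolding G(1,2) by auto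
  have arcs: "\<exists>g. arc g \<and> path_image g = curve G e \<and> {pathstart g, pathfinish g} = e" if e: "e \<in> edges G" for e
  proof -
    from e consider "e \<in> S" | "e = {vA, vC}" | "e = {vB, vD}" unfolding G(2) by blast
    then show ?thesis
    proof cases
      case 1
      then obtain p q where pq: "e = {p, q}" "p \<noteq> q" using cardS by (meson card_2_iff)
      then show ?thesis unfolding curve(3)[OF 1]
        by (intro exI[of _ "linepath p q"]) (simp add: segment_convex_hull)
    next
      case 2
      then show ?thesis unfolding 2 curve(1) bentAC_def by (intro bent_arc) (simp_all add: BS)
    next
      case 3
      then show ?thesis unfolding 3 curve(2) bentBD_def by (intro bent_arc) (simp_all add: BS)
    qed
  qed
  have hullW: "v \<in> s" if v: "v \<in> convex hull s" "v \<in> W" and s: "s \<in> S" for v s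
  proof -
    obtain s' where "s' \<in> S" "v \<in> s'" using v(2) unfolding W_def by blast
    then show ?thesis using straight_drawing_vertex[OF SD _ _ _ v(1), of s'] s by blast
  qed
  have cV: "curve G e \<inter> verts G = e" if e: "e \<in> edges G" for e
  proof -
    from e consider "e \<in> S" | "e = {vA, vC}" | "e = {vB, vD}" unfolding G(2) by blast
    then show ?thesis
    proof cases
      case 1
      show ?thesis
      proof
        show "curve G e \<inter> verts G \<subseteq> e" unfolding curve(3)[OF 1] G(1) using hullW[OF _ _ 1] by blast
        show "e \<subseteq> curve G e \<inter> verts G" unfolding curve(3)[OF 1] G(1) using Ssub[OF 1] hull_subset[of e convex] by blast
      qed
    next
      case 2
      have "v \<in> {vA, vC}" if v: "v \<in> bentAC" "v \<in> W" for v
      proof -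
        obtain s where s: "s \<in> S" "v \<in> s" using v(2) unfolding W_def by blast
        then have "v \<in> convex hull s" by (simp add: hull_inc)
        then show ?thesis using straight_bent(1)[OF s(1)] v(1) by blast
      qed
      moreover have "vA \<in> bentAC" "vC \<in> bentAC" by (simp_all add: bentAC_def hull_inc)
      ultimately show ?thesis unfolding 2 curve(1) G(1) using frameW by auto
    next
      case 3
      have "v \<in> {vB, vD}" if v: "v \<in> bentBD" "v \<in> W" for v
      proof -
        obtain s where s: "s \<in> S" "v \<in> s" using v(2) unfolding W_def by blast
        then have "v \<in> convex hull s" by (simp add: hull_inc)
        then show ?thesis using straight_bent(2)[OF s(1)] v(1) by blast
      qed
      moreover have "vB \<in> bentBD" "vD \<in> bentBD" by (simp_all add: bentBD_def hull_inc)
      ultimately show ?thesis unfolding 3 curve(2) G(1) using frameW by auto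
    qed
  qed
  define X where "X = (\<lambda>e f. e \<in> S \<and> f \<in> S \<and> cross_segs e f \<or>
    e = {vA, vC} \<and> f = {vB, vD} \<or> e = {vB, vD} \<and> f = {vA, vC})"
  have dich: "curve G e \<inter> curve G f \<subseteq> e \<inter> f \<or> X e f" if e: "e \<in> edges G" "f \<in> edges G" "e \<noteq> f" for e f
  proof -
    have "e \<in> S \<or> e = {vA, vC} \<or> e = {vB, vD}" "f \<in> S \<or> f = {vA, vC} \<or> f = {vB, vD}"
      using e unfolding G(2) by blast+
    then consider "e \<in> S" "f \<in> S" | "e \<in> S" "f = {vA, vC}" | "e \<in> S" "f = {vB, vD}"
      | "f \<in> S" "e = {vA, vC}" | "f \<in> S" "e = {vB, vD}" | "X e f"
      using e(3) unfolding X_def by (elim disjE; simp)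
    then show ?thesis
    proof cases
      case 1
      have "\<forall>s\<in>S \<union> BS. \<forall>t\<in>S \<union> BS. s \<noteq> t \<longrightarrow> tame s t \<or> cross_segs s t"
        using SD by (simp add: straight_drawing_def)
      then have "tame e f \<or> cross_segs e f" using 1 e(3) by blast
      then show ?thesis unfolding curve(3)[OF 1(1)] curve(3)[OF 1(2)] tame_def X_def using 1 by blast
    next
      case 2 then show ?thesis using straight_bent(1)[OF 2(1)] curve(3)[OF 2(1)] curve(1) by simp
    next
      case 3 then show ?thesis using straight_bent(2)[OF 3(1)] curve(3)[OF 3(1)] curve(2) by simp
    next
      case 4 then show ?thesis using straight_bent(1)[OF 4(1)] curve(3)[OF 4(1)] curve(1) by (simp add: Int_commute)
    next
      case 5 then show ?thesis using straight_bent(2)[OF 5(1)] curve(3)[OF 5(1)] curve(2) by (simp add: Int_commute)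
    qed simp
  qed
  have Xpt: "\<exists>z. curve G e \<inter> curve G f = {z} \<and> z \<notin> verts G \<and> crosses_at (curve G e) (curve G f) z"
    if x: "X e f" for e f
  proof -
    from x consider "e \<in> S" "f \<in> S" "cross_segs e f" | "e = {vA, vC}" "f = {vB, vD}" | "e = {vB, vD}" "f = {vA, vC}"
      unfolding X_def by blast
    then show ?thesis
    proof cases
      case 1
      obtain z where z: "convex hull e \<inter> convex hull f = {z}" "z \<notin> e" "crosses_at (convex hull e) (convex hull f) z"
        using cross_segs_point[OF 1(3)] by metis
      have "z \<notin> W" using hullW[of z e] z 1(1) by blast
      then show ?thesis using z unfolding curve(3)[OF 1(1)] curve(3)[OF 1(2)] G(1) by blast
    next
      case 2
      show ?thesis unfolding 2 curve(1,2) G(1) using bent_bent bent_edges_cross XW by (intro exI[of _ vX] conjI)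
    next
      case 3
      have "bentBD \<inter> bentAC = {vX}" using bent_bent by blast
      then show ?thesis
        unfolding 3 curve(1,2) G(1) using crosses_at_sym[OF bent_edges_cross] XW by (intro exI[of _ vX] conjI)
    qed
  qed
  have Xuniq: "f = g" if "X e f" "X e g" for e f g
  proof (cases "e \<in> S")
    case True
    then have "f \<in> S" "g \<in> S" "cross_segs e f" "cross_segs e g" using that bentS unfolding X_def by metis+
    moreover have "\<forall>s\<in>S \<union> BS. \<forall>t\<in>S \<union> BS. \<forall>u\<in>S \<union> BS. cross_segs s t \<longrightarrow> cross_segs s u \<longrightarrow> t = u"
      using SD by (simp add: straight_drawing_def)
    ultimately show ?thesis using True by blast
  next
    case False
    then show ?thesis using that ne unfolding X_def by metis
  qed
  have finG: "finite (verts G)" using finW G(1) by simp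
  have one: "one_plane G"
    by (rule one_plane_pointsI(1)[where X = X, OF finG G(3)]) (rule E arcs cV dich Xpt Xuniq; assumption)+
  have crX: "X e f" if "e \<in> edges G" "f \<in> edges G" "crosses G e f" for e f
    by (rule one_plane_pointsI(2)[where X = X, OF finG G(3) _ _ _ _ _ _ that])
      (rule E arcs cV dich Xpt Xuniq; assumption)+
  have ncr: "non_crossing G {vA, vB}"
    unfolding non_crossing_def
  proof (intro conjI ballI notI)
    show ABE: "{vA, vB} \<in> edges G" using AB unfolding G(2) S_def by blast
    fix f assume f: "f \<in> edges G" "crosses G {vA, vB} f"
    then have "X {vA, vB} f" using crX[OF ABE f(1)] f(2) by blast
    then have "f \<in> S" "cross_segs {vA, vB} f" unfolding X_def by (auto simp: doubleton_eq_iff)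
    moreover have "{vA, vB} \<noteq> f" using f(2) unfolding crosses_def by blast
    ultimately show False using special[of "{vA, vB}" f] by blast
  qed
  have PN: "P \<inter> N = {}" using glue(2) by blast
  have finP: "finite P" unfolding P_def by simp
  have finN: "finite N" using finS unfolding S_def by simp
  have PNv: "pt ` set V \<inter> \<Union>N = box_corners"
  proof
    show "box_corners \<subseteq> pt ` set V \<inter> \<Union>N" using bcP vs(1) nest(6) by blast
    show "pt ` set V \<inter> \<Union>N \<subseteq> box_corners"
    proof
      fix v assume v: "v \<in> pt ` set V \<inter> \<Union>N"
      then obtain s where s: "s \<in> P" "v \<in> s" using vs(1) by blast
      have "\<bar>Re v\<bar> \<ge> 1 \<or> \<bar>Im v\<bar> \<ge> 1" using off s hull_inc[of v s convex] unfolding off_square_def by blast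
      then have b: "\<bar>Re v\<bar> = 1 \<or> \<bar>Im v\<bar> = 1" using inbox[of v] v by auto
      obtain s' where s': "s' \<in> N" "v \<in> s'" using v by blast
      then show "v \<in> box_corners" using nest(1) b hull_inc[of v s' convex] unfolding square_filling_def by blast
    qed
  qed
  have cbc: "card box_corners = 4"
    unfolding box_corners_def using card_image[OF inj_on_subset[OF inj_pt subset_UNIV]] by (simp add: corners_def)
  have cV': "card (pt ` set V) = length V" using vs(1,2) by simp
  show cW: "card (verts G) = length V + 4 * j"
    unfolding G(1) W using card_Un_Int[of "pt ` set V" "\<Union>N"] nest(3,4) PNv cbc cV' by simp
  have "card S = length L + (2 + 16 * j)"
    unfolding S_def using card_Un_disjoint[OF finP finN PN] vs(3) nest(2) by simp
  moreover have "card (edges G) = card S + 2"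
    unfolding G(2) using card_Un_disjoint[of S "{{vA, vC}, {vB, vD}}"] bentS ne finS by simp
  ultimately show "card (edges G) + 8 = 4 * card (verts G)" using cW t(14) by simp
  \<comment> \<open>Square corners are odd in the pattern and in the nest, so the odd vertices of
    the straight part are those of the frame; each of these is an end of exactly one bent
    edge.\<close>
  have even_deg: "even (vertex_degree G v)" for v
  proof -
    have 1: "odd (card {s \<in> P. v \<in> s}) \<longleftrightarrow> v \<in> pt ` {w \<in> set V. (w \<in> set corners) \<noteq> (w \<in> set frame)}"
      using vs(4) .
    have "pt ` {w \<in> set V. (w \<in> set corners) \<noteq> (w \<in> set frame)} = box_corners \<union> pt ` set frame"
    proof -
      have "set corners \<inter> set frame = {}" by (simp add: corners_def frame_def)
      then have "{w \<in> set V. (w \<in> set corners) \<noteq> (w \<in> set frame)} = set corners \<union> set frame"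
        using t(5,6) by blast
      then show ?thesis unfolding box_corners_def by (simp add: image_Un)
    qed
    moreover have dj: "v \<in> box_corners \<longrightarrow> v \<notin> pt ` set frame"
      by (auto simp: box_corners_def corners_def frame_def)
    ultimately have 2: "odd (card {s \<in> S. v \<in> s}) \<longleftrightarrow> v \<in> pt ` set frame"
      unfolding S_def using odd_card_Un[OF finP finN PN, of v] 1 nest(5)[of v] by blast
    have 3: "odd (card {s \<in> {{vA, vC}, {vB, vD}}. v \<in> s}) \<longleftrightarrow> v \<in> pt ` set frame"
    proof -
      have eq: "{s \<in> {{vA, vC}, {vB, vD}}. v \<in> s} =
          (if v \<in> {vA, vC} then {{vA, vC}} else {}) \<union> (if v \<in> {vB, vD} then {{vB, vD}} else {})" by auto
      have "{vA, vC} \<inter> {vB, vD} = {}" by simp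
      then have "\<not> (v \<in> {vA, vC} \<and> v \<in> {vB, vD})" by blast
      moreover have "v \<in> pt ` set frame \<longleftrightarrow> v \<in> {vA, vC} \<or> v \<in> {vB, vD}" by (auto simp: frame_def)
      ultimately show ?thesis unfolding eq by (cases "v \<in> {vA, vC}"; cases "v \<in> {vB, vD}") simp_all
    qed
    have "S \<inter> {{vA, vC}, {vB, vD}} = {}" using bentS by blast
    then have "even (card {s \<in> S \<union> {{vA, vC}, {vB, vD}}. v \<in> s})"
      using odd_card_Un[OF finS _ _, of "{{vA, vC}, {vB, vD}}" v] 2 3 by blast
    then show ?thesis unfolding vertex_degree_def G(2) .
  qed
  \<comment> \<open>The height of an inner point is a proper convex combination of heights at least
    -20, and it exceeds -20 unless both ends lie on the base line.\<close>
  have above: "v \<in> convex hull {vA, vB} \<or> Im v > -20"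
    if v: "v \<in> convex hull {p, q}" and pq: "p \<noteq> q" "{p, q} \<noteq> {vA, vB}" "p = vA \<or> p = vB \<or> Im p > -20" "q = vA \<or> q = vB \<or> Im q > -20" for v p q
  proof (cases "v = p \<or> v = q")
    case True then show ?thesis using pq(3,4) by (auto simp: hull_inc)
  next
    case False
    obtain t where t: "0 \<le> t" "t \<le> 1" "Re v = Re p + t * (Re q - Re p)" "Im v = Im p + t * (Im q - Im p)"
      using v unfolding hull_pair_iff by blast
    have "t \<noteq> 0" "t \<noteq> 1" using False t(3,4) by (auto simp: complex_eq_iff)
    then have t01: "0 < t" "t < 1" using t by auto
    have ge: "Im p \<ge> -20" "Im q \<ge> -20" using pq(3,4) by auto
    have "Im p > -20 \<or> Im q > -20" using pq by (auto simp: doubleton_eq_iff)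
    then have "0 < (1 - t) * (Im p + 20) \<or> 0 < t * (Im q + 20)"
      using t01 by (auto simp: zero_less_mult_iff)
    moreover have "0 \<le> (1 - t) * (Im p + 20)" "0 \<le> t * (Im q + 20)" using ge t01 by simp_all
    ultimately have "0 < (1 - t) * (Im p + 20) + t * (Im q + 20)"
      by (metis add_nonneg_pos add_pos_nonneg)
    then have "Im v > -20" unfolding t(4) by (simp add: algebra_simps)
    then show ?thesis by blast
  qed
  have WIm: "v = vA \<or> v = vB \<or> Im v > -20" if "v \<in> W" for v
    using that t(8) inbox(2)[of v] unfolding W by fastforce
  have bent_above: "z \<in> convex hull {vA, vB} \<or> Im z > -20" if z: "z \<in> convex hull b" "b \<in> BS" for z b
    using above[of z vA vX] above[of z vX vC] above[of z vB vX] above[of z vX vD] z unfolding BS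
    by (auto simp: doubleton_eq_iff)
  have skel: "z \<in> convex hull {vA, vB} \<or> Im z > -20" if z: "z \<in> skeleton G" for z
  proof -
    from z have "z \<in> W \<or> (\<exists>e\<in>edges G. z \<in> curve G e)" unfolding skeleton_def G(1,3) by auto
    then consider "z \<in> W" | e where "e \<in> S" "z \<in> convex hull e" | "z \<in> bentAC" | "z \<in> bentBD"
      using curve unfolding G(2) by blast
    then show ?thesis
    proof cases
      case 1 then show ?thesis using WIm[OF 1] by (auto simp: hull_inc)
    next
      case 2
      obtain p q where pq: "e = {p, q}" "p \<noteq> q" using cardS[OF 2(1)] by (meson card_2_iff)
      show ?thesis
      proof (cases "e = {vA, vB}")
        case False
        then show ?thesis using above[of z p q] 2 pq WIm[of p] WIm[of q] Ssub[OF 2(1)] by auto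
      qed (use 2 in simp)
    next
      case 3 then show ?thesis using bent_above unfolding bentAC_def BS by blast
    next
      case 4 then show ?thesis using bent_above unfolding bentBD_def BS by blast
    qed
  qed
  show "resting G"
    unfolding resting_def using one G(1,3) frameW even_deg ncr curveAB skel by simp
qed

section \<open>Merging along the resting edge\<close>

lemma connected_subset_component:
  fixes K H :: "complex set"
  assumes "connected H" "H \<noteq> {}" "H \<inter> K = {}"
  obtains F where "F \<in> components (- K)" "H \<subseteq> F"
proof -
  obtain h where h: "h \<in> H" using assms(2) by blast
  have "H \<subseteq> - K" using assms(3) by blast
  then have "H \<subseteq> connected_component_set (- K) h" using connected_component_maximal[OF h assms(1)] by blast
  moreover have "connected_component_set (- K) h \<in> components (- K)"
    unfolding components_def using h \<open>H \<subseteq> - K\<close> by blast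
  ultimately show thesis using that by blast
qed

lemma subset_frontier_face:
  assumes "F \<in> components (- K)" "H \<subseteq> F" "C \<subseteq> closure H" "C \<subseteq> K"
  shows "C \<subseteq> frontier F"
proof
  fix z assume z: "z \<in> C"
  have "z \<notin> F" using in_components_subset[OF assms(1)] assms(4) z by blast
  moreover have "z \<in> closure F" using closure_mono[OF assms(2)] assms(3) z by blast
  ultimately show "z \<in> frontier F" using interior_subset[of F] unfolding frontier_def by blast
qed

text \<open>The labels 0 and 1 are reserved for the ends of the merged edge; a shift by
  \<open>M\<close> keeps the others clear of these two and of the labels \<open>N\<close> already in
  use.\<close>

lemma exists_labelling:
  fixes V :: "'a set" and N :: "nat set"
  assumes "finite V" "finite N" "a \<noteq> b"
  obtains f :: "'a \<Rightarrow> nat" where "inj_on f V" "f a = 0" "f b = 1" "f ` (V - {a, b}) \<inter> (N \<union> {0, 1}) = {}"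
proof -
  obtain h :: "'a \<Rightarrow> nat" where h: "inj_on h V" using finite_imp_inj_to_nat_seg[OF assms(1)] by blast
  define M where "M = Suc (Suc (Max (insert 0 N)))"
  define f where "f = (\<lambda>v. if v = a then 0 else if v = b then 1 else h v + M)"
  have inj: "inj_on f V"
    using h assms(3) unfolding f_def M_def inj_on_def by auto
  have "f v \<notin> N \<union> {0, 1}" if "v \<in> V - {a, b}" for v
  proof -
    have "f v \<ge> M" using that by (simp add: f_def)
    moreover have "x < M" if "x \<in> N" for x
      using that assms(2) by (simp add: M_def less_Suc_eq_le le_SucI)
    ultimately show ?thesis by (force simp: M_def)
  qed
  then have img: "f ` (V - {a, b}) \<inter> (N \<union> {0, 1}) = {}" by blast
  show thesis using that[OF inj _ _ img] assms(3) by (simp add: f_def)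
qed

lemma one_plane_edges:
  assumes "one_plane G" shows "finite (verts G)" "\<And>e. e \<in> edges G \<Longrightarrow> e \<subseteq> verts G \<and> card e = 2"
  using assms unfolding one_plane_def good_drawing_def drawing_def simple_graph_def by auto

lemma closure_halfplanes:
  fixes c :: real
  shows "{z. Im z = c} \<subseteq> closure {z. Im z < c}" "{z. Im z = c} \<subseteq> closure {z. Im z > c}"
proof -
  have "z \<in> closure S" if S: "\<And>e. e > 0 \<Longrightarrow> z + \<i> * of_real (\<sigma> * e) \<in> S" "\<bar>\<sigma>\<bar> = 1" for z S \<sigma>
    unfolding closure_approachable
  proof (intro allI impI)
    fix e :: real assume e: "e > 0"
    have "dist (z + \<i> * of_real (\<sigma> * (e/2))) z < e" using e S(2) by (simp add: dist_norm norm_mult abs_mult)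
    then show "\<exists>y\<in>S. dist y z < e" using S(1)[of "e/2"] e by (intro bexI) auto
  qed
  from this[of _ "-1"] this[of _ 1] show "{z. Im z = c} \<subseteq> closure {z. Im z < c}" "{z. Im z = c} \<subseteq> closure {z. Im z > c}"
    by (auto simp: subset_iff)
qed

lemma resting_edge_line: "z \<in> convex hull {vA, vB} \<Longrightarrow> Im z = -20"
  by (auto simp: hull_pair_iff)

lemma resting_skeleton: "resting G \<Longrightarrow> convex hull {vA, vB} \<subseteq> skeleton G"
  unfolding resting_def non_crossing_def skeleton_def by blast

lemma reflection_homeomorphism:
  "homeomorphism UNIV UNIV (\<lambda>z. cnj z - 40 * \<i>) (\<lambda>z. cnj z - 40 * \<i>)"
proof -
  have i: "cnj (cnj z - 40 * \<i>) - 40 * \<i> = z" for z by (simp add: complex_eq_iff)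
  then have "range (\<lambda>z. cnj z - 40 * \<i>) = UNIV" by (metis surj_def)
  then show ?thesis unfolding homeomorphism_def using i by (auto intro!: continuous_intros)
qed

text \<open>One drawing stands on the common edge and the other, reflected, hangs below it, so the
  second is already in position and the identity serves as its redrawing. The merged edge is the
  only common one, and its ends are the only vertices whose degree changes parity.\<close>

proposition merge_resting:
  assumes G1: "resting G1" "card (edges G1) + 8 = 4 * card (verts G1)"
    and G2: "resting G2" "card (edges G2) + 8 = 4 * card (verts G2)"
    and n: "card (verts G1) \<ge> 3" "card (verts G2) \<ge> 3"
  obtains G :: "nat drawn_graph" where "quasi_optimal G" "card (verts G) + 2 = card (verts G1) + card (verts G2)"
    "card (odd_vertices G) = 2"
proof -
  \<comment> \<open>Reflection in the line of the base edge: imaginary part y becomes -40 - y, which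
    fixes -20.\<close>
  define \<rho> where "\<rho> = (\<lambda>z. cnj z - 40 * \<i>)"
  have hid: "homeomorphism UNIV UNIV (\<lambda>z::complex. z) (\<lambda>z. z)" by (simp add: homeomorphism_def)
  have hrho: "homeomorphism UNIV UNIV \<rho> \<rho>" unfolding \<rho>_def by (rule reflection_homeomorphism)
  have AB: "vA \<noteq> vB" by simp
  have op: "one_plane G1" "one_plane G2" using G1(1) G2(1) by (auto simp: resting_def)
  note e1 = one_plane_edges[OF op(1)] and e2 = one_plane_edges[OF op(2)]
  obtain f1 :: "complex \<Rightarrow> nat" where f1: "inj_on f1 (verts G1)" "f1 vA = 0" "f1 vB = 1"
    using exists_labelling[OF e1(1) finite.emptyI AB] by metis
  have finN: "finite (f1 ` verts G1)" using e1(1) by simp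
  obtain f2 :: "complex \<Rightarrow> nat" where f2: "inj_on f2 (verts G2)" "f2 vA = 0" "f2 vB = 1"
    "f2 ` (verts G2 - {vA, vB}) \<inter> (f1 ` verts G1 \<union> {0, 1}) = {}"
    using exists_labelling[OF e2(1) finN AB] by metis
  define H1 where "H1 = relabel f1 (\<lambda>z. z) G1"
  define H2 where "H2 = relabel f2 \<rho> G2"
  have sub1: "\<forall>e\<in>edges G1. e \<subseteq> verts G1" and sub2: "\<forall>e\<in>edges G2. e \<subseteq> verts G2"
    using e1(2) e2(2) by auto
  note r1 = relabel_simps[OF f1(1) hid sub1, folded H1_def]
  note r2 = relabel_simps[OF f2(1) hrho sub2, folded H2_def]
  have oH: "one_plane H1" "one_plane H2"
    unfolding H1_def H2_def using one_plane_relabel[OF f1(1) hid sub1 op(1)] one_plane_relabel[OF f2(1) hrho sub2 op(2)] by auto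
  have cH: "card (verts H1) = card (verts G1)" "card (edges H1) = card (edges G1)"
    "card (verts H2) = card (verts G2)" "card (edges H2) = card (edges G2)"
    unfolding H1_def H2_def using relabel_card[OF f1(1) hid sub1] relabel_card[OF f2(1) hrho sub2] by auto
  have opt: "optimal_one_plane H1" "optimal_one_plane H2"
    using optimal_one_planeI[OF oH(1)] optimal_one_planeI[OF oH(2)] cH G1(2) G2(2) n by auto
  have AV: "vA \<in> verts G1" "vB \<in> verts G1" "vA \<in> verts G2" "vB \<in> verts G2"
    using G1(1) G2(1) by (auto simp: resting_def)
  let ?I = "convex hull {vA, vB}"
  have img: "f1 ` {vA, vB} = {0, 1}" "f2 ` {vA, vB} = {0, 1}" using f1 f2 by auto
  have nc: "non_crossing G1 {vA, vB}" "non_crossing G2 {vA, vB}" using G1(1) G2(1) by (auto simp: resting_def)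
  have ncH: "non_crossing H1 {0, 1}" "non_crossing H2 {0, 1}"
    using relabel_non_crossing[OF f1(1) hid sub1 nc(1)] relabel_non_crossing[OF f2(1) hrho sub2 nc(2)]
    unfolding H1_def H2_def img by auto
  have ABe: "{vA, vB} \<in> edges G1" "{vA, vB} \<in> edges G2" using nc by (auto simp: non_crossing_def)
  have cur: "curve G1 {vA, vB} = ?I" "curve G2 {vA, vB} = ?I" using G1(1) G2(1) by (auto simp: resting_def)
  have rhoI: "\<rho> z = z" if "z \<in> ?I" for z
    using resting_edge_line[OF that] by (simp add: \<rho>_def complex_eq_iff)
  have c1: "curve H1 {0, 1} = ?I" using r1(4)[OF ABe(1)] cur(1) img(1) by simp
  have c2: "curve H2 {0, 1} = ?I"
  proof -
    have "\<rho> ` ?I = ?I" using rhoI by force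
    then show ?thesis using r2(4)[OF ABe(2)] cur(2) img(2) by simp
  qed
  have sk: "skeleton H1 = skeleton G1" "skeleton H2 = \<rho> ` skeleton G2"
    unfolding H1_def H2_def using relabel_skeleton[OF f1(1) hid sub1] relabel_skeleton[OF f2(1) hrho sub2] by auto
  define LO where "LO = {z::complex. Im z < -20}"
  define UP where "UP = {z::complex. Im z > -20}"
  have s1: "z \<in> ?I \<or> z \<in> UP" if "z \<in> skeleton H1" for z
    using that G1(1) unfolding sk(1) resting_def UP_def by auto
  have s2: "z \<in> ?I \<or> z \<in> LO" if z: "z \<in> skeleton H2" for z
  proof -
    obtain w where w: "w \<in> skeleton G2" "z = \<rho> w" using z unfolding sk(2) by blast
    then have "w \<in> ?I \<or> Im w > -20" using G2(1) by (auto simp: resting_def)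
    then show ?thesis using rhoI w(2) by (auto simp: LO_def \<rho>_def)
  qed
  have Isk: "?I \<subseteq> skeleton H1" "?I \<subseteq> skeleton H2"
    using resting_skeleton[OF G1(1)] resting_skeleton[OF G2(1)] rhoI unfolding sk by force+
  have dis: "LO \<inter> skeleton H1 = {}" "UP \<inter> skeleton H2 = {}"
    using s1 s2 resting_edge_line by (force simp: LO_def UP_def)+
  have LU: "LO = Im -` {..<-20}" "UP = Im -` {-20<..}" by (auto simp: LO_def UP_def)
  have "linear Im" by (simp add: bounded_linear_Im bounded_linear.linear)
  then have con: "connected LO" "connected UP"
    unfolding LU by (auto intro!: convex_connected convex_linear_vimage)
  have "Complex 0 (-21) \<in> LO" "Complex 0 0 \<in> UP" by (auto simp: LO_def UP_def)
  then have ne: "LO \<noteq> {}" "UP \<noteq> {}" by auto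
  \<comment> \<open>Apart from the base edge, \<open>H1\<close> lies above the line. The open lower
    half-plane is therefore within one face of \<open>H1\<close>, which receives \<open>H2\<close>
    and has the base edge on its frontier. In the same way the upper half-plane lies in a face of
    \<open>H2\<close>, which is unbounded.\<close>
  obtain F where F: "F \<in> components (- skeleton H1)" "LO \<subseteq> F" using connected_subset_component[OF con(1) ne(1) dis(1)] .
  obtain F' where F': "F' \<in> components (- skeleton H2)" "UP \<subseteq> F'" using connected_subset_component[OF con(2) ne(2) dis(2)] .
  have "?I \<subseteq> {z. Im z = -20}" using resting_edge_line by blast
  then have cl: "?I \<subseteq> closure LO" "?I \<subseteq> closure UP"
    using closure_halfplanes[of "-20"] unfolding LO_def UP_def by blast+
  have fr: "?I \<subseteq> frontier F" "?I \<subseteq> frontier F'"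
    using subset_frontier_face[OF F cl(1) Isk(1)] subset_frontier_face[OF F' cl(2) Isk(2)] by auto
  have unb: "\<not> bounded F'"
  proof
    assume "bounded F'"
    then obtain B where B: "\<And>z. z \<in> F' \<Longrightarrow> norm z \<le> B" unfolding bounded_iff by blast
    have "Complex 0 (\<bar>B\<bar> + 1) \<in> F'" using F'(2) by (auto simp: UP_def)
    then have "norm (Complex 0 (\<bar>B\<bar> + 1)) \<le> B" using B by blast
    then show False using abs_Im_le_cmod[of "Complex 0 (\<bar>B\<bar> + 1)"] by simp
  qed
  have meet: "verts H1 \<inter> verts H2 = {0, 1}"
  proof -
    have v2: "verts G2 = {vA, vB} \<union> (verts G2 - {vA, vB})" using AV by auto
    have "verts H2 = {0, 1} \<union> f2 ` (verts G2 - {vA, vB})"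
      unfolding r2(1) by (subst v2) (simp only: image_Un img(2))
    moreover have "{0, 1} \<subseteq> verts H1"
      unfolding r1(1) using imageI[OF AV(1), of f1] imageI[OF AV(2), of f1] f1(2,3) by simp
    moreover have "f2 ` (verts G2 - {vA, vB}) \<inter> (verts H1 \<union> {0, 1}) = {}" using f2(4) unfolding r1(1) .
    moreover have "A \<inter> B = Z" if "B = Z \<union> R" "Z \<subseteq> A" "R \<inter> (A \<union> Z) = {}" for A B Z R :: "nat set"
      using that by blast
    ultimately show ?thesis by meson
  qed
  have loc: "loc H2 v = loc H1 v" if "v \<in> {0, 1}" for v
  proof -
    have l: "loc G1 v = v" "loc G2 v = v" for v using G1(1) G2(1) by (auto simp: resting_def)
    have "loc H1 (f1 vA) = vA" "loc H1 (f1 vB) = vB" using r1(3) AV l by auto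
    moreover have "loc H2 (f2 vA) = vA" "loc H2 (f2 vB) = vB"
      using r2(3) AV l rhoI by (simp_all add: hull_inc)
    moreover have "v = 0 \<or> v = 1" using that by simp
    ultimately show ?thesis using f1(2,3) f2(2,3) by (elim disjE) simp_all
  qed
  define G where "G = \<lparr>verts = verts H1 \<union> verts H2, edges = edges H1 \<union> edges H2,
    loc = (\<lambda>v. if v \<in> verts H1 then loc H1 v else loc H2 v),
    curve = (\<lambda>e. if e \<in> edges H1 then curve H1 e else curve H2 e)\<rparr>"
  have Gs: "verts G = verts H1 \<union> verts H2" "edges G = edges H1 \<union> edges H2"
    "loc G v = (if v \<in> verts H1 then loc H1 v else loc H2 v)"
    "curve G e = (if e \<in> edges H1 then curve H1 e else curve H2 e)" for v e
    by (simp_all add: G_def)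
  have eH1: "e \<subseteq> verts H1 \<and> card e = 2" if "e \<in> edges H1" for e using one_plane_edges[OF oH(1)] that by blast
  have eH2: "e \<subseteq> verts H2 \<and> card e = 2" if "e \<in> edges H2" for e using one_plane_edges[OF oH(2)] that by blast
  have e01: "{0, 1} \<in> edges H1" "{0, 1} \<in> edges H2" using ncH by (auto simp: non_crossing_def)
  have emeet: "edges H1 \<inter> edges H2 = {{0, 1}}"
  proof -
    have "e = {0, 1}" if e: "e \<in> edges H1" "e \<in> edges H2" for e
    proof (rule card_subset_eq)
      show "e \<subseteq> {0, 1}" using eH1[OF e(1)] eH2[OF e(2)] meet by blast
      show "card e = card {0, 1::nat}" using eH1[OF e(1)] by simp
    qed simp
    then show ?thesis using e01 by blast
  qed
  have merg: "edge_merging H1 {0, 1} H2 {0, 1} G"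
    unfolding edge_merging_def
  proof (intro conjI oH ncH)
    have "redrawing id H2 H2"
      unfolding redrawing_def by (intro conjI exI[of _ id]) (simp_all add: homeomorphic_map_id)
    moreover have "skeleton H2 - curve H2 {0, 1} \<subseteq> F" using s2 F(2) unfolding c2 by blast
    moreover have "\<forall>v\<in>verts H2. loc G v = loc H2 v"
    proof
      fix v assume v: "v \<in> verts H2"
      show "loc G v = loc H2 v"
      proof (cases "v \<in> verts H1")
        case True
        then have "v \<in> {0, 1}" using v meet by blast
        then show ?thesis using loc True Gs(3) by simp
      qed (simp add: Gs(3))
    qed
    moreover have "\<forall>e\<in>edges H2. curve G e = curve H2 e"
    proof
      fix e assume e: "e \<in> edges H2"
      show "curve G e = curve H2 e"
      proof (cases "e \<in> edges H1")
        case True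
        then have "e = {0, 1}" using e emeet by blast
        then show ?thesis using c1 c2 Gs(4) by simp
      qed (simp add: Gs(4))
    qed
    ultimately show "\<exists>s H F F'. redrawing s H2 H \<and>
        F' \<in> faces H \<and> \<not> bounded F' \<and> curve H (s ` {0, 1}) \<subseteq> frontier F' \<and>
        F \<in> faces H1 \<and> curve H1 {0, 1} \<subseteq> frontier F \<and>
        s ` {0, 1} = {0, 1} \<and> verts H1 \<inter> verts H = {0, 1} \<and>
        (\<forall>v\<in>{0, 1}. loc H v = loc H1 v) \<and> curve H {0, 1} = curve H1 {0, 1} \<and>
        skeleton H - curve H {0, 1} \<subseteq> F \<and>
        verts G = verts H1 \<union> verts H \<and> edges G = edges H1 \<union> edges H \<and>
        (\<forall>v\<in>verts H1. loc G v = loc H1 v) \<and> (\<forall>v\<in>verts H. loc G v = loc H v) \<and>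
        (\<forall>e\<in>edges H1. curve G e = curve H1 e) \<and> (\<forall>e\<in>edges H. curve G e = curve H e)"
      using F(1) F'(1) unb fr meet loc c1 c2
      by (intro exI[of _ id] exI[of _ H2] exI[of _ F] exI[of _ F']) (simp add: faces_def Gs)
  qed
  have "quasi_optimal G"
    by (rule quasi_optimal.merging[OF _ _ merg]) (rule quasi_optimal.optimal, rule opt)+
  moreover have fin: "finite (verts H1)" "finite (verts H2)" using one_plane_edges oH by auto
  then have "card (verts G) + 2 = card (verts G1) + card (verts G2)"
    using card_Un_Int[of "verts H1" "verts H2"] meet cH by (simp add: Gs)
  moreover have "odd_vertices G = {0, 1}"
  proof -
    have even1: "even (vertex_degree H1 v)" if v: "v \<in> verts H1" for v
    proof -
      obtain u where "u \<in> verts G1" "v = f1 u" using v unfolding r1(1) by blast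
      then show ?thesis
        using relabel_vertex_degree[OF f1(1) hid sub1, folded H1_def] G1(1) by (simp add: resting_def)
    qed
    have even2: "even (vertex_degree H2 v)" if v: "v \<in> verts H2" for v
    proof -
      obtain u where "u \<in> verts G2" "v = f2 u" using v unfolding r2(1) by blast
      then show ?thesis
        using relabel_vertex_degree[OF f2(1) hrho sub2, folded H2_def] G2(1) by (simp add: resting_def)
    qed
    have finE: "finite (edges H1)" "finite (edges H2)"
      using fin eH1 eH2 by (meson PowI finite_Pow_iff finite_subset subsetI)+
    \<comment> \<open>Inclusion and exclusion: the merged edge is counted in both degrees but occurs
      once.\<close>
    have deg: "vertex_degree G v + card {e \<in> {{0, 1}}. v \<in> e} = vertex_degree H1 v + vertex_degree H2 v" for v
    proof -
      have "{e \<in> edges G. v \<in> e} = {e \<in> edges H1. v \<in> e} \<union> {e \<in> edges H2. v \<in> e}" unfolding Gs(2) by blast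
      moreover have "{e \<in> {{0, 1}}. v \<in> e} = {e \<in> edges H1. v \<in> e} \<inter> {e \<in> edges H2. v \<in> e}" using emeet by blast
      ultimately show ?thesis
        using card_Un_Int[of "{e \<in> edges H1. v \<in> e}" "{e \<in> edges H2. v \<in> e}"] finE by (simp add: vertex_degree_def)
    qed
    have zero1: "vertex_degree H1 v = 0" if "v \<notin> verts H1" for v
      using that eH1 by (auto simp: vertex_degree_def card_eq_0_iff)
    have zero2: "vertex_degree H2 v = 0" if "v \<notin> verts H2" for v
      using that eH2 by (auto simp: vertex_degree_def card_eq_0_iff)
    have evens: "even (vertex_degree H1 v + vertex_degree H2 v)" for v
      using even1[of v] even2[of v] zero1[of v] zero2[of v] by (cases "v \<in> verts H1"; cases "v \<in> verts H2") auto
    have od: "odd (vertex_degree G v) \<longleftrightarrow> v \<in> {0, 1}" for v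
    proof -
      have "{e \<in> {{0, 1}}. v \<in> e} = (if v \<in> {0, 1} then {{0, 1}} else {})" by auto
      then have c: "card {e \<in> {{0, 1}}. v \<in> e} = (if v \<in> {0, 1} then 1 else 0)" by simp
      have "even (vertex_degree G v + (if v \<in> {0, 1} then 1 else 0))"
        unfolding c[symmetric] deg by (rule evens)
      then show ?thesis by (cases "v \<in> {0, 1}") simp_all
    qed
    have "{0, 1} \<subseteq> verts G" using meet unfolding Gs(1) by blast
    moreover have "odd_vertices G = {v \<in> verts G. v \<in> {0, 1}}" unfolding odd_vertices_def by (simp only: od)
    ultimately show ?thesis by auto
  qed
  then have "card (odd_vertices G) = 2" by simp
  ultimately show thesis using that[of G] by blast
qed

section \<open>The drawings with 8, 10, 11 and 13 vertices\<close>

text \<open>One face of each of these quadrangulations is the square with corners (+-1,+-1), left empty for the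
  nest.  The underlying quadrangulations are the cube, the pseudo-double wheel with rim length 8, and the
  pseudo-double wheels with rim lengths 8 and 10 in which one apex is split into two.\<close>

definition segments_8 :: "iseg list" where
  "segments_8 = [
    ((60, - 20), (- 60, - 20)), ((- 60, - 20), (- 20, 30)), ((- 20, 30), (20, 30)),
    ((20, 30), (60, - 20)), ((1, - 1), (- 1, - 1)), ((- 1, - 1), (- 60, - 20)),
    ((60, - 20), (1, - 1)), ((- 1, - 1), (- 1, 1)), ((- 1, 1), (- 20, 30)), ((- 1, 1), (1, 1)),
    ((1, 1), (20, 30)), ((1, 1), (1, - 1)), ((1, - 1), (- 60, - 20)), ((- 1, - 1), (60, - 20)),
    ((- 1, - 1), (- 20, 30)), ((- 1, 1), (- 60, - 20)), ((- 1, 1), (20, 30)),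
    ((1, 1), (- 20, 30)), ((1, 1), (60, - 20)), ((1, - 1), (20, 30))]"

definition vertices_8 :: "ipt list" where
  "vertices_8 = [
    (- 60, - 20), (60, - 20), (20, 30), (- 20, 30), (- 1, - 1), (1, - 1), (1, 1), (- 1, 1)]"

definition segments_10 :: "iseg list" where
  "segments_10 = [
    ((60, - 20), (1, - 1)), ((1, - 1), (- 1, - 1)), ((- 1, - 1), (- 4, - 10)),
    ((- 4, - 10), (60, - 20)), ((- 4, - 10), (- 26, - 11)), ((- 26, - 11), (- 60, - 20)),
    ((- 60, - 20), (60, - 20)), ((- 60, - 20), (- 20, 30)), ((- 20, 30), (20, 30)),
    ((20, 30), (60, - 20)), ((20, 30), (1, 1)), ((1, 1), (1, - 1)), ((- 1, 1), (- 26, - 11)),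
    ((- 1, - 1), (- 1, 1)), ((- 1, 1), (- 20, 30)), ((- 1, 1), (1, 1)),
    ((60, - 20), (- 1, - 1)), ((1, - 1), (- 4, - 10)), ((60, - 20), (- 26, - 11)),
    ((- 4, - 10), (- 60, - 20)), ((60, - 20), (1, 1)), ((20, 30), (1, - 1)),
    ((- 1, 1), (- 4, - 10)), ((- 26, - 11), (- 1, - 1)), ((- 1, 1), (- 60, - 20)),
    ((- 20, 30), (- 26, - 11)), ((- 1, 1), (20, 30)), ((1, 1), (- 20, 30))]"

definition vertices_10 :: "ipt list" where
  "vertices_10 = [
    (- 60, - 20), (60, - 20), (20, 30), (- 20, 30), (- 1, - 1), (1, - 1), (1, 1), (- 1, 1),
    (- 4, - 10), (- 26, - 11)]"

definition segments_11 :: "iseg list" where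
  "segments_11 = [
    ((- 10, - 2), (60, - 20)), ((60, - 20), (1, - 1)), ((1, - 1), (- 1, - 1)),
    ((- 1, - 1), (- 10, - 2)), ((- 1, - 1), (- 1, 1)), ((- 1, 1), (- 36, 3)),
    ((- 36, 3), (- 10, - 2)), ((- 60, - 20), (- 36, 3)), ((- 36, 3), (- 22, 22)),
    ((- 22, 22), (- 20, 30)), ((- 20, 30), (- 60, - 20)), ((- 20, 30), (20, 30)),
    ((20, 30), (60, - 20)), ((60, - 20), (- 60, - 20)), ((1, 1), (- 1, 1)), ((1, - 1), (1, 1)),
    ((1, 1), (- 22, 22)), ((1, 1), (20, 30)), ((- 10, - 2), (1, - 1)),
    ((60, - 20), (- 1, - 1)), ((- 10, - 2), (- 1, 1)), ((- 1, - 1), (- 36, 3)),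
    ((- 60, - 20), (- 22, 22)), ((- 36, 3), (- 20, 30)), ((1, 1), (- 36, 3)),
    ((- 22, 22), (- 1, 1)), ((1, 1), (- 20, 30)), ((20, 30), (- 22, 22)), ((1, 1), (60, - 20)),
    ((1, - 1), (20, 30)), ((- 10, - 2), (- 60, - 20)), ((- 36, 3), (60, - 20))]"

definition vertices_11 :: "ipt list" where
  "vertices_11 = [
    (- 60, - 20), (60, - 20), (20, 30), (- 20, 30), (- 1, - 1), (1, - 1), (1, 1), (- 1, 1),
    (- 10, - 2), (- 36, 3), (- 22, 22)]"

definition segments_13 :: "iseg list" where
  "segments_13 = [
    ((60, - 20), (- 60, - 20)), ((- 60, - 20), (- 20, 30)), ((- 20, 30), (20, 30)),
    ((20, 30), (60, - 20)), ((20, 30), (29, 4)), ((29, 4), (30, 3)), ((30, 3), (60, - 20)),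
    ((7, - 2), (30, 3)), ((30, 3), (1, 1)), ((1, 1), (1, - 1)), ((1, - 1), (7, - 2)),
    ((1, - 1), (- 1, - 1)), ((- 1, - 1), (- 3, - 4)), ((- 3, - 4), (7, - 2)),
    ((- 3, - 4), (- 35, - 12)), ((- 35, - 12), (- 60, - 20)), ((- 60, - 20), (7, - 2)),
    ((- 1, 1), (29, 4)), ((- 20, 30), (- 1, 1)), ((- 1, 1), (1, 1)), ((- 1, 1), (- 1, - 1)),
    ((- 1, 1), (- 35, - 12)), ((60, - 20), (29, 4)), ((20, 30), (30, 3)), ((7, - 2), (1, 1)),
    ((30, 3), (1, - 1)), ((7, - 2), (- 1, - 1)), ((1, - 1), (- 3, - 4)),
    ((7, - 2), (- 35, - 12)), ((- 3, - 4), (- 60, - 20)), ((- 1, 1), (20, 30)),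
    ((29, 4), (- 20, 30)), ((- 1, 1), (30, 3)), ((1, 1), (29, 4)), ((- 1, 1), (- 3, - 4)),
    ((- 35, - 12), (- 1, - 1)), ((- 1, 1), (- 60, - 20)), ((- 20, 30), (- 35, - 12)),
    ((60, - 20), (7, - 2)), ((30, 3), (- 60, - 20))]"

definition vertices_13 :: "ipt list" where
  "vertices_13 = [
    (- 60, - 20), (60, - 20), (20, 30), (- 20, 30), (- 1, - 1), (1, - 1), (1, 1), (- 1, 1),
    (29, 4), (30, 3), (7, - 2), (- 3, - 4), (- 35, - 12)]"

lemma pattern_tests:
  "pattern_test segments_8 vertices_8" "pattern_test segments_10 vertices_10"
  "pattern_test segments_11 vertices_11" "pattern_test segments_13 vertices_13"
  by code_simp+

lemma pattern_lengths:
  "length vertices_8 = 8" "length vertices_10 = 10" "length vertices_11 = 11" "length vertices_13 = 13"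
  by (simp_all add: vertices_8_def vertices_10_def vertices_11_def vertices_13_def)

proposition exists_resting:
  assumes "m = 8 \<or> m \<ge> 10"
  obtains G where "resting G" "card (verts G) = m" "card (edges G) + 8 = 4 * card (verts G)"
proof -
  \<comment> \<open>The four base sizes represent all residues modulo 4; the class of 1 begins with
    13, so 9 is the only number above 8 that is left out.\<close>
  have "\<exists>j. m = 8 + 4 * j \<or> m = 10 + 4 * j \<or> m = 11 + 4 * j \<or> m = 13 + 4 * j"
    using assms by presburger
  then obtain j L V where "pattern_test L V" "m = length V + 4 * j"
    using pattern_tests pattern_lengths by metis
  then show thesis using nested_drawing_properties that by metis
qed

theorem theorem1p3:
  fixes n :: nat
  assumes "n = 14 \<or> n \<ge> 16"
  shows "\<exists>G :: nat drawn_graph.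
           quasi_optimal G \<and> card (verts G) = n \<and> card (odd_vertices G) = 2"
proof -
  obtain G1 where G1: "resting G1" "card (verts G1) = 8" "card (edges G1) + 8 = 4 * card (verts G1)"
    using exists_resting[of 8] by blast
  \<comment> \<open>The sizes have to satisfy 8 + m - 2 = n. The excluded value n = 15 corresponds
    to m = 9.\<close>
  have "n - 6 = 8 \<or> n - 6 \<ge> 10" using assms by auto
  then obtain G2 where G2: "resting G2" "card (verts G2) = n - 6" "card (edges G2) + 8 = 4 * card (verts G2)"
    using exists_resting[of "n - 6"] by blast
  have "card (verts G1) \<ge> 3" "card (verts G2) \<ge> 3" using G1(2) G2(2) assms by auto
  then obtain G :: "nat drawn_graph" where G: "quasi_optimal G"
    "card (verts G) + 2 = card (verts G1) + card (verts G2)" "card (odd_vertices G) = 2"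
    using merge_resting[OF G1(1,3) G2(1,3)] by blast
  have "card (verts G) = n" using G(2) G1(2) G2(2) assms by auto
  then show ?thesis using G by blast
qed

end
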